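(* Let $l,k\ge 1$ be integers, $n=l+k$, $E=\mathbb{C}^n$. If $\lambda=(\lambda_1\ge\dots\ge\lambda_l\ge0)$ is a partition contained in an $l\times k$ rectangle (i.e. $\lambda_1\le k$), then the Schubert class $\sigma_\lambda$ in the small quantum cohomology ring $QH^*\operatorname{Gr}(l,E)$ is given by $$\sigma_\lambda=\det(\sigma_{\lambda_i+j-i})_{1\le i,j\le l},$$ where the determinant is computed in $QH^*\operatorname{Gr}(l,E)$, and $\sigma_i=0$ for $i<0$ and for $k<i<n$.
   Context: $X=\operatorname{Gr}(l,E)$ is the Grassmannian of $l$-dimensional subspaces of $E=\mathbb{C}^n$. For a partition $\lambda$ write $|\lambda|=\sum\lambda_i$. For a complete flag $F_1\subset F_2\subset\dots\subset F_n=E$ ($\dim F_i=i$) and a partition $\lambda=(\lambda_1\ge\dots\ge\lambda_l\ge0)$ with $\lambda_1\le k$, the Schubert variety is $\Omega_\lambda(F_\bullet)=\{V\in X\mid \dim(V\cap F_{k+i-\lambda_i})\ge i\ \ \forall\,1\le i\le l\}$; it has codimension $|\lambda|$, and $\Omega_\lambda\in H^*X=H^*(X;\mathbb{Z})$ denotes its class. The classes $\Omega_\lambda$, for $\lambda$ contained in the $l\times k$ rectangle, form a $\mathbb{Z}$-basis of $H^*X$. An integer $p$ with $0\le p\le k$ is identified with the one-row partition $(p)$, so $\sigma_p=\sigma_{(p)}$ and $\sigma_0=1$. The degree of a regular map $f:\mathbb{P}^1\to\mathbb{P}^N$ is the number of points in the inverse image of a general hyperplane; the degree of a map $\mathbb{P}^1\to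 X$ is that of its composition with the Plücker embedding $X\subset\mathbb{P}(\bigwedge^l E)$. For partitions $\lambda,\mu,\nu$ in the $l\times k$ rectangle and $d\ge0$ with $|\lambda|+|\mu|+|\nu|=lk+dn$, the Gromov-Witten invariant $\langle\Omega_\lambda,\Omega_\mu,\Omega_\nu\rangle_d$ is the number of rational curves $f:\mathbb{P}^1\to X$ of degree $d$ which meet all of $\Omega_\lambda(F_\bullet),\Omega_\mu(G_\bullet),\Omega_\nu(H_\bullet)$ for general flags $F_\bullet,G_\bullet,H_\bullet$, up to automorphisms of $\mathbb{P}^1$. If $|\lambda|+|\mu|+|\nu|\ne lk+dn$ the invariant is $0$. The (small) quantum cohomology ring $QH^*X$ is $H^*X\otimes_{\mathbb{Z}}\mathbb{Z}[q]$ as a $\mathbb{Z}[q]$-module, with Schubert classes $\sigma_\lambda=\Omega_\lambda\otimes1$ and $\mathbb{Z}[q]$-bilinear product $\sigma_\lambda\cdot\sigma_\mu=\sum_{\nu,\,d\ge0}\langle\Omega_\lambda,\Omega_\mu,\Omega_{\nu^\vee}\rangle_d\,q^d\,\sigma_\nu$, where $\nu^\vee=(k-\nu_l,\dots,k-\nu_1)$. It is a known fact, assumed here, that this defines an associative (commutative) ring. *)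

theory Defs
  imports
    "HOL-Analysis.Analysis"
    "HOL-Algebra.Ring"
    "HOL-Combinatorics.Permutations"
    "HOL-Computational_Algebra.Polynomial"
begin

section \<open>General points\<close>

inductive_set polynomial_maps :: "('a \<Rightarrow> complex) set \<Rightarrow> ('a \<Rightarrow> complex) set"
  for C :: "('a \<Rightarrow> complex) set"
  where
    coord: "c \<in> C \<Longrightarrow> c \<in> polynomial_maps C"
  | const: "(\<lambda>_. a) \<in> polynomial_maps C"
  | add: "f \<in> polynomial_maps C \<Longrightarrow> g \<in> polynomial_maps C \<Longrightarrow> (\<lambda>x. f x + g x) \<in> polynomial_maps C"
  | mult: "f \<in> polynomial_maps C \<Longrightarrow> g \<in> polynomial_maps C \<Longrightarrow> (\<lambda>x. f x * g x) \<in> polynomial_maps C"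

text \<open>
  \<open>Q\<close> holds on a nonempty Zariski open subset of the affine space with coordinate functions \<open>C\<close>.
  Every nonempty open subset contains a nonempty principal one, and those are dense.
\<close>

definition for_general :: "('a \<Rightarrow> complex) set \<Rightarrow> ('a \<Rightarrow> bool) \<Rightarrow> bool" where
  "for_general C Q \<longleftrightarrow>
     (\<exists>p\<in>polynomial_maps C. (\<exists>x. p x \<noteq> 0) \<and> (\<forall>x. p x \<noteq> 0 \<longrightarrow> Q x))"


section \<open>Grassmannians, projective spaces and regular maps from the projective line\<close>

text \<open>
  On \<open>complex ^ 'n\<close> the unqualified \<open>subspace\<close>, \<open>span\<close> and \<open>dim\<close> are those of the underlying real
  vector space; the complex ones are \<open>vec.subspace\<close>, \<open>vec.span\<close> and \<open>vec.dim\<close>.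
\<close>

definition Gr :: "nat \<Rightarrow> (complex ^ 'n) set set" where
  "Gr l = {V. vec.subspace V \<and> vec.dim V = l}"

abbreviation Proj :: "(complex ^ 'i) set set" where
  "Proj \<equiv> Gr 1"

abbreviation P1 :: "(complex ^ 2) set set" where
  "P1 \<equiv> Proj"

text \<open>The tuple of binary forms of degree \<open>m\<close> with coefficient vectors \<open>a 0, \<dots>, a m\<close>.\<close>

definition binary_form :: "nat \<Rightarrow> (nat \<Rightarrow> complex ^ 'i) \<Rightarrow> complex ^ 2 \<Rightarrow> complex ^ 'i" where
  "binary_form m a u = (\<Sum>i\<le>m. (u $ 1 ^ i * u $ 2 ^ (m - i)) *s a i)"

text \<open>
  Locally in the Zariski topology, \<open>\<phi>\<close> is given by forms of equal degree without common zeros.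
  The nonempty Zariski open subsets of the projective line are the cofinite ones. That the forms
  have no common zero on \<open>U\<close> follows from \<open>\<phi> y \<in> Proj\<close>.
\<close>

definition regular_map :: "((complex ^ 2) set \<Rightarrow> (complex ^ 'i) set) \<Rightarrow> bool" where
  "regular_map \<phi> \<longleftrightarrow>
     (\<forall>x\<in>P1. \<phi> x \<in> Proj) \<and>
     (\<forall>x\<in>P1. \<exists>U m a. x \<in> U \<and> U \<subseteq> P1 \<and> finite (P1 - U) \<and>
        (\<forall>y\<in>U. \<forall>u\<in>y - {0}. \<phi> y = vec.span {binary_form m a u}))"

definition hyperplane :: "complex ^ 'i \<Rightarrow> (complex ^ 'i) set" where
  "hyperplane c = {z. (\<Sum>i\<in>UNIV. c $ i * z $ i) = 0}"

definition has_degree :: "((complex ^ 2) set \<Rightarrow> (complex ^ 'i) set) \<Rightarrow> nat \<Rightarrow> bool" where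
  "has_degree \<phi> d \<longleftrightarrow>
     for_general (range (\<lambda>i (c :: complex ^ 'i). c $ i))
       (\<lambda>c. finite {x \<in> P1. \<phi> x \<subseteq> hyperplane c} \<and> card {x \<in> P1. \<phi> x \<subseteq> hyperplane c} = d)"

text \<open>
  The notation \<open>complex ^ 'n\<close> fixes the sort of \<open>'n\<close> to be just \<open>finite\<close>, so \<open>(complex, 'n) vec\<close> is used
  where an order on \<open>'n\<close> may be needed. Taking \<open>'n\<close> linearly ordered only serves to number the
  standard basis vectors.
\<close>

type_synonym 'n curve = "(complex ^ 2) set \<Rightarrow> (complex, 'n) vec set"
type_synonym 'n flag = "nat \<Rightarrow> (complex, 'n) vec set"

definition P1_automorphism :: "2 curve \<Rightarrow> bool" where
  "P1_automorphism \<phi> \<longleftrightarrow>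
     regular_map \<phi> \<and> (\<exists>\<psi>. regular_map \<psi> \<and> (\<forall>x\<in>P1. \<psi> (\<phi> x) = x \<and> \<phi> (\<psi> x) = x))"

text \<open>
  The type \<open>complex ^ ('n set)\<close> serves as the exterior algebra of \<open>complex ^ 'n\<close>: the coordinate \<open>I\<close>
  belongs to the wedge product of the standard basis vectors with index in \<open>I\<close>, in increasing
  order. The degree \<open>l\<close> part consists of the vectors supported on the \<open>I\<close> of cardinality \<open>l\<close>. Passing
  to the larger projective space does not change degrees of maps, because general hyperplanes
  restrict to general hyperplanes. The coordinates of \<open>wedge l v\<close> are the maximal minors, by the
  Leibniz formula.
\<close>

definition wedge :: "nat \<Rightarrow> (nat \<Rightarrow> complex ^ 'n::{finite,linorder}) \<Rightarrow> complex ^ ('n set)" where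
  "wedge l v = (\<chi> I. if card I = l
     then \<Sum>\<pi> | \<pi> permutes {..<l}.
            of_int (sign \<pi>) * (\<Prod>i<l. v (\<pi> i) $ (sorted_list_of_set I ! i))
     else 0)"

definition plucker :: "nat \<Rightarrow> (complex ^ 'n::{finite,linorder}) set \<Rightarrow> (complex ^ ('n set)) set" where
  "plucker l V = vec.span {wedge l v | v. \<forall>i<l. v i \<in> V}"

text \<open>A map into the closed subvariety \<open>Gr l\<close> is regular iff its composition with the Pluecker
  embedding is.\<close>

definition rational_curves :: "nat \<Rightarrow> nat \<Rightarrow> 'n::{finite,linorder} curve set" where
  "rational_curves l d =
     {f \<in> P1 \<rightarrow>\<^sub>E Gr l. regular_map (plucker l \<circ> f) \<and> has_degree (plucker l \<circ> f) d}"

definition reparametrization :: "('n::finite curve \<times> 'n curve) set" where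
  "reparametrization = {(f, g). \<exists>\<phi>. P1_automorphism \<phi> \<and> (\<forall>x\<in>P1. g x = f (\<phi> x))}"


section \<open>Flags and Schubert varieties\<close>

text \<open>Only the values \<open>F i\<close> with \<open>i \<le> CARD('n)\<close> matter.\<close>

definition complete_flag :: "'n::finite flag \<Rightarrow> bool" where
  "complete_flag F \<longleftrightarrow>
     (\<forall>i\<le>CARD('n). vec.subspace (F i) \<and> vec.dim (F i) = i) \<and>
     (\<forall>i<CARD('n). F i \<subseteq> F (Suc i))"

text \<open>The first \<open>i\<close> rows of \<open>A\<close> span \<open>F i\<close>.\<close>

definition adapted_basis ::
    "((complex, 'n) vec, 'n) vec \<Rightarrow> 'n::{finite,linorder} flag \<Rightarrow> bool" where
  "adapted_basis A F \<longleftrightarrow> (\<forall>i\<le>CARD('n). F i = vec.span {A $ j | j. card {..<j} < i})"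

text \<open>
  The variety of complete flags is the quotient of \<open>GL(n)\<close>, an open subset of matrix space, by the
  open map sending a basis to the flag it spans. So a property holds for general triples of flags
  iff, for a general triple of matrices, it holds whenever these are bases adapted to the flags.
\<close>

definition for_general_flags ::
    "('n::{finite,linorder} flag \<Rightarrow> 'n flag \<Rightarrow> 'n flag \<Rightarrow> bool) \<Rightarrow> bool" where
  "for_general_flags Q \<longleftrightarrow>
     for_general {\<lambda>M :: ((complex, 'n) vec, 'n) vec ^ 3. M $ r $ i $ j | r i j. True}
       (\<lambda>M. \<forall>F G H. complete_flag F \<longrightarrow> complete_flag G \<longrightarrow> complete_flag H \<longrightarrow>
          adapted_basis (M $ 1) F \<longrightarrow> adapted_basis (M $ 2) G \<longrightarrow> adapted_basis (M $ 3) H \<longrightarrow>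
          Q F G H)"

definition partitions_in :: "nat \<Rightarrow> nat \<Rightarrow> nat list set" where
  "partitions_in l k = {lam. length lam = l \<and> sorted_wrt (\<ge>) lam \<and> set lam \<subseteq> {..k}}"

text \<open>List positions start at 0, so the i-th part is \<open>lam ! (i - 1)\<close>.\<close>

definition schubert ::
    "nat \<Rightarrow> nat \<Rightarrow> nat list \<Rightarrow> 'n::finite flag \<Rightarrow> (complex, 'n) vec set set" where
  "schubert l k lam F =
     {V \<in> Gr l. \<forall>i\<in>{1..l}. vec.dim (V \<inter> F (k + i - lam ! (i - 1))) \<ge> i}"

definition dual_partition :: "nat \<Rightarrow> nat list \<Rightarrow> nat list" where
  "dual_partition k nu = rev (map (\<lambda>p. k - p) nu)"


section \<open>Gromov-Witten invariants\<close>

definition meeting_curves ::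
    "nat \<Rightarrow> nat \<Rightarrow> (complex, 'n) vec set set \<Rightarrow> (complex, 'n) vec set set \<Rightarrow>
     (complex, 'n) vec set set \<Rightarrow> 'n::{finite,linorder} curve set" where
  "meeting_curves l d X Y Z =
     {f \<in> rational_curves l d. f ` P1 \<inter> X \<noteq> {} \<and> f ` P1 \<inter> Y \<noteq> {} \<and> f ` P1 \<inter> Z \<noteq> {}}"

definition curve_classes :: "'n::finite curve set \<Rightarrow> 'n curve set set" where
  "curve_classes S = S // (reparametrization \<inter> S \<times> S)"

definition gromov_witten ::
    "'n::{finite,linorder} itself \<Rightarrow> nat \<Rightarrow> nat \<Rightarrow> nat list \<Rightarrow> nat list \<Rightarrow> nat list \<Rightarrow> nat \<Rightarrow> nat" where
  "gromov_witten T l k lam mu nu d =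
     (if sum_list lam + sum_list mu + sum_list nu = l * k + d * CARD('n)
      then THE N. for_general_flags (\<lambda>(F :: 'n flag) G H.
             let cs = curve_classes
                   (meeting_curves l d (schubert l k lam F) (schubert l k mu G) (schubert l k nu H))
             in finite cs \<and> card cs = N)
      else 0)"


section \<open>The quantum cohomology ring\<close>

text \<open>
  As a module, the ring is free over the integer polynomials in \<open>q\<close> with the Schubert classes as
  basis; an element is its family of coordinates. The set of \<open>d\<close> in the product has at most one
  element, by the dimension condition.
\<close>

definition schubert_class :: "nat list \<Rightarrow> nat list \<Rightarrow> int poly" where
  "schubert_class lam = (\<lambda>mu. if mu = lam then 1 else 0)"

definition quantum_coeff ::
    "'n::{finite,linorder} itself \<Rightarrow> nat \<Rightarrow> nat \<Rightarrow> nat list \<Rightarrow> nat list \<Rightarrow> nat list \<Rightarrow> int poly" where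
  "quantum_coeff T l k lam mu nu =
     (\<Sum>d | gromov_witten T l k lam mu (dual_partition k nu) d \<noteq> 0.
        monom (int (gromov_witten T l k lam mu (dual_partition k nu) d)) d)"

definition QH :: "'n::{finite,linorder} itself \<Rightarrow> nat \<Rightarrow> nat \<Rightarrow> (nat list \<Rightarrow> int poly) ring" where
  "QH T l k =
     \<lparr>carrier = {x. \<forall>nu. nu \<notin> partitions_in l k \<longrightarrow> x nu = 0},
      mult = (\<lambda>x y nu. if nu \<in> partitions_in l k
        then \<Sum>lam\<in>partitions_in l k. \<Sum>mu\<in>partitions_in l k.
               x lam * y mu * quantum_coeff T l k lam mu nu
        else 0),
      one = schubert_class (replicate l 0),
      zero = (\<lambda>_. 0),
      add = (\<lambda>x y nu. x nu + y nu)\<rparr>"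

definition special_class :: "nat \<Rightarrow> nat \<Rightarrow> int \<Rightarrow> nat list \<Rightarrow> int poly" where
  "special_class l k p =
     (if 0 \<le> p \<and> p \<le> int k then schubert_class (nat p # replicate (l - 1) 0) else (\<lambda>_. 0))"

definition ring_det :: "('a, 'b) ring_scheme \<Rightarrow> nat \<Rightarrow> (nat \<Rightarrow> nat \<Rightarrow> 'a) \<Rightarrow> 'a" where
  "ring_det R l A =
     finsum R (\<lambda>\<pi>. [sign \<pi>] \<cdot>\<^bsub>R\<^esub> finprod R (\<lambda>i. A i (\<pi> i)) {1..l}) {\<pi>. \<pi> permutes {1..l}}"

end

theory Submission
  imports Defs "HOL-Complex_Analysis.Conformal_Mappings"
begin

text \<open>
  The classical Pieri rule holds in the quantum ring, without \<open>q\<close>-terms, for products of a special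
  class with the class of a partition with fewer than \<open>l\<close> parts. Expanding the determinant along its
  last column only involves such products, and the sum telescopes as in the classical case.

  The points of a rational curve of degree \<open>d\<close> span a subspace \<open>W\<close> of dimension at most \<open>l + d\<close>. If
  the curve meets three Schubert varieties, \<open>W\<close> satisfies Schubert conditions in the Grassmannian of
  \<open>(l + d)\<close>-dimensional subspaces, where at most \<open>d\<close> columns are removed from each partition. For
  \<open>d \<ge> 1\<close> and general flags these conditions are too many to be satisfied. For \<open>d = 0\<close> the curve is
  constant, and the intersection of the three varieties is found by linear algebra in coordinates
  adapted to two of the flags.
\<close>

text \<open>The invariants are plain counts of curves, so a value follows from any general condition
  on the flags under which the set of curves is known. A single condition, independent of the
  partitions and of the degree, suffices because one class is special: F enters only through a
  nonzero vector in one of its members. In n coordinates adapted to the opposite flags G and H, it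
  says that no nonzero vector of F (card J) has all its coordinates in J equal to 0.

  A positive part in row l would leave room for d = 1, which is where the q-term of the quantum
  Pieri rule comes from.

  The obstacle in bounding the span is that the degree speaks of general hyperplanes only, whereas a
  hyperplane through chosen points of the curve is special. Its isolated intersections with the
  curve persist under small perturbations, by the open mapping theorem, and arbitrarily small
  perturbations are general.\<close>

type_synonym 'n cvec = "(complex, 'n) vec"
type_synonym 'n cmatrix = "((complex, 'n) vec, 'n) vec"

section \<open>General points\<close>

lemma polynomial_maps_sum:
  assumes "\<And>i. i \<in> A \<Longrightarrow> f i \<in> polynomial_maps C"
  shows "(\<lambda>x. \<Sum>i\<in>A. f i x) \<in> polynomial_maps C"
  using assms
  by (induction A rule: infinite_finite_induct)
    (auto intro: polynomial_maps.add polynomial_maps.const)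

lemma polynomial_maps_prod:
  assumes "\<And>i. i \<in> A \<Longrightarrow> f i \<in> polynomial_maps C"
  shows "(\<lambda>x. \<Prod>i\<in>A. f i x) \<in> polynomial_maps C"
  using assms
  by (induction A rule: infinite_finite_induct)
    (auto intro: polynomial_maps.mult polynomial_maps.const)

lemma polynomial_maps_det:
  assumes "\<And>i j. (\<lambda>x. A x $ i $ j) \<in> polynomial_maps C"
  shows "(\<lambda>x. det (A x)) \<in> polynomial_maps C"
  unfolding det_def
  by (intro polynomial_maps_sum polynomial_maps.mult polynomial_maps_prod assms
      polynomial_maps.const)

text \<open>A substitute for irreducibility of the affine space with coordinates C: along L every
  polynomial map becomes a polynomial in one variable.\<close>

definition joined_by_lines :: "('a \<Rightarrow> complex) set \<Rightarrow> bool" where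
  "joined_by_lines C \<longleftrightarrow>
     (\<forall>x y. \<exists>L. L 0 = x \<and> L 1 = y \<and> (\<forall>c\<in>C. \<exists>P. \<forall>s. c (L s) = poly P s))"

lemma polynomial_maps_line:
  assumes "f \<in> polynomial_maps C" "\<forall>c\<in>C. \<exists>P. \<forall>s. c (L s) = poly P s"
  shows "\<exists>P. \<forall>s. f (L s) = poly P s"
  using assms(1)
proof induction
  case (coord c)
  then show ?case using assms(2) by blast
next
  case (const a)
  have "\<forall>s. a = poly [:a:] s" by simp
  then show ?case by blast
next
  case (add f g)
  then obtain P Q where "\<forall>s. f (L s) = poly P s" "\<forall>s. g (L s) = poly Q s" by blast
  then have "\<forall>s. f (L s) + g (L s) = poly (P + Q) s" by simp
  then show ?case by blast
next
  case (mult f g)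
  then obtain P Q where "\<forall>s. f (L s) = poly P s" "\<forall>s. g (L s) = poly Q s" by blast
  then have "\<forall>s. f (L s) * g (L s) = poly (P * Q) s" by simp
  then show ?case by blast
qed

lemma for_general_ex: "for_general C P \<Longrightarrow> \<exists>x. P x"
  unfolding for_general_def by blast

lemma for_general_mono: "for_general C P \<Longrightarrow> (\<And>x. P x \<Longrightarrow> Q x) \<Longrightarrow> for_general C Q"
  unfolding for_general_def by blast

lemma for_general_True: "for_general C (\<lambda>x. True)"
  unfolding for_general_def by (rule bexI[OF _ polynomial_maps.const[of 1]]) auto

lemma for_general_nonzero:
  "p \<in> polynomial_maps C \<Longrightarrow> p x \<noteq> 0 \<Longrightarrow> for_general C (\<lambda>x. p x \<noteq> 0)"
  unfolding for_general_def by blast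

text \<open>On a line from a point where p is nonzero to a point where q is nonzero, both restrict
  to nonzero polynomials. These have finitely many zeros, so some point of the line avoids all of
  them.\<close>

lemma for_general_conj:
  assumes "joined_by_lines C" "for_general C P" "for_general C Q"
  shows "for_general C (\<lambda>x. P x \<and> Q x)"
proof -
  from assms obtain p x where p: "p \<in> polynomial_maps C" "p x \<noteq> 0" "\<And>x. p x \<noteq> 0 \<Longrightarrow> P x"
    unfolding for_general_def by blast
  from assms obtain q y where q: "q \<in> polynomial_maps C" "q y \<noteq> 0" "\<And>x. q x \<noteq> 0 \<Longrightarrow> Q x"
    unfolding for_general_def by blast
  from assms(1) obtain L where L: "L 0 = x" "L 1 = y" "\<forall>c\<in>C. \<exists>P. \<forall>s. c (L s) = poly P s"
    unfolding joined_by_lines_def by blast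
  from polynomial_maps_line[OF p(1) L(3)] obtain A where A: "\<And>s. p (L s) = poly A s" by blast
  from polynomial_maps_line[OF q(1) L(3)] obtain B where B: "\<And>s. q (L s) = poly B s" by blast
  have "A \<noteq> 0" "B \<noteq> 0" using A[of 0] B[of 1] L p(2) q(2) by auto
  then have "finite {s. poly (A * B) s = 0}" by (intro poly_roots_finite) auto
  then obtain s where "poly (A * B) s \<noteq> 0"
    using infinite_UNIV_char_0[where 'a=complex] by (metis (mono_tags, lifting) UNIV_eq_I mem_Collect_eq)
  then have "p (L s) * q (L s) \<noteq> 0" using A B by simp
  moreover have "(\<lambda>x. p x * q x) \<in> polynomial_maps C" using p q by (intro polynomial_maps.mult)
  ultimately show ?thesis unfolding for_general_def using p(3) q(3)
    by (intro bexI[of _ "\<lambda>x. p x * q x"]) auto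
qed

lemma for_general_ball:
  assumes "joined_by_lines C" "finite I" "\<And>i. i \<in> I \<Longrightarrow> for_general C (P i)"
  shows "for_general C (\<lambda>x. \<forall>i\<in>I. P i x)"
  using assms(2,3)
proof (induction I)
  case empty
  then show ?case using for_general_True[of C] by simp
next
  case (insert i I)
  then have "for_general C (\<lambda>x. P i x \<and> (\<forall>i\<in>I. P i x))"
    by (intro for_general_conj[OF assms(1)]) auto
  then show ?case by simp
qed

lemma line_poly: "\<exists>P. \<forall>s. (a::complex) + (s * b - s * a) = poly P s"
  by (rule exI[of _ "[:a, b - a:]"]) (simp add: algebra_simps)

text \<open>However special c is, the line from c to one good point has finitely many bad
  parameters, so all small nonzero s are good. This turns a special hyperplane into a general one by
  a small perturbation.\<close>

lemma for_general_vec_near: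
  assumes "for_general (range (\<lambda>i (c :: complex ^ 'i). c $ i)) Q"
  obtains e where "\<forall>\<^sub>F s in at (0::complex). Q (c + s *s e)"
proof -
  from assms obtain p y where p: "p \<in> polynomial_maps (range (\<lambda>i (c :: complex ^ 'i). c $ i))"
      "p y \<noteq> 0" "\<And>x. p x \<noteq> 0 \<Longrightarrow> Q x"
    unfolding for_general_def by blast
  have "\<exists>P. \<forall>s. p (c + s *s (y - c)) = poly P s"
    by (rule polynomial_maps_line[OF p(1)]) (auto simp: line_poly vector_add_component vector_smult_component)
  then obtain P where P: "\<And>s. p (c + s *s (y - c)) = poly P s" by blast
  have "P \<noteq> 0" using P[of 1] p(2) by auto
  then have "finite {s. poly P s = 0}" by (rule poly_roots_finite)
  then have "\<forall>\<^sub>F s in at (0::complex). s \<notin> {s. poly P s = 0}"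
    by (metis eventually_at_filter islimpt_finite islimpt_iff_eventually)
  then have "\<forall>\<^sub>F s in at (0::complex). Q (c + s *s (y - c))"
    by eventually_elim (use P p(3) in auto)
  then show ?thesis by (rule that)
qed

definition matrix_coords ::
  "('n::finite cmatrix ^ 3 \<Rightarrow> complex) set" where
  "matrix_coords = {\<lambda>M. M $ r $ i $ j | r i j. True}"

lemma joined_by_lines_matrix: "joined_by_lines (matrix_coords :: ('n::finite cmatrix ^ 3 \<Rightarrow> complex) set)"
  unfolding joined_by_lines_def
proof (intro allI)
  fix x y :: "'n::finite cmatrix ^ 3"
  show "\<exists>L. L 0 = x \<and> L 1 = y \<and>
     (\<forall>c\<in>matrix_coords :: ('n cmatrix ^ 3 \<Rightarrow> complex) set. \<exists>P. \<forall>s. c (L s) = poly P s)"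
    by (rule exI[of _ "\<lambda>s. \<chi> r i j. x $ r $ i $ j + s * (y $ r $ i $ j - x $ r $ i $ j)"])
      (auto simp: matrix_coords_def line_poly vec_eq_iff right_diff_distrib)
qed

section \<open>Flags in general position\<close>

definition place :: "'n::{finite,linorder} \<Rightarrow> nat" where
  "place j = card {..<j}"

definition row_at :: "nat \<Rightarrow> 'n::{finite,linorder}" where
  "row_at t = inv_into UNIV place t"

lemma place_less: "i < j \<Longrightarrow> place i < place (j :: 'n::{finite,linorder})"
  unfolding place_def by (intro psubset_card_mono) auto

lemma place_inj: "place i = place j \<longleftrightarrow> i = (j :: 'n::{finite,linorder})"
  by (metis place_less less_irrefl neq_iff)

lemma place_bound: "place (j :: 'n::{finite,linorder}) < CARD('n)"
  unfolding place_def by (intro psubset_card_mono) auto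

lemma bij_place: "bij_betw place (UNIV :: 'n::{finite,linorder} set) {..<CARD('n)}"
proof -
  have inj: "inj (place :: 'n \<Rightarrow> nat)" by (simp add: inj_def place_inj)
  have "range (place :: 'n \<Rightarrow> nat) = {..<CARD('n)}"
    using place_bound inj by (intro card_subset_eq) (auto simp: card_image)
  with inj show ?thesis by (simp add: bij_betw_def)
qed

lemma place_row_at [simp]: "t < CARD('n) \<Longrightarrow> place (row_at t :: 'n::{finite,linorder}) = t"
  unfolding row_at_def using bij_place[where 'n='n]
  by (intro f_inv_into_f) (auto simp: bij_betw_def)

lemma row_at_place [simp]: "row_at (place i) = i"
  using place_row_at[OF place_bound] place_inj by metis

text \<open>The form vanishing on the first j rows of X and the first n - 1 - j rows of Y: up to
  scale, the coordinate belonging to the line G (j + 1) \<inter> H (n - j). Leaving it as an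
  unnormalised determinant keeps it polynomial in the entries of X and Y.\<close>

definition dual_coord ::
    "'n cmatrix \<Rightarrow> 'n cmatrix \<Rightarrow> nat \<Rightarrow>
     'n::{finite,linorder} cvec \<Rightarrow> complex" where
  "dual_coord X Y j x = det (\<chi> i. if i = row_at j then x
     else if place i < j then X $ i else Y $ row_at (place i - j - 1))"

lemma dual_coord_add: "dual_coord X Y j (x + y) = dual_coord X Y j x + dual_coord X Y j y"
  unfolding dual_coord_def by (rule det_row_add)

lemma dual_coord_scale: "dual_coord X Y j (c *s x) = c * dual_coord X Y j x"
  unfolding dual_coord_def by (rule det_row_mul)

lemma dual_coord_X:
  assumes "j < CARD('n)" "place (i :: 'n::{finite,linorder}) < j"
  shows "dual_coord X Y j (X $ i) = 0"
  unfolding dual_coord_def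
proof (rule det_identical_rows)
  let ?B = "\<chi> i'. if i' = row_at j then X $ i else if place i' < j then X $ i' else Y $ row_at (place i' - j - 1)"
  show "i \<noteq> row_at j" using assms by auto
  then show "row i ?B = row (row_at j) ?B"
    using assms by (simp add: row_def)
qed

lemma dual_coord_Y:
  assumes "j < CARD('n)" "place (i :: 'n::{finite,linorder}) < CARD('n) - 1 - j"
  shows "dual_coord X Y j (Y $ i) = 0"
  unfolding dual_coord_def
proof (rule det_identical_rows)
  let ?B = "\<chi> i'. if i' = row_at j then Y $ i else if place i' < j then X $ i' else Y $ row_at (place i' - j - 1)"
  \<comment> \<open>Row \<open>place i\<close> of Y is placed in row \<open>place i + j + 1\<close>
    of the matrix, which therefore has two equal rows.\<close>
  let ?i = "row_at (place i + j + 1) :: 'n"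
  have r: "place ?i = place i + j + 1" using assms by simp
  show ne: "?i \<noteq> row_at j" using r assms by (metis place_row_at not_add_less2 less_add_one)
  show "row ?i ?B = row (row_at j) ?B"
    using ne r by (simp add: row_def)
qed

lemma span_place_decrease:
  fixes A :: "'n::{finite,linorder} cmatrix"
  assumes "b < CARD('n)" "x \<in> vec.span {A $ j | j. place j < Suc b}"
    and f: "\<And>x y. f (x + y) = f x + f y" "\<And>c x. f (c *s x) = c * f x"
    and "\<And>j. place j < b \<Longrightarrow> f (A $ j) = (0 :: complex)" "f (A $ row_at b) \<noteq> 0" "f x = 0"
  shows "x \<in> vec.span {A $ j | j. place j < b}"
proof -
  have "{A $ j | j. place j < Suc b} = insert (A $ row_at b) {A $ j | j. place j < b}"
    using assms(1) by (auto simp: less_Suc_eq)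
  with assms(2) obtain c where c: "x - c *s (A $ row_at b) \<in> vec.span {A $ j | j. place j < b}"
    by (auto simp: vec.span_breakdown_eq)
  have f0: "f 0 = 0" using f(2)[of 0 0] by simp
  have "y \<in> vec.span {A $ j | j. place j < b} \<Longrightarrow> f y = 0" for y
    by (induction rule: vec.span_induct_alt) (use assms(5) f f0 in auto)
  then have "f (x - c *s (A $ row_at b)) = 0" using c by blast
  moreover have "f x = f (x - c *s (A $ row_at b)) + c * f (A $ row_at b)"
    using f(1)[of "x - c *s (A $ row_at b)" "c *s (A $ row_at b)"] f(2) by simp
  ultimately have "c = 0" using assms(6,7) by simp
  then show ?thesis using c by simp
qed

text \<open>The functionals are triangular with respect to the rows: \<open>f b\<close> kills the
  rows before b but not row b. Starting from the whole space, the equations \<open>f b x = 0\<close>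
  for descending b remove one row at a time.\<close>

lemma span_place_cut:
  fixes A :: "'n::{finite,linorder} cmatrix"
  assumes f: "\<And>b x y. f b (x + y) = f b x + f b y" "\<And>b c x. f b (c *s x) = c * f b x"
    and 0: "\<And>b j. b < CARD('n) \<Longrightarrow> place j < b \<Longrightarrow> f b (A $ j) = (0 :: complex)"
    and 1: "\<And>b. b < CARD('n) \<Longrightarrow> f b (A $ row_at b) \<noteq> 0"
    and UNIV: "vec.span {A $ j | j. place j < CARD('n)} = UNIV"
    and "a \<le> CARD('n)"
  shows "x \<in> vec.span {A $ j | j. place j < a} \<longleftrightarrow> (\<forall>b. a \<le> b \<and> b < CARD('n) \<longrightarrow> f b x = 0)"
proof
  assume x: "x \<in> vec.span {A $ j | j. place j < a}"
  have f0: "f b 0 = 0" for b using f(2)[of b 0 0] by simp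
  show "\<forall>b. a \<le> b \<and> b < CARD('n) \<longrightarrow> f b x = 0"
    using x by (induction rule: vec.span_induct_alt) (auto simp: f f0 0)
next
  assume f0: "\<forall>b. a \<le> b \<and> b < CARD('n) \<longrightarrow> f b x = 0"
  have "x \<in> vec.span {A $ j | j. place j < a}" using \<open>a \<le> CARD('n)\<close> f0
  proof (induction a rule: inc_induct)
    case base
    then show ?case using UNIV by simp
  next
    case (step b)
    then have "x \<in> vec.span {A $ j | j. place j < Suc b}" by auto
    then show ?case
      by (rule span_place_decrease[of b x A "f b", rotated]) (use step 0 1 f in auto)
  qed
  then show "x \<in> vec.span {A $ j | j. place j < a}" .
qed

text \<open>
  Coordinates adapted to a pair of opposite flags \<open>G\<close>, \<open>H\<close>, with respect to which \<open>F\<close> is in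
  general position.
\<close>

locale general_flags =
  fixes F G H :: "'n::{finite,linorder} flag" and \<phi> :: "nat \<Rightarrow> 'n cvec \<Rightarrow> complex"
  assumes flag_F: "complete_flag F" and flag_G: "complete_flag G" and flag_H: "complete_flag H"
    and phi_add: "\<phi> j (x + y) = \<phi> j x + \<phi> j y"
    and phi_scale: "\<phi> j (c *s x) = c * \<phi> j x"
    and G_iff: "a \<le> CARD('n) \<Longrightarrow> x \<in> G a \<longleftrightarrow> (\<forall>j. a \<le> j \<and> j < CARD('n) \<longrightarrow> \<phi> j x = 0)"
    and H_iff: "b \<le> CARD('n) \<Longrightarrow> x \<in> H b \<longleftrightarrow> (\<forall>j < CARD('n) - b. \<phi> j x = 0)"
    and F_transversal: "J \<subseteq> {..<CARD('n)} \<Longrightarrow> x \<in> F (card J) \<Longrightarrow> \<forall>j\<in>J. \<phi> j x = 0 \<Longrightarrow> x = 0"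

text \<open>Up to sign its determinant is the minor formed by the coordinates in J of the first
  \<open>card J\<close> rows of Z. Unit rows at the places outside J, assigned by \<tau>, pad the
  minor to a square matrix over the index type.\<close>

definition transversality_matrix ::
    "nat set \<Rightarrow> (nat \<Rightarrow> nat) \<Rightarrow> 'n cmatrix \<Rightarrow> 'n cmatrix \<Rightarrow>
     'n cmatrix \<Rightarrow> 'n::{finite,linorder} cmatrix" where
  "transversality_matrix J \<tau> Z X Y = (\<chi> i j. if place i < card J then dual_coord X Y (place j) (Z $ i)
     else if place j = \<tau> (place i) then 1 else 0)"

lemma span_rows_sum:
  fixes A :: "'n::finite cmatrix"
  assumes "x \<in> vec.span {A $ j | j. P j}"
  obtains c where "x = (\<Sum>i\<in>UNIV. c i *s (A $ i))" "\<And>i. \<not> P i \<Longrightarrow> c i = 0"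
proof -
  have "\<exists>c. x = (\<Sum>i\<in>UNIV. c i *s (A $ i)) \<and> (\<forall>i. \<not> P i \<longrightarrow> c i = 0)"
    using assms
  proof (induction rule: vec.span_induct_alt)
    case base
    show ?case by (rule exI[of _ "\<lambda>_. 0"]) simp
  next
    case (step c y z)
    from step(1) obtain j where j: "y = A $ j" "P j" by blast
    from step obtain d where d: "z = (\<Sum>i\<in>UNIV. d i *s (A $ i))" "\<forall>i. \<not> P i \<longrightarrow> d i = 0" by blast
    have "(\<Sum>i\<in>UNIV. (if i = j then c else 0) *s (A $ i)) = c *s y"
      using j by (subst sum.remove[of _ j]) (auto intro!: sum.neutral)
    then have "c *s y + z = (\<Sum>i\<in>UNIV. ((if i = j then c else 0) + d i) *s (A $ i))"
      by (simp add: d vec.scale_left_distrib sum.distrib)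
    then show ?case using d j by (intro exI[of _ "\<lambda>i. (if i = j then c else 0) + d i"]) auto
  qed
  then show ?thesis using that by blast
qed

lemma dual_coord_0 [simp]: "dual_coord X Y j 0 = 0"
  using dual_coord_scale[of X Y j 0 0] by simp

lemma dual_coord_sum: "dual_coord X Y j (\<Sum>i\<in>A. c i *s f i) = (\<Sum>i\<in>A. c i * dual_coord X Y j (f i))"
  by (induction A rule: infinite_finite_induct) (auto simp: dual_coord_add dual_coord_scale)

text \<open>A combination x of the first rows of Z with vanishing coordinates in J extends to a
  vector in the left kernel of the matrix, which is trivial.\<close>

lemma transversality:
  fixes Z :: "'n::{finite,linorder} cmatrix"
  assumes "det (transversality_matrix J \<tau> Z X Y) \<noteq> 0" "J \<subseteq> {..<CARD('n)}"
    "bij_betw \<tau> {card J..<CARD('n)} ({..<CARD('n)} - J)"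
    "x \<in> vec.span {Z $ j | j. place j < card J}" "\<forall>j\<in>J. dual_coord X Y j x = 0"
  shows "x = 0"
proof -
  define N where "N = transversality_matrix J \<tau> Z X Y"
  from span_rows_sum[OF assms(4)] obtain c where
    c: "x = (\<Sum>i\<in>UNIV. c i *s (Z $ i))" "\<And>i. \<not> place i < card J \<Longrightarrow> c i = 0" by metis
  have dx: "dual_coord X Y j x = (\<Sum>i\<in>UNIV. c i * dual_coord X Y j (Z $ i))" for j
    unfolding dual_coord_sum[symmetric] c(1)[symmetric] ..
  \<comment> \<open>The weights on the unit rows cancel the coordinates of x outside J; those in J
    vanish by assumption.\<close>
  define y where "y = (\<chi> i. if place i < card J then c i else - dual_coord X Y (\<tau> (place i)) x)"
  have "(transpose N *v y) $ j = 0" for j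
  proof -
    have "(transpose N *v y) $ j = (\<Sum>i\<in>UNIV. N $ i $ j * y $ i)"
      by (simp add: matrix_vector_mult_def transpose_def)
    also have "\<dots> = (\<Sum>i\<in>UNIV. c i * dual_coord X Y (place j) (Z $ i)
       - (if \<not> place i < card J \<and> place j = \<tau> (place i) then dual_coord X Y (place j) x else 0))"
      by (intro sum.cong) (auto simp: N_def transversality_matrix_def y_def c(2))
    also have "\<dots> = dual_coord X Y (place j) x
      - (\<Sum>i\<in>(UNIV::'n set). if \<not> place i < card J \<and> place j = \<tau> (place i) then dual_coord X Y (place j) x else 0)"
      by (simp only: dx sum_subtractf)
    also have "\<dots> = 0"
    proof (cases "place j \<in> J")
      case True
      then have "dual_coord X Y (place j) x = 0" using assms(5) by blast
      then show ?thesis unfolding \<open>dual_coord X Y (place j) x = 0\<close> by simp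
    next
      case False
      then have "place j \<in> {..<CARD('n)} - J" using place_bound[of j] by auto
      then have "place j \<in> \<tau> ` {card J..<CARD('n)}" using bij_betw_imp_surj_on[OF assms(3)] by simp
      then obtain t where t: "t \<in> {card J..<CARD('n)}" "place j = \<tau> t" by blast
      have iff: "\<not> place i < card J \<and> place j = \<tau> (place i) \<longleftrightarrow> i = row_at t" for i :: 'n
      proof
        assume a: "\<not> place i < card J \<and> place j = \<tau> (place i)"
        then have "place i \<in> {card J..<CARD('n)}" using place_bound[of i] by auto
        then have "place i = t" using a t inj_onD[OF bij_betw_imp_inj_on[OF assms(3)], of "place i" t] by simp
        then show "i = row_at t" by auto
      next
        assume "i = row_at t"
        then show "\<not> place i < card J \<and> place j = \<tau> (place i)" using t by simp
      qed
      show ?thesis unfolding iff by simp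
    qed
    finally show ?thesis .
  qed
  then have "transpose N *v y = 0" by (simp add: vec_eq_iff)
  moreover have "invertible (transpose N)" using assms(1) by (simp add: invertible_det_nz N_def)
  then obtain B where "B ** transpose N = mat 1" unfolding invertible_def by blast
  ultimately have "y = 0"
    using matrix_left_invertible_ker[of "transpose N"] by blast
  then have yi: "y $ i = 0" for i by simp
  have "c i = 0" for i
    using c(2)[of i] yi[of i] by (cases "place i < card J") (simp_all add: y_def)
  then show ?thesis using c(1) by simp
qed

lemma det_nonzero_ker:
  fixes A :: "'n::finite cmatrix"
  assumes "\<And>x. A *v x = 0 \<Longrightarrow> x = 0"
  shows "det A \<noteq> 0"
  using assms matrix_left_invertible_ker[of A]
  by (auto simp: invertible_det_nz[symmetric] invertible_left_inverse)

section \<open>Sample flags: the standard basis and its reverse\<close>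

lemma det_axis_rows:
  assumes "inj (\<sigma> :: 'n::finite \<Rightarrow> 'n)"
  shows "det (\<chi> i. axis (\<sigma> i) (1 :: complex)) \<noteq> 0"
proof (rule det_nonzero_ker)
  fix x :: "'n cvec"
  assume 0: "(\<chi> i. axis (\<sigma> i) (1 :: complex)) *v x = 0"
  have "x $ \<sigma> i = ((\<chi> i. axis (\<sigma> i) (1 :: complex)) *v x) $ i" for i
    by (simp add: matrix_vector_mult_def axis_def if_distrib[of "\<lambda>t. t * _"] cong: if_cong)
  then have "x $ \<sigma> i = 0" for i using 0 by simp
  moreover have "surj \<sigma>" using assms by (simp add: finite_UNIV_inj_surj)
  ultimately show "x = 0" by (simp add: vec_eq_iff) (metis surj_def)
qed

definition reversed_basis :: "'n::{finite,linorder} cmatrix" where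
  "reversed_basis = (\<chi> i. axis (row_at (CARD('n) - 1 - place i)) 1)"

abbreviation standard_coord :: "nat \<Rightarrow> 'n::{finite,linorder} cvec \<Rightarrow> complex" where
  "standard_coord \<equiv> dual_coord (\<chi> i. axis i 1) reversed_basis"

lemma standard_coord_axis_same:
  fixes i :: "'n::{finite,linorder}"
  shows "standard_coord (place i) (axis i 1) \<noteq> 0"
proof -
  \<comment> \<open>After place i the matrix holds rows of the reversed basis. Row number t = place
    i' - place i - 1 of that basis is the axis at place n - 1 - t = n + place i - place i', so the
    whole matrix is a permutation matrix.\<close>
  define \<sigma> where "\<sigma> i' = (if place i' \<le> place i then i'
     else row_at (CARD('n) + place i - place i'))" for i' :: 'n
  have p: "place (\<sigma> i') = (if place i' \<le> place i then place i' else CARD('n) + place i - place i')" for i'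
    using place_bound[of i'] place_bound[of i] by (simp add: \<sigma>_def)
  have "inj \<sigma>"
  proof (rule injI)
    fix x y assume "\<sigma> x = \<sigma> y"
    then have "place (\<sigma> x) = place (\<sigma> y)" by simp
    then have "place x = place y"
      using place_bound[of x] place_bound[of y] place_bound[of i] by (auto simp: p split: if_splits)
    then show "x = y" by (simp add: place_inj)
  qed
  let ?e = "\<lambda>i'. if i' = row_at (place i) then axis i 1
     else if place i' < place i then (\<chi> i. axis i 1) $ i'
       else reversed_basis $ row_at (place i' - place i - 1)"
  have "(\<chi> i'. ?e i') = (\<chi> i'. axis (\<sigma> i') (1 :: complex))"
  proof (intro arg_cong[where f=vec_lambda] ext)
    fix i' :: 'n
    have "place i' \<noteq> place i" if "i' \<noteq> i" using that by (simp add: place_inj)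
    moreover have "place i' - place i - 1 < CARD('n)" using place_bound[of i'] by simp
    moreover have "CARD('n) - 1 - (place i' - place i - 1) = CARD('n) + place i - place i'"
      if "place i' > place i" using that place_bound[of i'] by simp
    ultimately show "?e i' = axis (\<sigma> i') (1 :: complex)"
      by (auto simp: \<sigma>_def reversed_basis_def)
  qed
  then show ?thesis unfolding dual_coord_def using det_axis_rows[OF \<open>inj \<sigma>\<close>] by simp
qed

lemma standard_coord_axis_other:
  assumes "j < CARD('n)" "place (i :: 'n::{finite,linorder}) \<noteq> j"
  shows "standard_coord j (axis i 1) = 0"
proof (cases "place i < j")
  case True
  then show ?thesis using dual_coord_X[of j i "\<chi> i. axis i 1"] assms by simp
next
  case False
  let ?i = "row_at (CARD('n) - 1 - place i) :: 'n"
  have "place ?i = CARD('n) - 1 - place i" by simp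
  moreover have "reversed_basis $ ?i = axis i 1"
    using place_bound[of i] by (simp add: reversed_basis_def)
  moreover have "CARD('n) - 1 - place i < CARD('n) - 1 - j"
    using assms False place_bound[of i] by linarith
  ultimately show ?thesis using dual_coord_Y[of j ?i "\<chi> i. axis i 1" reversed_basis] assms by simp
qed

lemma transversality_standard:
  fixes J :: "nat set"
  assumes J: "J \<subseteq> {..<CARD('n)}" and \<tau>: "bij_betw \<tau> {card J..<CARD('n)} ({..<CARD('n)} - J)"
  obtains Z :: "'n::{finite,linorder} cmatrix" where
    "det (transversality_matrix J \<tau> Z (\<chi> i. axis i 1) reversed_basis) \<noteq> 0"
proof -
  have fin: "finite J" using J finite_subset by blast
  then obtain \<sigma> where \<sigma>: "bij_betw \<sigma> {..<card J} J"
    using ex_bij_betw_nat_finite[OF fin] by (auto simp: atLeast0LessThan)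
  have cJ: "card J \<le> CARD('n)" using card_mono[OF _ J] by simp
  \<comment> \<open>The first \<open>card J\<close> rows of Z are the axes with places in J, so each
    row of the transversality matrix has exactly one nonzero entry.\<close>
  define Z :: "'n cmatrix" where "Z = (\<chi> i. axis (row_at (\<sigma> (place i))) 1)"
  let ?N = "transversality_matrix J \<tau> Z (\<chi> i. axis i 1) reversed_basis"
  have "det ?N \<noteq> 0"
  proof (rule det_nonzero_ker)
    fix y assume "?N *v y = 0"
    then have 0: "(\<Sum>j\<in>UNIV. ?N $ i $ j * y $ j) = 0" for i
      by (simp add: matrix_vector_mult_def vec_eq_iff)
    have "y $ j = 0" for j
    proof (cases "place j \<in> J")
      case True
      then have "place j \<in> \<sigma> ` {..<card J}" using bij_betw_imp_surj_on[OF \<sigma>] by simp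
      then obtain t where t: "t < card J" "\<sigma> t = place j" by auto
      have N: "?N $ row_at t $ j' = standard_coord (place j') (axis j 1)" for j'
        using t cJ by (simp add: transversality_matrix_def Z_def)
      have "standard_coord (place j') (axis j 1) * y $ j' = 0" if "j' \<noteq> j" for j'
        using that standard_coord_axis_other[of "place j'" j] place_bound[of j'] by (simp add: place_inj)
      then have "(\<Sum>j'\<in>UNIV. ?N $ row_at t $ j' * y $ j') =
          (\<Sum>j'\<in>UNIV. if j' = j then standard_coord (place j) (axis j 1) * y $ j else 0)"
        unfolding N by (intro sum.cong) auto
      then have "(\<Sum>j'\<in>UNIV. ?N $ row_at t $ j' * y $ j') = standard_coord (place j) (axis j 1) * y $ j"
        by simp
      then show ?thesis using 0 standard_coord_axis_same[of j] by auto
    next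
      case False
      then have "place j \<in> {..<CARD('n)} - J" using place_bound[of j] by auto
      then have "place j \<in> \<tau> ` {card J..<CARD('n)}" using bij_betw_imp_surj_on[OF \<tau>] by simp
      then obtain t where t: "card J \<le> t" "t < CARD('n)" "\<tau> t = place j" by auto
      have N: "?N $ row_at t $ j' = (if j' = j then 1 else 0)" for j'
        using t by (simp add: transversality_matrix_def place_inj)
      have "(\<Sum>j'\<in>UNIV. ?N $ row_at t $ j' * y $ j') = y $ j"
        unfolding N by (simp add: if_distrib[of "\<lambda>t. t * _"] cong: if_cong)
      then show ?thesis using 0 by auto
    qed
    then show "y = 0" by (simp add: vec_eq_iff)
  qed
  then show ?thesis using that by blast
qed

section \<open>Nondegeneracy of three flags as polynomial conditions\<close>

lemma matrix_coords_coord: "(\<lambda>M. M $ r $ i $ j) \<in> polynomial_maps matrix_coords"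
  unfolding matrix_coords_def by (rule polynomial_maps.coord) blast

lemma polynomial_maps_dual_coord:
  assumes "\<And>i. (\<lambda>M. v M $ i) \<in> polynomial_maps matrix_coords"
  shows "(\<lambda>M. dual_coord (M $ r) (M $ s) j (v M)) \<in> polynomial_maps matrix_coords"
  unfolding dual_coord_def
proof (rule polynomial_maps_det)
  fix i i'
  show "(\<lambda>M. (\<chi> i. if i = row_at j then v M else if place i < j then M $ r $ i
      else M $ s $ row_at (place i - j - 1)) $ i $ i') \<in> polynomial_maps matrix_coords"
    by (cases "i = row_at j"; cases "place i < j") (simp_all add: matrix_coords_coord assms)
qed

lemma polynomial_maps_transversality:
  "(\<lambda>M. det (transversality_matrix J \<tau> (M $ r) (M $ s) (M $ t))) \<in> polynomial_maps matrix_coords"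
  unfolding transversality_matrix_def
proof (rule polynomial_maps_det)
  fix i j :: 'a
  show "(\<lambda>x. (\<chi> i j. if place i < card J then dual_coord (x $ s) (x $ t) (place j) (x $ r $ i)
             else if place j = \<tau> (place i) then 1 else 0) $ i $ j)
    \<in> polynomial_maps matrix_coords"
    by (cases "place i < card J")
      (auto intro!: polynomial_maps_dual_coord matrix_coords_coord polynomial_maps.const)
qed

lemma complement_bij:
  assumes "J \<subseteq> {..<n::nat}"
  shows "\<exists>\<tau>. bij_betw \<tau> {card J..<n} ({..<n} - J)"
  using assms finite_subset[OF assms]
  by (intro finite_same_card_bij) (auto simp: card_Diff_subset)

text \<open>General position amounts to finitely many polynomials in the three matrices being
  nonzero. Each needs only a sample point of its own, since finitely many general conditions can be
  combined.\<close>

lemma for_general_flags_general: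
  "for_general_flags (\<lambda>(F :: 'n::{finite,linorder} flag) G H. \<exists>\<phi>. general_flags F G H \<phi>)"
proof -
  let ?n = "CARD('n)"
  define \<tau> where "\<tau> J = (SOME \<tau>. bij_betw \<tau> {card J..<?n} ({..<?n} - J))" for J
  have \<tau>: "bij_betw (\<tau> J) {card J..<?n} ({..<?n} - J)" if "J \<subseteq> {..<?n}" for J
    unfolding \<tau>_def using someI_ex[OF complement_bij[OF that]] .
  let ?C = "matrix_coords :: ('n cmatrix ^ 3 \<Rightarrow> complex) set"
  let ?M = "\<lambda>Z. vector [Z, \<chi> i. axis i 1, reversed_basis] :: 'n cmatrix ^ 3"
  note line = joined_by_lines_matrix
  have 1: "for_general ?C (\<lambda>M. dual_coord (M $ 2) (M $ 3) b (M $ 2 $ row_at b) \<noteq> 0)" if "b < ?n" for b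
    by (rule for_general_nonzero[where x="?M 0"])
      (use standard_coord_axis_same[of "row_at b :: 'n"] that in
        \<open>auto intro!: polynomial_maps_dual_coord matrix_coords_coord simp: vector_3\<close>)
  \<comment> \<open>Triangularity for the third flag: its rows pair with the coordinates in reverse
    order, place t with coordinate n - 1 - t.\<close>
  have 2: "for_general ?C (\<lambda>M. dual_coord (M $ 2) (M $ 3) b (M $ 3 $ row_at (?n - 1 - b)) \<noteq> 0)" if "b < ?n" for b
    by (rule for_general_nonzero[where x="?M 0"])
      (use standard_coord_axis_same[of "row_at b :: 'n"] that in
        \<open>auto intro!: polynomial_maps_dual_coord matrix_coords_coord simp: vector_3 reversed_basis_def\<close>)
  have 3: "for_general ?C (\<lambda>M. det (transversality_matrix J (\<tau> J) (M $ 1) (M $ 2) (M $ 3)) \<noteq> 0)"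
    if J: "J \<subseteq> {..<?n}" for J
  proof -
    obtain Z :: "'n cmatrix" where
      "det (transversality_matrix J (\<tau> J) Z (\<chi> i. axis i 1) reversed_basis) \<noteq> 0"
      using transversality_standard[OF J \<tau>[OF J]] .
    then show ?thesis
      by (intro for_general_nonzero[where x="?M Z"] polynomial_maps_transversality) (simp add: vector_3)
  qed
  let ?gen = "\<lambda>M. ((\<forall>b\<in>{..<?n}. dual_coord (M $ 2) (M $ 3) b (M $ 2 $ row_at b) \<noteq> 0) \<and>
     (\<forall>b\<in>{..<?n}. dual_coord (M $ 2) (M $ 3) b (M $ 3 $ row_at (?n - 1 - b)) \<noteq> 0)) \<and>
     (\<forall>J\<in>Pow {..<?n}. det (transversality_matrix J (\<tau> J) (M $ 1) (M $ 2) (M $ 3)) \<noteq> 0)"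
  have "for_general ?C ?gen"
    by (intro for_general_conj[OF line] for_general_ball[OF line])
      (use 1 2 3 in \<open>auto simp del: One_nat_def\<close>)
  then show ?thesis unfolding for_general_flags_def matrix_coords_def[symmetric]
  proof (rule for_general_mono, intro allI impI)
    fix M :: "'n cmatrix ^ 3" and F G H :: "'n flag"
    let ?\<phi> = "dual_coord (M $ 2) (M $ 3)"
    assume gen: "?gen M"
    assume flags: "complete_flag F" "complete_flag G" "complete_flag H"
      and "adapted_basis (M $ 1) F" "adapted_basis (M $ 2) G" "adapted_basis (M $ 3) H"
    then have F: "F a = vec.span {M $ 1 $ j | j. place j < a}"
      and G: "G a = vec.span {M $ 2 $ j | j. place j < a}"
      and H: "H a = vec.span {M $ 3 $ j | j. place j < a}" if "a \<le> ?n" for a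
      using that by (auto simp: adapted_basis_def place_def)
    \<comment> \<open>That the rows of each matrix span is read off the flag, whose top member has
      full dimension.\<close>
    have full: "K ?n = UNIV" if "complete_flag K" for K :: "'n flag"
    proof -
      have "vec.dim (K ?n) = ?n" "vec.subspace (K ?n)" using that by (auto simp: complete_flag_def)
      then have "vec.span (K ?n) = UNIV"
        using vec.dim_eq_full[of "K ?n"] by (simp add: card_cart_basis vec.dimension_def)
      with \<open>vec.subspace (K ?n)\<close> show ?thesis by (metis vec.span_eq_iff)
    qed
    have "general_flags F G H ?\<phi>"
    proof
      fix a x assume a: "a \<le> ?n"
      show "x \<in> G a \<longleftrightarrow> (\<forall>j. a \<le> j \<and> j < ?n \<longrightarrow> ?\<phi> j x = 0)"
        unfolding G[OF a]
        by (rule span_place_cut)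
          (use gen a full[of G] flags G[of ?n] in \<open>auto simp: dual_coord_add dual_coord_scale dual_coord_X\<close>)
    next
      fix b x assume b: "b \<le> ?n"
      have "x \<in> H b \<longleftrightarrow> (\<forall>j. b \<le> j \<and> j < ?n \<longrightarrow> ?\<phi> (?n - 1 - j) x = 0)"
        unfolding H[OF b]
      proof (rule span_place_cut[OF _ _ _ _ _ b])
        show "?\<phi> (?n - 1 - b) (M $ 3 $ row_at b) \<noteq> 0" if "b < ?n" for b
          using gen that by (auto dest!: bspec[of _ _ "?n - 1 - b"])
      qed (use full[of H] flags H[of ?n] in \<open>auto simp: dual_coord_add dual_coord_scale dual_coord_Y\<close>)
      also have "\<dots> \<longleftrightarrow> (\<forall>j < ?n - b. ?\<phi> j x = 0)"
      proof safe
        fix j assume *: "\<forall>j. b \<le> j \<and> j < ?n \<longrightarrow> ?\<phi> (?n - 1 - j) x = 0" "j < ?n - b"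
        show "?\<phi> j x = 0" using *(1)[rule_format, of "?n - 1 - j"] *(2) by simp
      qed auto
      finally show "x \<in> H b \<longleftrightarrow> (\<forall>j < ?n - b. ?\<phi> j x = 0)" .
    next
      fix J x assume J: "J \<subseteq> {..<?n}" and x: "x \<in> F (card J)" and 0: "\<forall>j\<in>J. ?\<phi> j x = 0"
      have "card J \<le> ?n" using card_mono[OF _ J] by simp
      with x have "x \<in> vec.span {M $ 1 $ j | j. place j < card J}" using F by simp
      then show "x = 0"
        using transversality[OF _ J \<tau>[OF J] _ 0] gen J by blast
    qed (use flags dual_coord_add dual_coord_scale in auto)
    then show "\<exists>\<phi>. general_flags F G H \<phi>" by blast
  qed
qed

lemma for_general_flags_conj:
  assumes "for_general_flags P" "for_general_flags Q"
  shows "for_general_flags (\<lambda>F G H. P F G H \<and> Q F G H)"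
  using for_general_conj[OF joined_by_lines_matrix
      assms[unfolded for_general_flags_def matrix_coords_def[symmetric]]]
  unfolding for_general_flags_def matrix_coords_def[symmetric]
  by (rule for_general_mono) simp

lemma for_general_flags_mono:
  assumes "for_general_flags P" "\<And>F G H. P F G H \<Longrightarrow> Q F G H"
  shows "for_general_flags Q"
  using assms(1) unfolding for_general_flags_def
  by (rule for_general_mono) (simp add: assms(2))

lemma ex_adapted_flag:
  fixes A :: "'n::{finite,linorder} cmatrix"
  assumes "det A \<noteq> 0"
  obtains F where "complete_flag F" "adapted_basis A F"
proof -
  define F where "F i = vec.span {A $ j | j. place j < i}" for i
  have inj: "inj (($) A)" and ind: "vec.independent (rows A)"
    using assms det_identical_rows[of _ _ A] det_dependent_rows[of A]
    by (auto simp: inj_def row_def vec_eq_iff)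
  have "{A $ j | j. place j < i} = (\<lambda>t. A $ row_at t) ` {..<i}" if "i \<le> CARD('n)" for i
    using that by (auto intro!: image_eqI[of _ _ "place _"])
  moreover have "inj_on (\<lambda>t. A $ (row_at t :: 'n)) {..<i}" if "i \<le> CARD('n)" for i
  proof (rule inj_onI)
    fix s t assume st: "s \<in> {..<i}" "t \<in> {..<i}" "A $ (row_at s :: 'n) = A $ row_at t"
    then have "row_at s = (row_at t :: 'n)" using inj by (simp add: inj_eq)
    then have "place (row_at s :: 'n) = place (row_at t :: 'n)" by simp
    then show "s = t" using st that by simp
  qed
  ultimately have card: "card {A $ j | j. place j < i} = i" if "i \<le> CARD('n)" for i
    using that by (simp add: card_image)
  have "vec.independent {A $ j | j. place j < i}" for i
    by (rule vec.independent_mono[OF ind]) (auto simp: rows_def row_def)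
  then have "vec.dim (F i) = i" if "i \<le> CARD('n)" for i
    unfolding F_def using card[OF that] by (simp add: vec.dim_eq_card_independent)
  moreover have "F i \<subseteq> F (Suc i)" for i
    unfolding F_def by (rule vec.span_mono) auto
  ultimately have "complete_flag F" by (auto simp: complete_flag_def F_def)
  moreover have "adapted_basis A F" by (simp add: adapted_basis_def F_def place_def)
  ultimately show ?thesis by (rule that)
qed

text \<open>A singular matrix is adapted to no complete flag and satisfies the condition vacuously.
  Combining with invertibility, again a general condition, yields actual flags.\<close>

lemma for_general_flags_ex:
  assumes "for_general_flags (P :: 'n::{finite,linorder} flag \<Rightarrow> _)"
  shows "\<exists>F G H. P F G H"
proof -
  have "for_general matrix_coords (\<lambda>M :: 'n cmatrix ^ 3. \<forall>r\<in>UNIV. det (M $ r) \<noteq> 0)"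
    by (intro for_general_ball[OF joined_by_lines_matrix]
        for_general_nonzero[where x="\<chi> r. mat 1"] polynomial_maps_det matrix_coords_coord) auto
  from for_general_ex[OF for_general_conj[OF joined_by_lines_matrix this assms[unfolded for_general_flags_def matrix_coords_def[symmetric]]]]
  obtain M :: "'n cmatrix ^ 3" where
    "\<forall>r. det (M $ r) \<noteq> 0" "\<And>F G H. complete_flag F \<Longrightarrow> complete_flag G \<Longrightarrow> complete_flag H \<Longrightarrow>
          adapted_basis (M $ 1) F \<Longrightarrow> adapted_basis (M $ 2) G \<Longrightarrow> adapted_basis (M $ 3) H \<Longrightarrow>
          P F G H" by auto
  moreover obtain F where "complete_flag F" "adapted_basis (M $ 1) F"
    using ex_adapted_flag calculation(1) by blast
  moreover obtain G where "complete_flag G" "adapted_basis (M $ 2) G"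
    using ex_adapted_flag calculation(1) by blast
  moreover obtain H where "complete_flag H" "adapted_basis (M $ 3) H"
    using ex_adapted_flag calculation(1) by blast
  ultimately show ?thesis by blast
qed

section \<open>Schubert conditions for three flags\<close>

lemma direct_sum_decomposition:
  fixes U U' W :: "'n::finite cvec set"
  assumes "vec.subspace U" "vec.subspace U'" "vec.subspace W" "U \<subseteq> W" "U' \<subseteq> W" "U \<inter> U' \<subseteq> {0}"
    "vec.dim W \<le> vec.dim U + vec.dim U'" "x \<in> W"
  obtains y z where "y \<in> U" "z \<in> U'" "x = y + z"
proof -
  let ?S = "{y + z | y z. y \<in> U \<and> z \<in> U'}"
  have "vec.dim (U \<inter> U') = 0" using assms(6) by (simp add: vec.dim_eq_0)
  then have "vec.dim W \<le> vec.dim ?S" using vec.dim_sums_Int[OF assms(1,2)] assms(7) by linarith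
  moreover have "?S \<subseteq> W" using assms by (auto intro: vec.subspace_add)
  ultimately have "?S = W"
    using vec.subspace_sums[OF assms(1,2)] assms(3) by (intro vec.subspace_dim_equal) auto
  then show ?thesis using assms(8) that by blast
qed

lemma nontrivial_intersection:
  fixes U U' W :: "'n::finite cvec set"
  assumes "vec.subspace U" "vec.subspace U'" "vec.subspace W" "U \<subseteq> W" "U' \<subseteq> W"
    "vec.dim W < vec.dim U + vec.dim U'"
  shows "\<exists>x \<in> U \<inter> U'. x \<noteq> 0"
proof (rule ccontr)
  assume "\<not> ?thesis"
  then have "vec.dim (U \<inter> U') = 0" by (auto simp: vec.dim_eq_0)
  moreover have "vec.dim {y + z | y z. y \<in> U \<and> z \<in> U'} \<le> vec.dim W"
    using assms by (intro vec.dim_subset) (auto intro: vec.subspace_add)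
  ultimately show False using vec.dim_sums_Int[OF assms(1,2)] assms(6) by linarith
qed

lemma dim_functional_kernel:
  fixes S :: "'n::finite cvec set" and f :: "'n cvec \<Rightarrow> complex"
  assumes "vec.subspace S" and f: "\<And>x y. f (x + y) = f x + f y" "\<And>c x. f (c *s x) = c * f x"
  shows "vec.dim S \<le> Suc (vec.dim {x \<in> S. f x = 0})" "vec.subspace {x \<in> S. f x = 0}"
proof -
  have f0: "f 0 = 0" using f(2)[of 0 0] by simp
  show sub: "vec.subspace {x \<in> S. f x = 0}"
    using assms(1) f f0 by (auto simp: vec.subspace_def)
  show "vec.dim S \<le> Suc (vec.dim {x \<in> S. f x = 0})"
  proof (cases "S \<subseteq> {x \<in> S. f x = 0}")
    case True
    then show ?thesis using vec.dim_subset le_SucI by blast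
  next
    case False
    then obtain w where w: "w \<in> S" "f w \<noteq> 0" by auto
    have "x \<in> vec.span (insert w {x \<in> S. f x = 0})" if "x \<in> S" for x
    proof -
      have "f (x - (f x / f w) *s w) = 0"
        using f(1)[of "x - (f x / f w) *s w" "(f x / f w) *s w"] f(2) w by simp
      then have "x - (f x / f w) *s w \<in> {x \<in> S. f x = 0}"
        using that w assms(1) by (auto intro: vec.subspace_diff vec.subspace_scale)
      then show ?thesis unfolding vec.span_breakdown_eq by (blast intro: vec.span_base)
    qed
    then have "vec.dim S \<le> vec.dim (insert w {x \<in> S. f x = 0})" by (intro vec.dim_mono) auto
    then show ?thesis by (simp add: vec.dim_insert split: if_splits)
  qed
qed

lemma dim_triangular:
  fixes w :: "nat \<Rightarrow> 'n::finite cvec" and f :: "nat \<Rightarrow> 'n cvec \<Rightarrow> complex"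
  assumes f: "\<And>i x y. f i (x + y) = f i x + f i y" "\<And>i c x. f i (c *s x) = c * f i x"
    and "\<And>i. i \<in> {1..m} \<Longrightarrow> f i (w i) \<noteq> 0" "\<And>i j. i \<in> {1..m} \<Longrightarrow> j \<in> {1..<i} \<Longrightarrow> f i (w j) = 0"
  shows "vec.dim (vec.span (w ` {1..m})) = m"
  using assms(3,4)
proof (induction m)
  case (Suc m)
  have f0: "f i 0 = 0" for i using f(2)[of i 0 0] by simp
  have "f (Suc m) x = 0" if "x \<in> vec.span (w ` {1..m})" for x
    using that by (induction rule: vec.span_induct_alt) (use Suc.prems(2) f f0 in auto)
  then have "w (Suc m) \<notin> vec.span (w ` {1..m})" using Suc.prems(1)[of "Suc m"] by auto
  moreover have "vec.dim (vec.span (w ` {1..m})) = m" by (intro Suc.IH) (use Suc.prems in auto)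
  ultimately show ?case by (simp add: atLeastAtMostSuc_conv vec.dim_insert)
qed simp

context general_flags
begin

section \<open>Splitting subspaces along opposite flags\<close>

lemma flag_subspace:
  assumes "a \<le> CARD('n)"
  shows "vec.subspace (F a)" "vec.subspace (G a)" "vec.subspace (H a)"
    "vec.dim (F a) = a" "vec.dim (G a) = a" "vec.dim (H a) = a"
  using flag_F flag_G flag_H assms by (auto simp: complete_flag_def)

lemma phi_0 [simp]: "\<phi> j 0 = 0"
  using phi_scale[of j 0 0] by simp

lemma phi_diff: "\<phi> j (x - y) = \<phi> j x - \<phi> j y"
  using phi_add[of j "x - y" y] by simp

lemma phi_eq_0: "(\<And>j. j < CARD('n) \<Longrightarrow> \<phi> j x = 0) \<Longrightarrow> x = 0"
  using G_iff[of 0 x] flag_subspace(5)[of 0] by (auto simp: vec.dim_eq_0)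

lemma phi_inj: "(\<And>j. j < CARD('n) \<Longrightarrow> \<phi> j x = \<phi> j y) \<Longrightarrow> x = y"
  using phi_eq_0[of "x - y"] by (simp add: phi_diff)

lemma G_H_disjoint:
  assumes "a + b \<le> CARD('n)" "x \<in> G a" "x \<in> H b"
  shows "x = 0"
proof (rule phi_eq_0)
  fix j assume "j < CARD('n)"
  then show "\<phi> j x = 0" using assms G_iff[of a x] H_iff[of b x] by (cases "a \<le> j") auto
qed

text \<open>For a + b <= n the members G a and H b meet in 0, so intersections with W of dimensions
  at least r and m - r already fill W.\<close>

lemma decompose:
  assumes "vec.subspace W" "vec.dim W = m" "r \<le> m" "a + b \<le> CARD('n)"
    "r \<le> vec.dim (W \<inter> G a)" "m - r \<le> vec.dim (W \<inter> H b)" "x \<in> W"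
  obtains y z where "y \<in> W \<inter> G a" "z \<in> W \<inter> H b" "x = y + z"
proof (rule direct_sum_decomposition[of "W \<inter> G a" "W \<inter> H b" W x])
  show "W \<inter> G a \<inter> (W \<inter> H b) \<subseteq> {0}" using G_H_disjoint assms(4) by auto
qed (use assms flag_subspace[of a] flag_subspace[of b] that in \<open>auto intro: vec.subspace_inter\<close>)

text \<open>Coordinate j lies in the gap: it vanishes on G a because a <= j, and on H b because j <
  n - b. Hence it vanishes on both summands of W.\<close>

lemma phi_vanish:
  assumes "vec.subspace W" "vec.dim W = m" "r \<le> m" "a \<le> j" "j + b < CARD('n)"
    "r \<le> vec.dim (W \<inter> G a)" "m - r \<le> vec.dim (W \<inter> H b)" "x \<in> W"
  shows "\<phi> j x = 0"
proof -
  obtain y z where yz: "y \<in> W \<inter> G a" "z \<in> W \<inter> H b" "x = y + z"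
    using decompose[of W m r a b x] assms by auto
  have "\<phi> j y = 0" using G_iff[of a y] yz assms by auto
  moreover have "\<phi> j z = 0" using H_iff[of b z] yz assms by auto
  ultimately show ?thesis using yz phi_add by simp
qed

lemma dim_F_kernel:
  assumes "s \<le> CARD('n)" "finite J"
  shows "s \<le> vec.dim {x \<in> F s. \<forall>j\<in>J. \<phi> j x = 0} + card J
    \<and> vec.subspace {x \<in> F s. \<forall>j\<in>J. \<phi> j x = 0}"
  using assms(2)
proof (induction J)
  case empty
  then show ?case using flag_subspace[OF assms(1)] by simp
next
  case (insert i J)
  let ?S = "{x \<in> F s. \<forall>j\<in>J. \<phi> j x = 0}"
  have "{x \<in> F s. \<forall>j\<in>insert i J. \<phi> j x = 0} = {x \<in> ?S. \<phi> i x = 0}" by auto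
  then show ?case
    using insert dim_functional_kernel[of ?S "\<phi> i"] phi_add phi_scale by auto
qed

end

text \<open>
  A coordinate outside \<open>support\<close> vanishes on every incident subspace, so \<open>card support\<close> bounds the
  dimension of the span of all of them.
\<close>

locale schubert_pair = general_flags F G H \<phi>
  for F G H :: "'n::{finite,linorder} flag" and \<phi> +
  fixes m :: nat and a b :: "nat \<Rightarrow> nat"
  assumes a_le: "i \<in> {1..m} \<Longrightarrow> a i \<le> CARD('n)" and b_le: "i \<in> {1..m} \<Longrightarrow> b i \<le> CARD('n)"
begin

text \<open>The coordinates that can be nonzero on G (a i) \<inter> H (b (m + 1 - i)).\<close>

definition block :: "nat \<Rightarrow> nat set" where
  "block i = {CARD('n) - b (m + 1 - i)..<a i}"

definition support :: "nat set" where
  "support = (\<Union>i\<in>{1..m}. block i)"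

definition incident :: "'n cvec set \<Rightarrow> bool" where
  "incident W \<longleftrightarrow> vec.subspace W \<and> vec.dim W = m \<and>
     (\<forall>i\<in>{1..m}. i \<le> vec.dim (W \<inter> G (a i))) \<and> (\<forall>i\<in>{1..m}. i \<le> vec.dim (W \<inter> H (b i)))"

lemma support_bound: "support \<subseteq> {..<CARD('n)}"
  using a_le by (auto simp: support_def block_def) (meson less_le_trans atLeastAtMost_iff)

text \<open>Let r be the last index with a r <= j. Since j is not in block r + 1, it also lies below
  n - b (m - r), and W splits along G (a r) and H (b (m - r)) with j in the gap.\<close>

lemma phi_outside_support:
  assumes W: "incident W" and j: "j < CARD('n)" "j \<notin> support" and x: "x \<in> W"
  shows "\<phi> j x = 0"
proof -
  define R where "R = {r \<in> {1..m}. a r \<le> j}"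
  have fin: "finite R" by (simp add: R_def)
  define r where "r = (if R = {} then 0 else Max R)"
  have r: "r \<le> m" "r = 0 \<or> r \<in> R"
    using Max_in[OF fin] by (auto simp: r_def R_def)
  have next': "j + b (m - r) < CARD('n)" if "r < m"
  proof -
    have "Suc r \<notin> R"
    proof
      assume "Suc r \<in> R"
      then have "Suc r \<le> Max R" "r = Max R" using Max_ge[OF fin] by (auto simp: r_def)
      then show False by simp
    qed
    then have "j < a (Suc r)" using that by (auto simp: R_def)
    then have "j < CARD('n) - b (m - r)" using j that
      by (force simp: support_def block_def)
    then show ?thesis by simp
  qed
  \<comment> \<open>For r = 0 or r = m one summand is 0 and is represented by the zero member of the
    flag.\<close>
  let ?a = "if r = 0 then 0 else a r" and ?b = "if r = m then 0 else b (m - r)"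
  show ?thesis
  proof (rule phi_vanish[of W m r ?a j ?b])
    show "?a \<le> j" using r(2) by (auto simp: R_def)
    show "j + ?b < CARD('n)" using next' r(1) j by auto
    show "r \<le> vec.dim (W \<inter> G ?a)" using W r by (auto simp: incident_def R_def)
    show "m - r \<le> vec.dim (W \<inter> H ?b)" using W r(1) by (auto simp: incident_def)
  qed (use W r x in \<open>auto simp: incident_def\<close>)
qed

text \<open>The two intersections with W have dimensions adding up to at least m + 1, so they share
  a nonzero vector, which opposite members allow only if their dimensions exceed n in total.\<close>

lemma pair_bound:
  assumes "incident W" "i \<in> {1..m}"
  shows "CARD('n) < a i + b (m + 1 - i)"
proof (rule ccontr)
  assume "\<not> ?thesis"
  then have small: "a i + b (m + 1 - i) \<le> CARD('n)" by simp
  have i': "m + 1 - i \<in> {1..m}" using assms by auto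
  have "i \<le> vec.dim (W \<inter> G (a i))" "m + 1 - i \<le> vec.dim (W \<inter> H (b (m + 1 - i)))"
    using assms i' by (auto simp: incident_def)
  moreover have "vec.dim W = m" using assms by (simp add: incident_def)
  ultimately have "vec.dim W < vec.dim (W \<inter> G (a i)) + vec.dim (W \<inter> H (b (m + 1 - i)))"
    using assms(2) by (simp only: atLeastAtMost_iff)
  then have "\<exists>x \<in> (W \<inter> G (a i)) \<inter> (W \<inter> H (b (m + 1 - i))). x \<noteq> 0"
    using assms flag_subspace[OF a_le[OF assms(2)]] flag_subspace[OF b_le[OF i']]
    by (intro nontrivial_intersection[of _ _ W]) (auto simp: incident_def intro!: vec.subspace_inter)
  then show False using G_H_disjoint small by blast
qed

lemma card_block:
  assumes "i \<in> {1..m}" "CARD('n) < a i + b (m + 1 - i)"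
  shows "card (block i) + CARD('n) = a i + b (m + 1 - i)"
proof -
  have "m + 1 - i \<in> {1..m}" using assms by auto
  then have "b (m + 1 - i) \<le> CARD('n)" by (rule b_le)
  then show ?thesis using assms by (simp add: block_def)
qed

lemma finite_block [simp]: "finite (block i)"
  by (simp add: block_def)

lemma sum_card_block:
  assumes "\<And>i. i \<in> {1..m} \<Longrightarrow> CARD('n) < a i + b (m + 1 - i)"
  shows "(\<Sum>i\<in>{1..m}. card (block i)) + m * CARD('n) = (\<Sum>i\<in>{1..m}. a i) + (\<Sum>i\<in>{1..m}. b i)"
proof -
  have "(\<Sum>i\<in>{1..m}. card (block i)) + m * CARD('n) = (\<Sum>i\<in>{1..m}. card (block i) + CARD('n))"
    by (simp add: sum.distrib)
  also have "\<dots> = (\<Sum>i\<in>{1..m}. a i + b (m + 1 - i))"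
    using card_block assms by (intro sum.cong) auto
  also have "\<dots> = (\<Sum>i\<in>{1..m}. a i) + (\<Sum>i\<in>{1..m}. b (m + 1 - i))" by (simp add: sum.distrib)
  also have "(\<Sum>i\<in>{1..m}. b (m + 1 - i)) = (\<Sum>i\<in>{1..m}. b i)"
    by (rule sum.reindex_bij_witness[of _ "\<lambda>i. m + 1 - i" "\<lambda>i. m + 1 - i"]) auto
  finally show ?thesis .
qed

text \<open>If s coordinates outside the support were available, x would vanish on them and lie in F
  s, against transversality.\<close>

lemma triple_bound:
  assumes "incident W" "x \<in> W" "x \<in> F s" "x \<noteq> 0"
  shows "CARD('n) < s + card support"
proof (rule ccontr)
  assume "\<not> ?thesis"
  then have "s \<le> card ({..<CARD('n)} - support)"
    using support_bound by (subst card_Diff_subset) (auto intro: finite_subset)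
  then obtain J where J: "J \<subseteq> {..<CARD('n)} - support" "card J = s"
    by (metis obtain_subset_with_card_n)
  then have "x = 0"
    using F_transversal[of J x] phi_outside_support[OF assms(1) _ _ assms(2)] assms(3) by auto
  then show False using assms(4) by simp
qed

lemma triple_sum_bound:
  assumes "incident W" "x \<in> W" "x \<in> F s" "x \<noteq> 0"
  shows "CARD('n) + m * CARD('n) < s + (\<Sum>i\<in>{1..m}. a i) + (\<Sum>i\<in>{1..m}. b i)"
proof -
  have "card support \<le> (\<Sum>i\<in>{1..m}. card (block i))"
    unfolding support_def by (rule card_UN_le) simp
  then show ?thesis using triple_bound[OF assms] sum_card_block[OF pair_bound[OF assms(1)]] by simp
qed

text \<open>Block r + 1 starts at n - b (m - r) < a r, so the coordinate a r - 1 belongs to both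
  block r and block r + 1, and the union bound loses at least one.\<close>

lemma triple_sum_bound_overlap:
  assumes "incident W" "x \<in> W" "x \<in> F s" "x \<noteq> 0"
    and r: "1 \<le> r" "r < m" "CARD('n) < a r + b (m - r)" "a r \<le> a (Suc r)"
  shows "CARD('n) + m * CARD('n) + 1 < s + (\<Sum>i\<in>{1..m}. a i) + (\<Sum>i\<in>{1..m}. b i)"
proof -
  note pb = pair_bound[OF assms(1)]
  have "m + 1 - r \<in> {1..m}" "r \<in> {1..m}" using r by auto
  then have "b (m + 1 - r) \<le> CARD('n)" "CARD('n) < a r + b (m + 1 - r)" using b_le pb by blast+
  then have ar: "a r - 1 \<in> block r" by (auto simp: block_def)
  moreover have "a r - 1 \<in> block (Suc r)" using ar r by (auto simp: block_def)
  ultimately have "support \<subseteq> (\<Union>i\<in>{1..m}. if i = r then block r - {a r - 1} else block i)"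
    using r by (fastforce simp: support_def split: if_splits)
  then have "card support \<le> card (\<Union>i\<in>{1..m}. if i = r then block r - {a r - 1} else block i)"
    by (intro card_mono) auto
  also have "\<dots> \<le> (\<Sum>i\<in>{1..m}. card (if i = r then block r - {a r - 1} else block i))"
    by (rule card_UN_le) simp
  also have "\<dots> < (\<Sum>i\<in>{1..m}. card (block i))"
  proof (rule sum_strict_mono_ex1)
    show "\<exists>i\<in>{1..m}. card (if i = r then block r - {a r - 1} else block i) < card (block i)"
      using r card_Diff1_less[OF finite_block ar] by (intro bexI[of _ r]) auto
  qed (auto intro!: card_mono)
  finally show ?thesis using triple_bound[OF assms(1-4)] sum_card_block[OF pb] by simp
qed

end

text \<open>
  The blocks are nonempty and disjoint, and there is exactly one vector \<open>u\<close> in \<open>F s\<close>, up to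
  scalars, with coordinates in the support. An incident \<open>V\<close> meeting \<open>F s\<close> contains \<open>u\<close>, and hence
  all truncations of \<open>u\<close> at the ends of blocks, which form a basis.
\<close>

locale schubert_pair_disjoint = schubert_pair F G H \<phi> m a b
  for F G H :: "'n::{finite,linorder} flag" and \<phi> m a b +
  fixes s :: nat
  assumes m_pos: "1 \<le> m"
    and blocks_nonempty: "i \<in> {1..m} \<Longrightarrow> CARD('n) < a i + b (m + 1 - i)"
    and blocks_disjoint: "1 \<le> r \<Longrightarrow> r < m \<Longrightarrow> a r + b (m - r) \<le> CARD('n)"
    and sum_a_b: "s + (\<Sum>i\<in>{1..m}. a i) + (\<Sum>i\<in>{1..m}. b i) = m * CARD('n) + CARD('n) + 1"
begin

text \<open>Block j + 1 starts no earlier than block j ends and is nonempty, so it ends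
  later.\<close>

lemma a_mono:
  assumes "1 \<le> i" "i \<le> j" "j \<le> m"
  shows "a i \<le> a j"
  using assms(2,3)
proof (induction j rule: dec_induct)
  case (step j)
  then have "CARD('n) < a (Suc j) + b (m + 1 - Suc j)" using assms(1) blocks_nonempty[of "Suc j"] by simp
  moreover have "a j + b (m - j) \<le> CARD('n)" using blocks_disjoint[of j] step assms(1) by simp
  moreover have "m + 1 - Suc j = m - j" by simp
  ultimately have "a j \<le> a (Suc j)" by simp
  then show ?case using step by simp
qed simp

lemma b_mono:
  assumes "1 \<le> i" "i \<le> j" "j \<le> m"
  shows "b i \<le> b j"
  using assms(2,3)
proof (induction j rule: dec_induct)
  case (step j)
  then have "CARD('n) < a (m - j) + b (m + 1 - (m - j))" using assms(1) blocks_nonempty[of "m - j"] by simp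
  moreover have "a (m - j) + b (m - (m - j)) \<le> CARD('n)"
    using blocks_disjoint[of "m - j"] step assms(1) by simp
  moreover have "m + 1 - (m - j) = Suc j" "m - (m - j) = j" using step by auto
  ultimately have "b j \<le> b (Suc j)" by simp
  then show ?case using step by simp
qed simp

lemma gap_not_support:
  assumes "1 \<le> r" "r \<le> m" "a r \<le> j" "r < m \<Longrightarrow> j + b (m - r) < CARD('n)"
  shows "j \<notin> support"
proof
  assume "j \<in> support"
  then obtain i where i: "1 \<le> i" "i \<le> m" "CARD('n) - b (m + 1 - i) \<le> j" "j < a i"
    by (auto simp: support_def block_def)
  show False
  proof (cases "i \<le> r")
    case True
    then show False using a_mono[of i r] i assms by simp
  next
    case False
    then have "b (m + 1 - i) \<le> b (m - r)" using i by (intro b_mono) auto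
    then show False using False i assms by simp
  qed
qed

lemma card_support: "s + card support = CARD('n) + 1"
proof -
  have less: "block i \<inter> block j = {}" if "i \<in> {1..m}" "j \<in> {1..m}" "i < j" for i j
  proof -
    have "1 \<le> j - 1" "j - 1 < m" "m - (j - 1) = m + 1 - j" using that by auto
    then have "a (j - 1) + b (m + 1 - j) \<le> CARD('n)" using blocks_disjoint[of "j - 1"] by simp
    moreover have "a i \<le> a (j - 1)" using that by (intro a_mono) auto
    ultimately show ?thesis by (auto simp: block_def)
  qed
  have "block i \<inter> block j = {}" if "i \<in> {1..m}" "j \<in> {1..m}" "i \<noteq> j" for i j
    using less[OF that(1,2)] less[OF that(2,1)] that(3) by (cases "i < j") auto
  then have "card support = (\<Sum>i\<in>{1..m}. card (block i))"
    unfolding support_def by (intro card_UN_disjoint) auto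
  then show ?thesis using sum_card_block[OF blocks_nonempty] sum_a_b by simp
qed

lemma s_le: "s \<le> CARD('n)" and support_nonempty: "support \<noteq> {}"
proof -
  have "1 \<in> {1..m}" using m_pos by simp
  then have "a 1 - 1 \<in> block 1" using blocks_nonempty[of 1] b_le[of m] by (auto simp: block_def)
  then show "support \<noteq> {}" using \<open>1 \<in> {1..m}\<close> unfolding support_def by blast
  then have "card support > 0" using support_bound by (auto simp: card_gt_0_iff intro: finite_subset)
  then show "s \<le> CARD('n)" using card_support by simp
qed

lemma card_complement: "Suc (card ({..<CARD('n)} - support)) = s"
proof -
  have "card support \<le> CARD('n)" using card_mono[OF _ support_bound] by simp
  then show ?thesis using support_bound card_support by (subst card_Diff_subset) (auto intro: finite_subset)
qed

text \<open>The coordinates outside the support number s - 1. One more from the support makes s,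
  exactly what transversality to F s requires; so a supported vector of F s is determined by any one
  of its support coordinates.\<close>

lemma F_support_zero:
  assumes "x \<in> F s" "\<And>j. j < CARD('n) \<Longrightarrow> j \<notin> support \<Longrightarrow> \<phi> j x = 0" "i \<in> support" "\<phi> i x = 0"
  shows "x = 0"
proof (rule F_transversal[of "insert i ({..<CARD('n)} - support)"])
  have "card (insert i ({..<CARD('n)} - support)) = s" using assms(3) card_complement by simp
  then show "x \<in> F (card (insert i ({..<CARD('n)} - support)))" using assms(1) by simp
qed (use assms support_bound in auto)

text \<open>In F s, the s - 1 conditions outside the support leave a nonzero solution, and
  \<open>F_support_zero\<close> then forbids any further zero coordinate.\<close>

lemma ex_supported_vector:
  obtains u where "u \<in> F s" "\<And>j. j < CARD('n) \<Longrightarrow> j \<notin> support \<Longrightarrow> \<phi> j u = 0"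
    "\<And>j. j \<in> support \<Longrightarrow> \<phi> j u \<noteq> 0"
proof -
  let ?K = "{x \<in> F s. \<forall>j\<in>{..<CARD('n)} - support. \<phi> j x = 0}"
  have "s \<le> vec.dim ?K + card ({..<CARD('n)} - support)" using dim_F_kernel[OF s_le] by blast
  then have "vec.dim ?K \<noteq> 0" using card_complement by linarith
  then obtain u where "u \<in> ?K" "u \<noteq> 0" by (auto simp: vec.dim_eq_0)
  then show ?thesis using F_support_zero[of u] that[of u] by blast
qed

lemma ex1_incident:
  obtains V where "{W. incident W \<and> (\<exists>x \<in> W \<inter> F s. x \<noteq> 0)} = {V}"
proof -
  obtain u where u: "u \<in> F s" "\<And>j. j < CARD('n) \<Longrightarrow> j \<notin> support \<Longrightarrow> \<phi> j u = 0"
    "\<And>j. j \<in> support \<Longrightarrow> \<phi> j u \<noteq> 0" using ex_supported_vector by blast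
  \<comment> \<open>Truncation at c exists because the whole space is the sum of G c and H (n -
    c).\<close>
  have "\<exists>y. \<forall>j<CARD('n). \<phi> j y = (if j < c then \<phi> j u else 0)" if c: "c \<le> CARD('n)" for c
  proof -
    obtain y z where yz: "y \<in> UNIV \<inter> G c" "z \<in> UNIV \<inter> H (CARD('n) - c)" "u = y + z"
      by (rule decompose[of UNIV "CARD('n)" c c "CARD('n) - c" u])
        (use c flag_subspace[of c] flag_subspace[of "CARD('n) - c"] in \<open>auto simp: vec.dim_UNIV vec.dimension_def card_cart_basis\<close>)
    then have "\<phi> j y = (if j < c then \<phi> j u else 0)" if "j < CARD('n)" for j
      using G_iff[of c y] H_iff[of "CARD('n) - c" z] c that phi_add[of j y z] by auto
    then show ?thesis by blast
  qed
  then have "\<exists>y. \<forall>r\<in>{1..m}. \<forall>j<CARD('n). \<phi> j (y r) = (if j < a r then \<phi> j u else 0)"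
    using a_le by (intro bchoice) blast
  then obtain y where y: "\<And>r j. r \<in> {1..m} \<Longrightarrow> j < CARD('n) \<Longrightarrow> \<phi> j (y r) = (if j < a r then \<phi> j u else 0)"
    by blast
  define V where "V = vec.span (y ` {1..m})"
  have y_G: "y i \<in> G (a j)" if "i \<in> {1..m}" "i \<le> j" "j \<le> m" for i j
    using that G_iff[of "a j" "y i"] a_le[of j] a_mono[of i j] y[of i] by auto
  \<comment> \<open>The last coordinate of a block, and in \<open>start\<close> the first one,
    separate the truncations: u is nonzero there, while the truncations at earlier blocks
    vanish.\<close>
  have end': "a i - 1 \<in> support \<and> 0 < a i" if "i \<in> {1..m}" for i
  proof -
    have "m + 1 - i \<in> {1..m}" using that by auto
    then have "b (m + 1 - i) \<le> CARD('n)" by (rule b_le)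
    then have "a i - 1 \<in> block i" "0 < a i" using blocks_nonempty[OF that] by (auto simp: block_def)
    then show ?thesis using that by (auto simp: support_def)
  qed
  have start: "CARD('n) - b t \<in> support" if t: "t \<in> {1..m}" for t
  proof -
    have "m + 1 - t \<in> {1..m}" "m + 1 - (m + 1 - t) = t" using t by auto
    moreover have "CARD('n) < a (m + 1 - t) + b t" using blocks_nonempty[of "m + 1 - t"] calculation by simp
    ultimately show ?thesis using b_le[OF t] unfolding support_def block_def
      by (intro UN_I[of "m + 1 - t"]) auto
  qed
  have y_dim: "vec.dim (vec.span (y ` {1..i})) = i" if "i \<le> m" for i
  proof (rule dim_triangular[where f = "\<lambda>i. \<phi> (a i - 1)"])
    fix t assume t: "t \<in> {1..i}"
    then show "\<phi> (a t - 1) (y t) \<noteq> 0"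
      using that end'[of t] y[of t "a t - 1"] u(3) support_bound by auto
    fix j assume j: "j \<in> {1..<t}"
    have "a j \<le> a t - 1"
    proof -
      have "a j \<le> a (t - 1)" using j t that by (intro a_mono) auto
      moreover have "CARD('n) < a t + b (m + 1 - t)" using blocks_nonempty[of t] t that by simp
      moreover have "1 \<le> t - 1" "t - 1 < m" using t j that by auto
      then have "a (t - 1) + b (m - (t - 1)) \<le> CARD('n)" by (rule blocks_disjoint)
      moreover have "m - (t - 1) = m + 1 - t" using t by auto
      ultimately show ?thesis by simp
    qed
    then show "\<phi> (a t - 1) (y j) = 0"
      using that t j end'[of t] y[of j "a t - 1"] support_bound by auto
  qed (use phi_add phi_scale in auto)
  have V: "vec.subspace V" "vec.dim V = m" using y_dim[of m] by (auto simp: V_def)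
  have y_V: "y i \<in> V" if "i \<in> {1..m}" for i using that by (auto simp: V_def intro: vec.span_base)
  have y_m: "y m = u"
  proof (rule phi_inj)
    fix j assume "j < CARD('n)"
    then show "\<phi> j (y m) = \<phi> j u"
      using y[of m j] m_pos gap_not_support[of m j] u(2)[of j] by (cases "j < a m") auto
  qed
  \<comment> \<open>The complementary tails of u: \<open>z t\<close> begins after block m - t. The
    next block starts at n - b t, so the tail lies in H (b t). For t = m no block precedes and the
    tail is u itself.\<close>
  define z where "z t = (if t = m then u else u - y (m - t))" for t
  have z: "\<phi> j (z t) = (if t = m \<or> a (m - t) \<le> j then \<phi> j u else 0)"
    if "t \<in> {1..m}" "j < CARD('n)" for t j
  proof (cases "t = m")
    case False
    then have "m - t \<in> {1..m}" using that by auto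
    then show ?thesis using y[of "m - t" j] that False by (auto simp: z_def phi_diff)
  qed (simp add: z_def)
  have z_V: "z t \<in> V" if "t \<in> {1..m}" for t
    using y_V[of m] y_V[of "m - t"] that m_pos y_m V(1) by (auto simp: z_def intro: vec.subspace_diff)
  have z_H: "z t \<in> H (b i)" if t: "t \<in> {1..m}" "t \<le> i" "i \<le> m" for t i
  proof -
    have "\<phi> j (z t) = 0" if j: "j < CARD('n) - b i" for j
    proof -
      have "b t \<le> b i" using t by (intro b_mono) auto
      then have jt: "j + b t < CARD('n)" using j by simp
      have "j \<notin> support" if "t = m \<or> a (m - t) \<le> j"
      proof (cases "t = m")
        case True
        then have "b (m + 1 - i') \<le> b t" if "i' \<in> {1..m}" for i' using that by (intro b_mono) auto
        then have "\<not> CARD('n) - b (m + 1 - i') \<le> j" if "i' \<in> {1..m}" for i'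
          using that jt by fastforce
        then show ?thesis by (auto simp: support_def block_def)
      next
        case False
        then show ?thesis using t that jt by (intro gap_not_support[of "m - t"]) auto
      qed
      then show ?thesis using z[of t j] t j u(2)[of j] by auto
    qed
    then show ?thesis using H_iff[of "b i" "z t"] b_le[of i] t by auto
  qed
  have z_dim: "vec.dim (vec.span (z ` {1..i})) = i" if "i \<le> m" for i
  proof (rule dim_triangular[where f = "\<lambda>t. \<phi> (CARD('n) - b t)"])
    fix t assume t: "t \<in> {1..i}"
    then have "t \<in> {1..m}" using that by auto
    then have st: "CARD('n) - b t \<in> support" "CARD('n) - b t < CARD('n)" using start support_bound by blast+
    have "t = m \<or> a (m - t) \<le> CARD('n) - b t" 
    proof (cases "t = m")
      case False
      then have "1 \<le> m - t" "m - t < m" "m - (m - t) = t" using t that by auto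
      then have "a (m - t) + b t \<le> CARD('n)" using blocks_disjoint[of "m - t"] by simp
      then show ?thesis by (intro disjI2) linarith
    qed simp
    then show "\<phi> (CARD('n) - b t) (z t) \<noteq> 0"
      using z[of t "CARD('n) - b t"] st u(3) \<open>t \<in> {1..m}\<close> by simp
    fix j assume j: "j \<in> {1..<t}"
    have "m + 1 - t \<in> {1..m}" "m + 1 - (m + 1 - t) = t" using t that by auto
    then have "CARD('n) < a (m + 1 - t) + b t" using blocks_nonempty[of "m + 1 - t"] by simp
    then have "CARD('n) - b t < a (m + 1 - t)" using b_le[OF \<open>t \<in> {1..m}\<close>] by simp
    also have "\<dots> \<le> a (m - j)" using j t that by (intro a_mono) auto
    finally show "\<phi> (CARD('n) - b t) (z j) = 0"
      using z[of j "CARD('n) - b t"] j t that st by auto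
  qed (use phi_add phi_scale in auto)
  have "incident V"
    unfolding incident_def
  proof (intro conjI ballI)
    fix i assume i: "i \<in> {1..m}"
    have "vec.span (y ` {1..i}) \<subseteq> V \<inter> G (a i)"
      using i V(1) y_V y_G flag_subspace(2)[OF a_le[OF i]]
      by (intro vec.span_minimal) (auto intro: vec.subspace_inter)
    from vec.dim_subset[OF this] show "i \<le> vec.dim (V \<inter> G (a i))" using y_dim[of i] i by simp
    have "vec.span (z ` {1..i}) \<subseteq> V \<inter> H (b i)"
      using i V(1) z_V z_H flag_subspace(3)[OF b_le[OF i]]
      by (intro vec.span_minimal) (auto intro: vec.subspace_inter)
    from vec.dim_subset[OF this] show "i \<le> vec.dim (V \<inter> H (b i))" using z_dim[of i] i by simp
  qed (use V in auto)
  moreover have "u \<in> V \<inter> F s" using y_V[of m] y_m m_pos u(1) by auto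
  moreover have "u \<noteq> 0" using u(3) support_nonempty by fastforce
  moreover have "W = V" if W: "incident W" and x: "x \<in> W \<inter> F s" "x \<noteq> 0" for W x
  proof -
    note W' = W[unfolded incident_def]
    obtain i where i: "i \<in> support" using support_nonempty by blast
    \<comment> \<open>Both x and u are supported vectors of F s, so agreement in the single
      coordinate i makes x equal to c times u.\<close>
    define c where "c = \<phi> i x / \<phi> i u"
    have out: "\<phi> j x = 0" if "j < CARD('n)" "j \<notin> support" for j
      using phi_outside_support[OF W that] x by blast
    have "x - c *s u = 0"
    proof (rule F_support_zero[OF _ _ i])
      show "x - c *s u \<in> F s"
        using x u(1) flag_subspace(1)[OF s_le] by (auto intro: vec.subspace_diff vec.subspace_scale)
      show "\<phi> j (x - c *s u) = 0" if "j < CARD('n)" "j \<notin> support" for j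
        using out u(2) that by (simp add: phi_diff phi_scale)
      show "\<phi> i (x - c *s u) = 0" using u(3)[OF i] by (simp add: phi_diff phi_scale c_def)
    qed
    then have "x = c *s u" "c \<noteq> 0" using x(2) by auto
    then have "u = (1 / c) *s x" by simp
    then have uW: "u \<in> W" using x W' by (auto intro: vec.subspace_scale)
    \<comment> \<open>W splits along G (a r) and H (b (m - r)). As a r + b (m - r) <= n, the
      coordinates of the two parts of u do not overlap, so the first part must be the truncation
      \<open>y r\<close>.\<close>
    have "y r \<in> W" if r: "r \<in> {1..m}" for r
    proof (cases "r = m")
      case True
      then show ?thesis using uW y_m by simp
    next
      case False
      then have rm: "m - r \<in> {1..m}" "1 \<le> r" "r < m" using r by auto
      obtain v w where vw: "v \<in> W \<inter> G (a r)" "w \<in> W \<inter> H (b (m - r))" "u = v + w"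
        by (rule decompose[of W m r "a r" "b (m - r)" u])
          (use W' r rm uW blocks_disjoint[of r] in auto)
      have "v = y r"
      proof (rule phi_inj)
        fix j assume j: "j < CARD('n)"
        then show "\<phi> j v = \<phi> j (y r)"
          using y[OF r j] vw phi_add[of j v w] G_iff[OF a_le[OF r], of v] H_iff[OF b_le[OF rm(1)], of w]
            blocks_disjoint[OF rm(2,3)] by (cases "j < a r") auto
      qed
      then show ?thesis using vw by simp
    qed
    then have "V \<subseteq> W" unfolding V_def using W' by (intro vec.span_minimal) auto
    then show "W = V" using V W' by (intro vec.subspace_dim_equal[symmetric]) auto
  qed
  ultimately have "{W. incident W \<and> (\<exists>x \<in> W \<inter> F s. x \<noteq> 0)} = {V}" by blast
  then show ?thesis by (rule that)
qed

end

section \<open>The Pieri rule\<close>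

lemma partitions_in_length: "mu \<in> partitions_in l k \<Longrightarrow> length mu = l"
  by (simp add: partitions_in_def)

lemma partitions_in_nth_le: "mu \<in> partitions_in l k \<Longrightarrow> i < l \<Longrightarrow> mu ! i \<le> k"
  using nth_mem by (fastforce simp: partitions_in_def)

lemma partitions_in_antimono:
  "mu \<in> partitions_in l k \<Longrightarrow> i \<le> j \<Longrightarrow> j < l \<Longrightarrow> mu ! j \<le> mu ! i"
  by (cases "i = j") (auto simp: partitions_in_def sorted_wrt_iff_nth_less)

lemma partitions_in_iff:
  "mu \<in> partitions_in l k \<longleftrightarrow> length mu = l \<and> (\<forall>i<l. mu ! i \<le> k) \<and> (\<forall>i j. i < j \<longrightarrow> j < l \<longrightarrow> mu ! j \<le> mu ! i)"
  by (auto simp: partitions_in_def sorted_wrt_iff_nth_less in_set_conv_nth subset_iff)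

lemma sum_list_nth_pred: "length mu = l \<Longrightarrow> (\<Sum>i\<in>{1..l}. mu ! (i - 1)) = sum_list mu"
  unfolding sum_list_sum_nth
  by (rule sum.reindex_bij_witness[of _ Suc "\<lambda>i. i - 1"]) auto

lemma sum_list_nth_rev: "length nu = l \<Longrightarrow> (\<Sum>i\<in>{1..l}. nu ! (l - i)) = sum_list nu"
  unfolding sum_list_sum_nth
  by (rule sum.reindex_bij_witness[of _ "\<lambda>i. l - i" "\<lambda>i. l - i"]) auto

lemma dual_partition_nth:
  "nu \<in> partitions_in l k \<Longrightarrow> i \<in> {1..l} \<Longrightarrow> k + i - dual_partition k nu ! (i - 1) = i + nu ! (l - i)"
  using partitions_in_nth_le[of nu l k "l - i"]
  by (auto simp: dual_partition_def rev_nth partitions_in_length)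

lemma sum_list_dual_partition:
  assumes "nu \<in> partitions_in l k"
  shows "sum_list (dual_partition k nu) + sum_list nu = l * k"
proof -
  have "\<forall>x\<in>set nu. x \<le> k" using assms by (auto simp: partitions_in_def)
  then have "sum_list (map (\<lambda>p. k - p) nu) + sum_list nu = length nu * k"
    by (induction nu) auto
  then show ?thesis using assms by (simp add: dual_partition_def partitions_in_length)
qed

definition horizontal_strip :: "nat list \<Rightarrow> nat list \<Rightarrow> bool" where
  "horizontal_strip mu nu \<longleftrightarrow>
     (\<forall>i<length nu. mu ! i \<le> nu ! i \<and> (Suc i < length nu \<longrightarrow> nu ! Suc i \<le> mu ! i))"

lemma dim_Int_lower:
  fixes U U' :: "'n::finite cvec set"
  assumes "vec.subspace U" "vec.subspace U'"
  shows "vec.dim U + vec.dim U' \<le> vec.dim (U \<inter> U') + CARD('n)"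
proof -
  have "vec.dim {x + y | x y. x \<in> U \<and> y \<in> U'} \<le> CARD('n)"
    by (rule vec.dim_subset_UNIV[unfolded vec.dimension_def card_cart_basis])
  then show ?thesis using vec.dim_sums_Int[OF assms] by linarith
qed

lemma dim_pos_iff:
  fixes U :: "'n::finite cvec set"
  shows "1 \<le> vec.dim U \<longleftrightarrow> (\<exists>x\<in>U. x \<noteq> 0)"
proof -
  have "1 \<le> vec.dim U \<longleftrightarrow> vec.dim U \<noteq> 0" by linarith
  also have "\<dots> \<longleftrightarrow> (\<exists>x\<in>U. x \<noteq> 0)" unfolding vec.dim_eq_0 by blast
  finally show ?thesis .
qed

text \<open>For i >= 2 the condition holds for every V, because l + (k + i) - n = i. Only the
  condition for i = 1 remains.\<close>

lemma schubert_special_iff: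
  fixes F :: "'n::finite flag"
  assumes F: "complete_flag F" and n: "CARD('n) = l + k" and l: "1 \<le> l" and p: "p \<le> k"
    and V: "V \<in> Gr l"
  shows "V \<in> schubert l k (p # replicate (l - 1) 0) F \<longleftrightarrow> (\<exists>x \<in> V \<inter> F (k + 1 - p). x \<noteq> 0)"
proof -
  have "i \<le> vec.dim (V \<inter> F (k + i - (p # replicate (l - 1) 0) ! (i - 1)))" if "i \<in> {2..l}" for i
  proof -
    have "(p # replicate (l - 1) 0) ! (i - 1) = 0" using that by (auto simp: nth_Cons split: nat.split)
    moreover have "vec.subspace (F (k + i))" "vec.dim (F (k + i)) = k + i"
      using F that n by (auto simp: complete_flag_def)
    ultimately show ?thesis using dim_Int_lower[of V "F (k + i)"] V n by (simp add: Gr_def)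
  qed
  moreover have "{1..l} = insert 1 {2..l}" using l by auto
  ultimately have "V \<in> schubert l k (p # replicate (l - 1) 0) F \<longleftrightarrow> 1 \<le> vec.dim (V \<inter> F (k + 1 - p))"
    using V by (simp add: schubert_def)
  then show ?thesis by (simp only: dim_pos_iff)
qed

context general_flags
begin

text \<open>With 1-based parts, block i runs from k + i - 1 - nu_i up to, but not including, k + i -
  mu_i. Blocks are nonempty iff mu_i <= nu_i, and consecutive ones are disjoint iff nu_{i+1} <=
  mu_i: together this is the horizontal strip condition.\<close>

lemma pieri_intersection:
  assumes n: "CARD('n) = l + k" and l: "1 \<le> l" and p: "p \<le> k"
    and mu: "mu \<in> partitions_in l k" and nu: "nu \<in> partitions_in l k"
    and sum: "p + sum_list mu = sum_list nu"
  defines "X \<equiv> schubert l k (p # replicate (l - 1) 0) F \<inter> schubert l k mu G \<inter> schubert l k (dual_partition k nu) H"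
  shows "if horizontal_strip mu nu then \<exists>V. X = {V} else X = {}"
proof -
  define a where "a i = k + i - mu ! (i - 1)" for i
  define b where "b i = i + nu ! (l - i)" for i
  define s where "s = k + 1 - p"
  interpret schubert_pair F G H \<phi> l a b
  proof
    show "a i \<le> CARD('n)" if "i \<in> {1..l}" for i using that n by (auto simp: a_def)
    show "b i \<le> CARD('n)" if "i \<in> {1..l}" for i
      using that n partitions_in_nth_le[OF nu, of "l - i"] by (auto simp: b_def)
  qed
  have X: "X = {V. incident V \<and> (\<exists>x \<in> V \<inter> F s. x \<noteq> 0)}"
    using schubert_special_iff[OF flag_F n l p] dual_partition_nth[OF nu]
    by (auto simp: X_def s_def incident_def schubert_def Gr_def a_def b_def)
  have ai: "a i + mu ! (i - 1) = k + i" if "i \<in> {1..l}" for i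
  proof -
    have "i - 1 < l" using that by auto
    from partitions_in_nth_le[OF mu this] show ?thesis by (simp add: a_def)
  qed
  have "(\<Sum>i\<in>{1..l}. a i) + sum_list mu = (\<Sum>i\<in>{1..l}. k + i)"
    using ai by (simp add: sum_list_nth_pred[OF partitions_in_length[OF mu], symmetric] sum.distrib[symmetric])
  moreover have "(\<Sum>i\<in>{1..l}. b i) = (\<Sum>i\<in>{1..l}. i) + sum_list nu"
    by (simp add: b_def sum_list_nth_rev[OF partitions_in_length[OF nu], symmetric] sum.distrib)
  moreover have "2 * (\<Sum>i\<in>{1..l}. i) = l * l + l"
    by (induction l) auto
  \<comment> \<open>Complementary codimensions make the total the least value that
    \<open>triple_sum_bound\<close> permits, so any overlap of blocks is excluded.\<close>
  ultimately have total: "s + (\<Sum>i\<in>{1..l}. a i) + (\<Sum>i\<in>{1..l}. b i) = l * CARD('n) + CARD('n) + 1"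
    using sum p n by (simp add: sum.distrib s_def algebra_simps)
  show ?thesis
  proof (cases "horizontal_strip mu nu")
    case True
    interpret schubert_pair_disjoint F G H \<phi> l a b s
    proof
      fix i assume i: "i \<in> {1..l}"
      then have "l - (l + 1 - i) = i - 1" "i - 1 < l" by auto
      moreover have "mu ! (i - 1) \<le> nu ! (i - 1)"
        using True i by (auto simp: horizontal_strip_def partitions_in_length[OF nu])
      ultimately show "CARD('n) < a i + b (l + 1 - i)" using ai[OF i] i n by (auto simp: b_def)
    next
      fix r assume r: "1 \<le> r" "r < l"
      then have "nu ! r \<le> mu ! (r - 1)"
        using True by (auto simp: horizontal_strip_def partitions_in_length[OF nu] dest!: spec[of _ "r - 1"])
      then show "a r + b (l - r) \<le> CARD('n)" using ai[of r] r n by (auto simp: b_def)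
    qed (use l total in auto)
    show ?thesis using True ex1_incident X by metis
  next
    case False
    have False if V: "V \<in> X" for V
    proof -
      obtain x where x: "incident V" "x \<in> V" "x \<in> F s" "x \<noteq> 0" using V X by auto
      have mn: "mu ! i \<le> nu ! i" if "i < l" for i
      proof -
        have "Suc i \<in> {1..l}" "l - (l - i) = i" using that by auto
        then show ?thesis using pair_bound[OF x(1), of "Suc i"] ai[of "Suc i"] n by (simp add: b_def)
      qed
      then obtain i where i: "Suc i < l" "mu ! i < nu ! Suc i"
        using False by (auto simp: horizontal_strip_def partitions_in_length[OF nu] not_le)
      have "l - (l - Suc i) = Suc i" using i by simp
      then have "CARD('n) < a (Suc i) + b (l - Suc i)" using ai[of "Suc i"] i n by (simp add: b_def)
      moreover have "a (Suc i) \<le> a (Suc (Suc i))"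
        using ai[of "Suc i"] ai[of "Suc (Suc i)"] i partitions_in_antimono[OF mu, of i "Suc i"] by simp
      ultimately show False
        using triple_sum_bound_overlap[OF x, of "Suc i"] i total by simp
    qed
    then show ?thesis using False by auto
  qed
qed

text \<open>Enlarged to dimension m = l + d, W inherits the conditions of V2 in rows i < l and all
  those of V3; the other rows carry conditions true of every m-dimensional subspace. Inserting these
  into \<open>triple_sum_bound\<close> leaves d^2 < 1.\<close>

lemma no_common_subspace:
  assumes n: "CARD('n) = l + k" and l: "1 \<le> l" and p: "p \<le> k"
    and mu: "mu \<in> partitions_in l k" and nu: "nu \<in> partitions_in l k" and mu0: "mu ! (l - 1) = 0"
    and sum: "p + sum_list mu = sum_list nu + d * (l + k)" and d: "1 \<le> d"
    and W: "vec.subspace W" "vec.dim W \<le> l + d" "V1 \<subseteq> W" "V2 \<subseteq> W" "V3 \<subseteq> W"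
    and V1: "V1 \<in> schubert l k (p # replicate (l - 1) 0) F"
    and V2: "V2 \<in> schubert l k mu G" and V3: "V3 \<in> schubert l k (dual_partition k nu) H"
  shows False
proof -
  have sum_mu: "(\<Sum>i\<in>{1..<l}. mu ! (i - 1)) = sum_list mu"
  proof -
    have "{1..l} = insert l {1..<l}" using l by auto
    then show ?thesis using sum_list_nth_pred[OF partitions_in_length[OF mu]] mu0 by simp
  qed
  have "sum_list mu \<le> (\<Sum>i\<in>{1..<l}. k)"
    unfolding sum_mu[symmetric] using partitions_in_nth_le[OF mu] by (intro sum_mono) auto
  then have "d * (l + k) \<le> l * k" using sum p l by (cases l) auto
  moreover have "d * l < d * (l + k)" using d p sum \<open>1 \<le> l\<close> calculation
    by (cases "k = 0") (auto simp: add_mult_distrib2)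
  ultimately have "d * l < l * k" by linarith
  \<comment> \<open>This gives l + d < n, so that W can be enlarged, and makes the subtractions k +
    i - d genuine.\<close>
  then have dk: "d < k" by (simp add: mult.commute[of d l])
  define m where "m = l + d"
  obtain W' where W': "W \<subseteq> W'" "vec.subspace W'" "vec.dim W' = m"
  proof -
    have "\<exists>W'. W \<subseteq> W' \<and> vec.subspace W' \<and> vec.dim W' = m" if "vec.dim W \<le> m"
      using that W(1)
    proof (induction "m - vec.dim W" arbitrary: W)
      case 0
      then show ?case by (metis diff_is_0_eq le_antisym order_refl)
    next
      case (Suc t)
      have "W \<noteq> UNIV" using Suc n dk by (auto simp: m_def vec.dim_UNIV vec.dimension_def card_cart_basis)
      then obtain w where w: "w \<notin> W" by blast
      have "vec.span W = W" using Suc by (simp add: vec.span_eq_iff)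
      then have "vec.dim (vec.span (insert w W)) = Suc (vec.dim W)"
        using w by (metis vec.dim_insert vec.dim_span Suc_eq_plus1)
      then have "\<exists>W'. vec.span (insert w W) \<subseteq> W' \<and> vec.subspace W' \<and> vec.dim W' = m"
        using Suc by (intro Suc.hyps(1)) auto
      then obtain W' where W': "vec.span (insert w W) \<subseteq> W'" "vec.subspace W'" "vec.dim W' = m" by blast
      have "W \<subseteq> W'" using vec.span_superset[of "insert w W"] W'(1) by auto
      with W' show ?case by (intro exI[of _ W'] conjI)
    qed
    then show ?thesis using W(2) that m_def by auto
  qed
  \<comment> \<open>In row l the condition of V2 is trivial, as mu vanishes there, and the generic
    value k + l - d is smaller by d. This gain is decisive: with k + l the estimate would end in d^2
    < d + 1, which d = 1 satisfies.\<close>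
  define a where "a i = (if i < l then k + i - mu ! (i - 1) else k + i - d)" for i
  define b where "b i = (if i \<le> l then i + nu ! (l - i) else k + i - d)" for i
  define s where "s = k + 1 - p"
  interpret schubert_pair F G H \<phi> m a b
  proof
    show "a i \<le> CARD('n)" if "i \<in> {1..m}" for i using that n dk by (auto simp: a_def m_def)
    show "b i \<le> CARD('n)" if "i \<in> {1..m}" for i
      using that n dk partitions_in_nth_le[OF nu, of "l - i"] by (auto simp: b_def m_def)
  qed
  \<comment> \<open>The value k + i - d is chosen so that m + (k + i - d) - n = i.\<close>
  have generic: "i \<le> vec.dim (W' \<inter> G (k + i - d))" "i \<le> vec.dim (W' \<inter> H (k + i - d))" if "i \<in> {1..m}" for i
  proof -
    have le: "k + i - d \<le> CARD('n)" using that n dk by (auto simp: m_def)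
    show "i \<le> vec.dim (W' \<inter> G (k + i - d))" "i \<le> vec.dim (W' \<inter> H (k + i - d))"
      using dim_Int_lower[OF W'(2) flag_subspace(2)[OF le]] dim_Int_lower[OF W'(2) flag_subspace(3)[OF le]]
        flag_subspace[OF le] W'(3) n dk by (auto simp: m_def)
  qed
  have "incident W'" unfolding incident_def
  proof (intro conjI ballI)
    fix i assume i: "i \<in> {1..m}"
    show "i \<le> vec.dim (W' \<inter> G (a i))"
    proof (cases "i < l")
      case True
      then have "i \<le> vec.dim (V2 \<inter> G (a i))" using V2 i by (auto simp: schubert_def a_def)
      also have "\<dots> \<le> vec.dim (W' \<inter> G (a i))" using W W' by (intro vec.dim_subset) auto
      finally show ?thesis .
    qed (use generic i in \<open>auto simp: a_def\<close>)
    show "i \<le> vec.dim (W' \<inter> H (b i))"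
    proof (cases "i \<le> l")
      case True
      then have "i \<in> {1..l}" using i by simp
      moreover from this have "i \<le> vec.dim (V3 \<inter> H (k + i - dual_partition k nu ! (i - 1)))"
        using V3 by (simp add: schubert_def)
      ultimately have "i \<le> vec.dim (V3 \<inter> H (b i))"
        using dual_partition_nth[OF nu, of i] by (simp add: b_def)
      also have "\<dots> \<le> vec.dim (W' \<inter> H (b i))" using W W' by (intro vec.dim_subset) auto
      finally show ?thesis .
    qed (use generic i in \<open>auto simp: b_def\<close>)
  qed (use W' in auto)
  moreover obtain x where "x \<in> V1" "x \<in> F s" "x \<noteq> 0"
    using schubert_special_iff[OF flag_F n l p, of V1] V1 by (auto simp: s_def schubert_def)
  ultimately have bound: "CARD('n) + m * CARD('n) < s + (\<Sum>i\<in>{1..m}. a i) + (\<Sum>i\<in>{1..m}. b i)"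
    using triple_sum_bound[of W' x s] W W' by auto
  have "{1..m} = {1..<l} \<union> {l..m}" using l by (auto simp: m_def)
  then have split: "(\<Sum>i\<in>{1..m}. f i) = (\<Sum>i\<in>{1..<l}. f i) + (\<Sum>i\<in>{l..m}. f i)" for f :: "nat \<Rightarrow> nat"
    by (simp add: sum.union_disjoint Int_def)
  have "{1..m} = {1..l} \<union> {l<..m}" using l by (auto simp: m_def)
  then have split': "(\<Sum>i\<in>{1..m}. f i) = (\<Sum>i\<in>{1..l}. f i) + (\<Sum>i\<in>{l<..m}. f i)" for f :: "nat \<Rightarrow> nat"
    by (simp add: sum.union_disjoint Int_def)
  have "(\<Sum>i\<in>{1..<l}. a i) + sum_list mu = (\<Sum>i\<in>{1..<l}. k + i)"
    unfolding sum_mu[symmetric] sum.distrib[symmetric] using partitions_in_nth_le[OF mu]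
    by (intro sum.cong) (auto simp: a_def intro!: le_add_diff_inverse2 trans_le_add1)
  moreover have "(\<Sum>i\<in>{l..m}. a i) + (d + 1) * d = (\<Sum>i\<in>{l..m}. k + i)"
  proof -
    have "(\<Sum>i\<in>{l..m}. a i) + (\<Sum>i\<in>{l..m}. d) = (\<Sum>i\<in>{l..m}. k + i)"
      unfolding sum.distrib[symmetric] using dk by (intro sum.cong) (auto simp: a_def)
    then show ?thesis by (simp add: m_def)
  qed
  ultimately have A: "(\<Sum>i\<in>{1..m}. a i) + sum_list mu + (d + 1) * d = (\<Sum>i\<in>{1..m}. k + i)"
    unfolding split by simp
  have "(\<Sum>i\<in>{1..l}. b i) = (\<Sum>i\<in>{1..l}. i) + sum_list nu"
    by (simp add: b_def sum_list_nth_rev[OF partitions_in_length[OF nu], symmetric] sum.distrib)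
  moreover have "(\<Sum>i\<in>{l<..m}. b i) + d * d = (\<Sum>i\<in>{l<..m}. i) + d * k"
  proof -
    have "(\<Sum>i\<in>{l<..m}. b i) + (\<Sum>i\<in>{l<..m}. d) = (\<Sum>i\<in>{l<..m}. i) + (\<Sum>i\<in>{l<..m}. k)"
      unfolding sum.distrib[symmetric] using dk by (intro sum.cong) (auto simp: b_def)
    then show ?thesis by (simp add: m_def)
  qed
  ultimately have B: "(\<Sum>i\<in>{1..m}. b i) + d * d = (\<Sum>i\<in>{1..m}. i) + sum_list nu + d * k"
    unfolding split' by simp
  have S: "2 * (\<Sum>i\<in>{1..m}. i) = m * m + m" by (induction m) auto
  have K: "(\<Sum>i\<in>{1..m}. k + i) = m * k + (\<Sum>i\<in>{1..m}. i)" by (simp add: sum.distrib)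
  have "int s = int k + 1 - int p" using p by (simp add: s_def)
  moreover have "int (\<Sum>i\<in>{1..m}. a i) = int m * int k + int (\<Sum>i\<in>{1..m}. i) - int (sum_list mu) - (int d + 1) * int d"
    using A K by (simp flip: of_nat_mult of_nat_add of_nat_sum add: algebra_simps)
  moreover have "int (\<Sum>i\<in>{1..m}. b i) = int (\<Sum>i\<in>{1..m}. i) + int (sum_list nu) + int d * int k - int d * int d"
    using B by (simp flip: of_nat_mult of_nat_add of_nat_sum add: algebra_simps)
  moreover have "2 * int (\<Sum>i\<in>{1..m}. i) = int m * int m + int m"
    using S by (simp flip: of_nat_mult of_nat_add of_nat_sum)
  moreover have "int p + int (sum_list mu) = int (sum_list nu) + int d * (int l + int k)"
    using sum by (simp flip: of_nat_mult of_nat_add)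
  moreover have "(int l + int k) + int m * (int l + int k) < int s + int (\<Sum>i\<in>{1..m}. a i) + int (\<Sum>i\<in>{1..m}. b i)"
    using bound n by (simp flip: of_nat_mult of_nat_add of_nat_sum)
  ultimately have "int d * int d < 1"
    by (simp add: m_def algebra_simps)
  moreover have "1 \<le> d * d" using mult_le_mono[OF d d] by simp
  ultimately show False by (simp flip: of_nat_mult)
qed

end

section \<open>Hyperplanes and the Pluecker embedding\<close>

definition leibniz :: "nat \<Rightarrow> (nat \<Rightarrow> nat \<Rightarrow> complex) \<Rightarrow> complex" where
  "leibniz l M = (\<Sum>\<pi> | \<pi> permutes {..<l}. of_int (sign \<pi>) * (\<Prod>i<l. M (\<pi> i) i))"

lemma leibniz_cong:
  assumes "\<And>a i. a < l \<Longrightarrow> i < l \<Longrightarrow> M a i = N a i"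
  shows "leibniz l M = leibniz l N"
  unfolding leibniz_def
  by (intro sum.cong refl arg_cong2[where f = "(*)"] prod.cong assms)
    (auto dest: permutes_in_image)

lemma leibniz_permute:
  assumes \<tau>: "\<tau> permutes {..<l}"
  shows "leibniz l (\<lambda>a i. M a (\<tau> i)) = of_int (sign \<tau>) * leibniz l M"
proof -
  have perm: "permutation \<pi>" if "\<pi> permutes {..<l}" for \<pi>
    using that permutation_permutes by blast
  have "leibniz l M = (\<Sum>\<pi> | \<pi> permutes {..<l}. of_int (sign (\<pi> \<circ> inv_into UNIV \<tau>)) * (\<Prod>i<l. M ((\<pi> \<circ> inv_into UNIV \<tau>) i) i))"
    unfolding leibniz_def
    by (rule sum.reindex_bij_witness[of _ "\<lambda>\<pi>. \<pi> \<circ> inv_into UNIV \<tau>" "\<lambda>\<pi>. \<pi> \<circ> \<tau>"])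
      (use \<tau> in \<open>auto simp: comp_assoc permutes_inv_o permutes_compose permutes_inv\<close>)
  also have "\<dots> = (\<Sum>\<pi> | \<pi> permutes {..<l}. of_int (sign \<tau>) * (of_int (sign \<pi>) * (\<Prod>i<l. M (\<pi> i) (\<tau> i))))"
  proof (intro sum.cong refl)
    fix \<pi> assume "\<pi> \<in> {\<pi>. \<pi> permutes {..<l}}"
    then have "sign (\<pi> \<circ> inv_into UNIV \<tau>) = sign \<tau> * sign \<pi>"
      using \<tau> perm by (simp add: sign_compose sign_inverse permutation_inverse)
    moreover have "(\<Prod>i<l. M ((\<pi> \<circ> inv_into UNIV \<tau>) i) i) = (\<Prod>i<l. M (\<pi> i) (\<tau> i))"
      using \<tau> by (subst prod.permute[OF \<tau>]) (simp add: o_def permutes_inverses)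
    ultimately show "of_int (sign (\<pi> \<circ> inv_into UNIV \<tau>)) * (\<Prod>i<l. M ((\<pi> \<circ> inv_into UNIV \<tau>) i) i) =
        of_int (sign \<tau>) * (of_int (sign \<pi>) * (\<Prod>i<l. M (\<pi> i) (\<tau> i)))" by simp
  qed
  also have "\<dots> = of_int (sign \<tau>) * leibniz l (\<lambda>a i. M a (\<tau> i))"
    by (simp add: leibniz_def sum_distrib_left)
  finally have "leibniz l M = of_int (sign \<tau>) * leibniz l (\<lambda>a i. M a (\<tau> i))" .
  moreover have "of_int (sign \<tau>) * of_int (sign \<tau>) = (1 :: complex)"
    by (metis of_int_1 of_int_mult sign_idempotent)
  ultimately show ?thesis by (simp flip: mult.assoc)
qed

lemma leibniz_equal_columns:
  assumes "\<not> inj_on \<kappa> {..<l}"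
  shows "leibniz l (\<lambda>a i. \<alpha> a (\<kappa> i)) = 0"
proof -
  obtain i j where ij: "i < l" "j < l" "i \<noteq> j" "\<kappa> i = \<kappa> j" using assms by (auto simp: inj_on_def)
  have "leibniz l (\<lambda>a t. \<alpha> a (\<kappa> (Transposition.transpose i j t))) = - leibniz l (\<lambda>a i. \<alpha> a (\<kappa> i))"
    using leibniz_permute[of "Transposition.transpose i j" l "\<lambda>a i. \<alpha> a (\<kappa> i)"] ij
    by (simp add: permutes_swap_id sign_swap_id)
  moreover have "\<kappa> (Transposition.transpose i j t) = \<kappa> t" for t using ij by (simp add: Transposition.transpose_def)
  ultimately show ?thesis by simp
qed

text \<open>Multilinearity in the columns: \<kappa> records which summand is taken from column i.
  With B the index set of the matrix this leads to multiplicativity, with B the coordinate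
  directions to forms on wedges.\<close>

lemma leibniz_expand:
  assumes "finite B"
  shows "leibniz l (\<lambda>a i. \<Sum>b\<in>B. \<alpha> a b * M b i) =
    (\<Sum>\<kappa>\<in>{..<l} \<rightarrow>\<^sub>E B. (\<Prod>i<l. M (\<kappa> i) i) * leibniz l (\<lambda>a i. \<alpha> a (\<kappa> i)))"
proof -
  have "leibniz l (\<lambda>a i. \<Sum>b\<in>B. \<alpha> a b * M b i) =
     (\<Sum>\<pi> | \<pi> permutes {..<l}. \<Sum>\<kappa>\<in>{..<l} \<rightarrow>\<^sub>E B. of_int (sign \<pi>) * (\<Prod>i<l. \<alpha> (\<pi> i) (\<kappa> i) * M (\<kappa> i) i))"
    unfolding leibniz_def using assms by (subst prod_sum_PiE) (auto simp: sum_distrib_left)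
  also have "\<dots> = (\<Sum>\<kappa>\<in>{..<l} \<rightarrow>\<^sub>E B. \<Sum>\<pi> | \<pi> permutes {..<l}. of_int (sign \<pi>) * (\<Prod>i<l. \<alpha> (\<pi> i) (\<kappa> i) * M (\<kappa> i) i))"
    by (rule sum.swap)
  also have "\<dots> = (\<Sum>\<kappa>\<in>{..<l} \<rightarrow>\<^sub>E B. (\<Prod>i<l. M (\<kappa> i) i) * leibniz l (\<lambda>a i. \<alpha> a (\<kappa> i)))"
    by (simp add: leibniz_def prod.distrib sum_distrib_left mult_ac)
  finally show ?thesis .
qed

text \<open>Column 0 is free below its diagonal entry, since a permutation other than the identity
  moves some i >= 1. This freedom lets the first functional be replaced in
  \<open>hyperplane_separating\<close>, where its values on the other basis vectors are
  unknown.\<close>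

lemma leibniz_unitriangular:
  assumes "\<And>a i. a < l \<Longrightarrow> 1 \<le> i \<Longrightarrow> i < l \<Longrightarrow> a \<noteq> i \<Longrightarrow> M a i = 0" "\<And>i. i < l \<Longrightarrow> M i i = 1"
  shows "leibniz l M = 1"
proof -
  have "of_int (sign \<pi>) * (\<Prod>i<l. M (\<pi> i) i) = (if \<pi> = id then 1 else 0)" if \<pi>: "\<pi> permutes {..<l}" for \<pi>
  proof (cases "\<pi> = id")
    case True
    then show ?thesis using assms(2) by (simp add: sign_id)
  next
    case False
    have "\<exists>i. 1 \<le> i \<and> i < l \<and> \<pi> i \<noteq> i"
    proof (rule ccontr)
      assume "\<not> ?thesis"
      then have fix1: "\<pi> i = i" if "1 \<le> i" for i using that \<pi> by (cases "i < l") (auto simp: permutes_def)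
      have "\<pi> 0 = 0"
      proof (rule ccontr)
        assume "\<pi> 0 \<noteq> 0"
        then have "\<pi> (\<pi> 0) = \<pi> 0" using fix1 by simp
        then show False using \<open>\<pi> 0 \<noteq> 0\<close> permutes_inj[OF \<pi>] by (simp add: inj_eq)
      qed
      then have "\<pi> = id" using fix1 by (metis eq_id_iff less_one linorder_not_less)
      then show False using False by simp
    qed
    then obtain i where i: "1 \<le> i" "i < l" "\<pi> i \<noteq> i" by blast
    then have "M (\<pi> i) i = 0" using assms(1) permutes_in_image[OF \<pi>, of i] by simp
    then have "(\<Prod>i<l. M (\<pi> i) i) = 0" using i by (intro prod_zero) auto
    then show ?thesis using False by simp
  qed
  then have "leibniz l M = (\<Sum>\<pi> | \<pi> permutes {..<l}. if \<pi> = id then 1 else 0)"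
    unfolding leibniz_def by (intro sum.cong) auto
  also have "\<dots> = 1" using permutes_id[of "{..<l}"] by (subst sum.delta) (auto simp: finite_permutations)
  finally show ?thesis .
qed

lemma leibniz_self_map:
  assumes "\<kappa> \<in> {..<l} \<rightarrow> {..<l}"
  shows "\<exists>c. \<forall>\<alpha>. leibniz l (\<lambda>a i. \<alpha> a (\<kappa> i)) = c * leibniz l \<alpha>"
proof (cases "inj_on \<kappa> {..<l}")
  case False
  then show ?thesis by (intro exI[of _ 0]) (simp add: leibniz_equal_columns)
next
  case True
  define \<tau> where "\<tau> i = (if i < l then \<kappa> i else i)" for i
  have "\<kappa> ` {..<l} = {..<l}" using True assms by (intro card_subset_eq) (auto simp: card_image)
  then have "bij_betw \<tau> {..<l} {..<l}" using True by (auto simp: bij_betw_def \<tau>_def inj_on_def)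
  then have "\<tau> permutes {..<l}" by (rule bij_imp_permutes) (simp add: \<tau>_def)
  from leibniz_permute[OF this]
  have "leibniz l (\<lambda>a i. \<alpha> a (\<kappa> i)) = of_int (sign \<tau>) * leibniz l \<alpha>" for \<alpha>
    using leibniz_cong[of l "\<lambda>a i. \<alpha> a (\<kappa> i)" "\<lambda>a i. \<alpha> a (\<tau> i)"] by (simp add: \<tau>_def)
  then show ?thesis by blast
qed

text \<open>The expansion shows that the left side is \<open>leibniz l \<alpha>\<close> times a
  factor independent of \<alpha>; the identity matrix in place of \<alpha> identifies the
  factor.\<close>

lemma leibniz_mult: "leibniz l (\<lambda>a i. \<Sum>b<l. \<alpha> a b * M b i) = leibniz l \<alpha> * leibniz l M"
proof -
  have "\<exists>c. \<forall>\<kappa>\<in>{..<l} \<rightarrow>\<^sub>E {..<l}. \<forall>\<alpha>. leibniz l (\<lambda>a i. \<alpha> a (\<kappa> i)) = c \<kappa> * leibniz l \<alpha>"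
    by (intro bchoice ballI leibniz_self_map) auto
  then obtain c where c: "\<And>\<kappa> \<alpha>. \<kappa> \<in> {..<l} \<rightarrow>\<^sub>E {..<l} \<Longrightarrow> leibniz l (\<lambda>a i. \<alpha> a (\<kappa> i)) = c \<kappa> * leibniz l \<alpha>"
    by blast
  have expand: "leibniz l (\<lambda>a i. \<Sum>b<l. \<alpha> a b * M b i) =
      leibniz l \<alpha> * (\<Sum>\<kappa>\<in>{..<l} \<rightarrow>\<^sub>E {..<l}. (\<Prod>i<l. M (\<kappa> i) i) * c \<kappa>)" for \<alpha>
    unfolding leibniz_expand[OF finite_lessThan] sum_distrib_left
    by (intro sum.cong refl) (simp add: c)
  have "leibniz l (\<lambda>a b. if a = b then 1 else 0) = 1"
    by (rule leibniz_unitriangular) auto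
  moreover have "leibniz l (\<lambda>a i. \<Sum>b<l. (if a = b then 1 else 0) * M b i) = leibniz l M"
    by (rule leibniz_cong) (simp add: if_distrib[of "\<lambda>t. t * _"] cong: if_cong)
  ultimately show ?thesis using expand[of "\<lambda>a b. if a = b then 1 else 0"] expand[of \<alpha>] by simp
qed

section \<open>Linear functionals and forms on the exterior power\<close>

definition linear_functional :: "('n::finite cvec \<Rightarrow> complex) \<Rightarrow> bool" where
  "linear_functional \<xi> \<longleftrightarrow> (\<forall>x y. \<xi> (x + y) = \<xi> x + \<xi> y) \<and> (\<forall>c x. \<xi> (c *s x) = c * \<xi> x)"

lemma linear_functional_zero: "linear_functional \<xi> \<Longrightarrow> \<xi> 0 = 0"
  by (metis linear_functional_def mult_zero_left vec.scale_zero_left)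

lemma linear_functional_sum:
  "linear_functional \<xi> \<Longrightarrow> \<xi> (\<Sum>b\<in>B. c b *s v b) = (\<Sum>b\<in>B. c b * \<xi> (v b))"
  by (induction B rule: infinite_finite_induct) (auto simp: linear_functional_zero, auto simp: linear_functional_def)

lemma linear_functional_vanish_span:
  assumes "linear_functional \<xi>" "\<And>x. x \<in> S \<Longrightarrow> \<xi> x = 0" "x \<in> vec.span S"
  shows "\<xi> x = 0"
  using assms(3)
  by (induction rule: vec.span_induct_alt) (use assms in \<open>auto simp: linear_functional_zero linear_functional_def\<close>)

lemma linear_functional_extend:
  assumes "vec.independent (B :: 'n::finite cvec set)"
  shows "\<exists>\<xi>. linear_functional \<xi> \<and> (\<forall>x\<in>B. \<xi> x = f x)"
proof -
  obtain g :: "'n cvec \<Rightarrow> 'n cvec" where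
    g: "Vector_Spaces.linear (*s) (*s) g" "\<forall>x\<in>B. g x = (\<chi> i. f x)"
    using vec.linear_independent_extend[OF assms, of "\<lambda>x. \<chi> i. f x"] by blast
  interpret Vector_Spaces.linear "(*s)" "(*s)" g by (rule g(1))
  show ?thesis
    \<comment> \<open>On B all coordinates of \<open>g x\<close> equal \<open>f x\<close>, so an
      arbitrary one serves.\<close>
    by (rule exI[of _ "\<lambda>x. g x $ undefined"]) (use g(2) in \<open>auto simp: linear_functional_def add scale\<close>)
qed

lemma wedge_nth:
  "wedge l v $ I = (if card I = l then leibniz l (\<lambda>a i. v a $ (sorted_list_of_set I ! i)) else 0)"
  by (simp add: wedge_def leibniz_def)

text \<open>A minor with columns in the order \<kappa> is 0 if a column repeats; otherwise sorting
  the columns gives a Pluecker coordinate up to sign.\<close>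

lemma wedge_coordinate:
  fixes \<kappa> :: "nat \<Rightarrow> 'n::{finite,linorder}"
  shows "\<exists>c. \<forall>v. leibniz l (\<lambda>a i. v a $ \<kappa> i) = (\<Sum>I\<in>UNIV. c $ I * wedge l v $ I)"
proof (cases "inj_on \<kappa> {..<l}")
  case False
  then have "\<forall>v :: nat \<Rightarrow> 'n cvec. leibniz l (\<lambda>a i. v a $ \<kappa> i) = (\<Sum>I\<in>UNIV. (0 :: complex ^ ('n set)) $ I * wedge l v $ I)"
    using leibniz_equal_columns[OF False, of "\<lambda>a b. _ a $ b"] by simp
  then show ?thesis by blast
next
  case True
  define I where "I = \<kappa> ` {..<l}"
  define L where "L = sorted_list_of_set I"
  have card: "card I = l" using True by (simp add: I_def card_image)
  then have L: "set L = I" "length L = l" by (auto simp: L_def I_def)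
  have "\<exists>t. t < l \<and> L ! t = \<kappa> i" if "i < l" for i
    using that L by (metis I_def image_eqI in_set_conv_nth lessThan_iff)
  then obtain t where t: "\<And>i. i < l \<Longrightarrow> t i < l \<and> L ! t i = \<kappa> i" by metis
  define \<tau> where "\<tau> i = (if i < l then t i else i)" for i
  have inj: "inj_on \<tau> {..<l}"
    using True t by (intro inj_onI) (metis \<tau>_def inj_onD lessThan_iff)
  moreover have "\<tau> ` {..<l} = {..<l}"
    using t by (intro card_subset_eq) (auto simp: card_image[OF inj], simp add: \<tau>_def)
  ultimately have "bij_betw \<tau> {..<l} {..<l}" by (simp add: bij_betw_def)
  then have \<tau>: "\<tau> permutes {..<l}" by (rule bij_imp_permutes) (simp add: \<tau>_def)
  have "leibniz l (\<lambda>a i. v a $ \<kappa> i) = (\<Sum>J\<in>UNIV. axis I (of_int (sign \<tau>)) $ J * wedge l v $ J)"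
    for v :: "nat \<Rightarrow> 'n cvec"
  proof -
    have "leibniz l (\<lambda>a i. v a $ \<kappa> i) = leibniz l (\<lambda>a i. v a $ (L ! \<tau> i))"
      using t by (intro leibniz_cong) (simp add: \<tau>_def)
    also have "\<dots> = of_int (sign \<tau>) * wedge l v $ I"
      using leibniz_permute[OF \<tau>, of "\<lambda>a i. v a $ (L ! i)"] card by (simp add: wedge_nth L_def)
    also have "\<dots> = (\<Sum>J\<in>UNIV. axis I (of_int (sign \<tau>)) $ J * wedge l v $ J)"
      by (simp add: axis_def if_distrib[of "\<lambda>t. t * _"] cong: if_cong)
    finally show ?thesis .
  qed
  then show ?thesis by blast
qed

text \<open>c is the coordinate vector of the decomposable form given by the wedge product of \<xi>
  0, ..., \<xi> (l - 1).\<close>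

abbreviation wedge_form ::
    "complex ^ ('n set) \<Rightarrow> nat \<Rightarrow> (nat \<Rightarrow> 'n::{finite,linorder} cvec \<Rightarrow> complex) \<Rightarrow> bool" where
  "wedge_form c l \<xi> \<equiv> \<forall>v. (\<Sum>I\<in>UNIV. c $ I * wedge l v $ I) = leibniz l (\<lambda>a i. \<xi> i (v a))"

lemma wedge_functional:
  fixes \<xi> :: "nat \<Rightarrow> 'n::{finite,linorder} cvec \<Rightarrow> complex"
  assumes "\<And>i. linear_functional (\<xi> i)"
  shows "\<exists>c. wedge_form c l \<xi>"
proof -
  obtain c :: "(nat \<Rightarrow> 'n) \<Rightarrow> complex ^ ('n set)" where
    c: "\<And>\<kappa> v. leibniz l (\<lambda>a i. v a $ \<kappa> i) = (\<Sum>I\<in>UNIV. c \<kappa> $ I * wedge l v $ I)"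
    using wedge_coordinate[where l=l and 'n='n] by metis
  define C where "C = (\<Sum>\<kappa>\<in>{..<l} \<rightarrow>\<^sub>E UNIV. (\<Prod>i<l. \<xi> i (axis (\<kappa> i) 1)) *s c \<kappa>)"
  have "(\<Sum>I\<in>UNIV. C $ I * wedge l v $ I) = leibniz l (\<lambda>a i. \<xi> i (v a))" for v
  proof -
    have "leibniz l (\<lambda>a i. \<xi> i (v a)) = leibniz l (\<lambda>a i. \<Sum>b\<in>UNIV. v a $ b * \<xi> i (axis b 1))"
    proof (rule leibniz_cong)
      fix a i
      have "v a = (\<Sum>b\<in>UNIV. v a $ b *s axis b 1)" by (rule basis_expansion[symmetric])
      then show "\<xi> i (v a) = (\<Sum>b\<in>UNIV. v a $ b * \<xi> i (axis b 1))"
        using linear_functional_sum[OF assms] by metis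
    qed
    also have "\<dots> = (\<Sum>\<kappa>\<in>{..<l} \<rightarrow>\<^sub>E UNIV. (\<Prod>i<l. \<xi> i (axis (\<kappa> i) 1)) * (\<Sum>I\<in>UNIV. c \<kappa> $ I * wedge l v $ I))"
      by (simp add: leibniz_expand c)
    also have "\<dots> = (\<Sum>I\<in>UNIV. C $ I * wedge l v $ I)"
      unfolding C_def sum_distrib_left sum_component vector_smult_component sum_distrib_right
      by (subst sum.swap) (simp add: mult_ac)
    finally show ?thesis by simp
  qed
  then show ?thesis by blast
qed

lemma Gr_basis:
  assumes "V \<in> Gr l" "x \<in> V" "x \<noteq> 0"
  obtains v where "v 0 = x" "\<And>i. i < l \<Longrightarrow> v i \<in> V" "inj_on v {..<l}" "vec.independent (v ` {..<l})"
    "vec.span (v ` {..<l}) = V" "1 \<le> l"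
proof -
  have "vec.independent {x}" using assms(3) by (simp add: vec.independent_insert)
  then obtain B where B: "{x} \<subseteq> B" "B \<subseteq> V" "vec.independent B" "V \<subseteq> vec.span B"
    using vec.maximal_independent_subset_extend[of "{x}" V] assms(2) by blast
  have V: "vec.subspace V" "vec.dim V = l" using assms(1) by (auto simp: Gr_def)
  have card: "card B = l" using vec.basis_card_eq_dim[of B V] B V by auto
  have fin: "finite B" using vec.finiteI_independent B(3) by blast
  have l: "1 \<le> l" using B(1) fin card by (metis card_0_eq insert_not_empty less_one linorder_not_less subset_empty)
  have "card {1..<l} = card (B - {x})" using B(1) fin card by simp
  then obtain h where h: "bij_betw h {1..<l} (B - {x})" using fin finite_same_card_bij[of "{1..<l}" "B - {x}"] by auto
  define v where "v i = (if i = 0 then x else h i)" for i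
  have eq: "{..<l} = insert 0 {1..<l}" using l by auto
  have v1: "v ` {1..<l} = h ` {1..<l}" by (intro image_cong) (auto simp: v_def)
  also have "\<dots> = B - {x}" using h by (simp add: bij_betw_def)
  finally have v1: "v ` {1..<l} = B - {x}" .
  have "inj_on v {1..<l} \<longleftrightarrow> inj_on h {1..<l}" by (intro inj_on_cong) (auto simp: v_def)
  then have "inj_on v {1..<l}" using h by (simp add: bij_betw_def)
  moreover have "v 0 = x" by (simp add: v_def)
  ultimately have v: "v ` {..<l} = B" "inj_on v {..<l}"
    unfolding eq image_insert inj_on_insert v1 using B(1) v1 by auto
  show ?thesis
  proof (rule that[of v])
    show "vec.span (v ` {..<l}) = V"
      using B V by (auto simp: v vec.span_subspace)
  qed (use v B l in \<open>auto simp: v_def\<close>)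
qed

section \<open>Hyperplanes containing the Pluecker image of a subspace\<close>

lemma subspace_hyperplane: "vec.subspace (hyperplane c)"
  by (auto simp: vec.subspace_def hyperplane_def algebra_simps sum.distrib
      simp flip: sum_distrib_left)

lemma plucker_subset_hyperplane:
  "plucker l V \<subseteq> hyperplane c \<longleftrightarrow>
     (\<forall>v. (\<forall>i<l. v i \<in> V) \<longrightarrow> (\<Sum>I\<in>UNIV. c $ I * wedge l v $ I) = 0)"
proof
  assume "plucker l V \<subseteq> hyperplane c"
  moreover have "wedge l v \<in> plucker l V" if "\<forall>i<l. v i \<in> V" for v
    unfolding plucker_def using that by (intro vec.span_base) blast
  ultimately show "\<forall>v. (\<forall>i<l. v i \<in> V) \<longrightarrow> (\<Sum>I\<in>UNIV. c $ I * wedge l v $ I) = 0"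
    by (auto simp: hyperplane_def subset_iff)
next
  assume "\<forall>v. (\<forall>i<l. v i \<in> V) \<longrightarrow> (\<Sum>I\<in>UNIV. c $ I * wedge l v $ I) = 0"
  then show "plucker l V \<subseteq> hyperplane c"
    unfolding plucker_def by (intro vec.span_minimal subspace_hyperplane) (auto simp: hyperplane_def)
qed

lemma span_image_sum:
  fixes v :: "nat \<Rightarrow> 'n::finite cvec"
  assumes "inj_on v {..<l}" "x \<in> vec.span (v ` {..<l})"
  shows "\<exists>c. x = (\<Sum>i<l. c i *s v i)"
proof -
  obtain u where "x = (\<Sum>w\<in>v ` {..<l}. u w *s w)"
    using assms(2) vec.span_finite[of "v ` {..<l}"] by auto
  then have "x = (\<Sum>i<l. u (v i) *s v i)" using assms(1) by (simp add: sum.reindex)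
  then show ?thesis by (intro exI[of _ "\<lambda>i. u (v i)"])
qed

lemma span_image_sum_family:
  fixes v :: "nat \<Rightarrow> 'n::finite cvec"
  assumes "inj_on v {..<l}" "\<And>a. a < l \<Longrightarrow> w a \<in> vec.span (v ` {..<l})"
  obtains \<alpha> where "\<And>a. a < l \<Longrightarrow> w a = (\<Sum>b<l. \<alpha> a b *s v b)"
proof -
  have "\<forall>a\<in>{..<l}. \<exists>c. w a = (\<Sum>i<l. c i *s v i)"
    using span_image_sum[OF assms(1)] assms(2) by auto
  then obtain \<alpha> where "\<forall>a\<in>{..<l}. w a = (\<Sum>b<l. \<alpha> a b *s v b)" by (metis bchoice)
  then show ?thesis using that[of \<alpha>] by auto
qed

lemma wedge_proportional:
  assumes "inj_on v {..<l}" "\<And>a. a < l \<Longrightarrow> w a \<in> vec.span (v ` {..<l})"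
  shows "\<exists>c. wedge l w = c *s wedge l v"
proof -
  obtain \<alpha> where \<alpha>: "\<And>a. a < l \<Longrightarrow> w a = (\<Sum>b<l. \<alpha> a b *s v b)"
    by (rule span_image_sum_family[of v l w]) (use assms in auto)
  have "wedge l w = leibniz l \<alpha> *s wedge l v"
  proof (intro vec_eq_iff[THEN iffD2] allI)
    fix I
    have "leibniz l (\<lambda>a i. w a $ (sorted_list_of_set I ! i)) =
        leibniz l (\<lambda>a i. \<Sum>b<l. \<alpha> a b * v b $ (sorted_list_of_set I ! i))"
      by (rule leibniz_cong) (simp add: \<alpha>)
    then show "wedge l w $ I = (leibniz l \<alpha> *s wedge l v) $ I"
      by (simp add: wedge_nth leibniz_mult)
  qed
  then show ?thesis by blast
qed

lemma dual_functionals: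
  fixes v :: "nat \<Rightarrow> 'n::finite cvec"
  assumes "inj_on v {..<l}" "vec.independent (v ` {..<l} \<union> A)" "v ` {..<l} \<inter> A = {}"
  shows "\<exists>\<xi>. (\<forall>i. linear_functional (\<xi> i)) \<and>
    (\<forall>i<l. \<forall>a<l. \<xi> i (v a) = (if a = i then 1 else 0)) \<and> (\<forall>i<l. \<forall>x\<in>A. \<xi> i x = 0)"
proof -
  have "\<exists>\<xi>. \<forall>i. linear_functional (\<xi> i) \<and> (\<forall>x\<in>v ` {..<l} \<union> A. \<xi> i x = (if x = v i then 1 else 0))"
    by (intro choice allI linear_functional_extend[OF assms(2)])
  then obtain \<xi> where \<xi>: "\<And>i. linear_functional (\<xi> i)"
    "\<And>i x. x \<in> v ` {..<l} \<union> A \<Longrightarrow> \<xi> i x = (if x = v i then 1 else 0)" by blast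
  have "\<xi> i (v a) = (if a = i then 1 else 0)" if "i < l" "a < l" for i a
    using \<xi>(2)[of "v a" i] that assms(1) by (auto simp: inj_on_def)
  moreover have "\<xi> i x = 0" if "i < l" "x \<in> A" for i x
    using \<xi>(2)[of x i] that assms(3) by auto
  ultimately show ?thesis using \<xi>(1) by (intro exI[of _ \<xi>]) blast
qed

text \<open>Any l vectors of V are combinations of a basis v, which multiplies the wedge of v by a
  determinant. That wedge is nonzero because the form built from dual functionals takes the value 1
  on it.\<close>

lemma plucker_span:
  assumes "V \<in> Gr l" "1 \<le> l"
  obtains w where "w \<noteq> 0" "plucker l V = vec.span {w}"
proof -
  have "vec.dim V \<noteq> 0" using assms by (auto simp: Gr_def)
  then obtain x where "x \<in> V" "x \<noteq> 0" by (auto simp: vec.dim_eq_0)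
  then obtain v where v: "\<And>i. i < l \<Longrightarrow> v i \<in> V" "inj_on v {..<l}" "vec.independent (v ` {..<l})"
    "vec.span (v ` {..<l}) = V" using Gr_basis[OF assms(1)] by metis
  have "vec.independent (v ` {..<l} \<union> {})" using v by simp
  from dual_functionals[OF _ this] v obtain \<xi> where \<xi>: "\<forall>i. linear_functional (\<xi> i)"
    "\<forall>i<l. \<forall>a<l. \<xi> i (v a) = (if a = i then 1 else 0)" by blast
  obtain c where c: "wedge_form c l \<xi>"
    using wedge_functional[of \<xi> l] \<xi>(1) by blast
  have "leibniz l (\<lambda>a i. \<xi> i (v a)) = 1" by (rule leibniz_unitriangular) (use \<xi>(2) in auto)
  then have "wedge l v \<noteq> 0" using c[rule_format, of v] by auto
  moreover have "plucker l V = vec.span {wedge l v}"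
  proof (rule antisym)
    have "wedge l w \<in> vec.span {wedge l v}" if "\<forall>i<l. w i \<in> V" for w
    proof -
      have "\<exists>c. wedge l w = c *s wedge l v"
        by (rule wedge_proportional) (use v that in auto)
      then obtain c where "wedge l w = c *s wedge l v" by blast
      then show ?thesis by (simp add: vec.span_base vec.span_scale)
    qed
    then show "plucker l V \<subseteq> vec.span {wedge l v}"
      unfolding plucker_def by (intro vec.span_minimal) auto
    show "vec.span {wedge l v} \<subseteq> plucker l V"
      unfolding plucker_def using v(1) by (intro vec.span_mono) auto
  qed
  ultimately show ?thesis by (rule that)
qed

lemma plucker_Proj:
  assumes "V \<in> Gr l" "1 \<le> l"
  shows "plucker l V \<in> Proj"
proof -
  obtain w where "w \<noteq> 0" "plucker l V = vec.span {w}" using plucker_span[OF assms] .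
  then show ?thesis by (simp add: Gr_def vec.dim_insert)
qed

text \<open>In a basis of V starting with x the matrix of the \<xi> i has a zero row.\<close>

lemma plucker_vanish:
  fixes \<xi> :: "nat \<Rightarrow> 'n::{finite,linorder} cvec \<Rightarrow> complex"
  assumes \<xi>: "\<And>i. linear_functional (\<xi> i)"
    and c: "wedge_form c l \<xi>"
    and V: "V \<in> Gr l" "x \<in> V" "x \<noteq> 0" "\<And>i. i < l \<Longrightarrow> \<xi> i x = 0"
  shows "plucker l V \<subseteq> hyperplane c"
  unfolding plucker_subset_hyperplane
proof (intro allI impI)
  fix w assume w: "\<forall>i<l. w i \<in> V"
  obtain v where v: "v 0 = x" "inj_on v {..<l}" "vec.span (v ` {..<l}) = V" "1 \<le> l"
    using Gr_basis[OF V(1-3)] by metis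
  obtain \<alpha> where \<alpha>: "\<And>a. a < l \<Longrightarrow> w a = (\<Sum>b<l. \<alpha> a b *s v b)"
    by (rule span_image_sum_family[of v l w]) (use v w in auto)
  have "leibniz l (\<lambda>a i. \<xi> i (w a)) = leibniz l (\<lambda>a i. \<Sum>b<l. \<alpha> a b * \<xi> i (v b))"
    by (rule leibniz_cong) (simp add: \<alpha> linear_functional_sum[OF \<xi>])
  also have "\<dots> = leibniz l \<alpha> * leibniz l (\<lambda>b i. \<xi> i (v b))" by (rule leibniz_mult)
  also have "leibniz l (\<lambda>b i. \<xi> i (v b)) = 0"
    unfolding leibniz_def
  proof (intro sum.neutral ballI)
    fix \<pi> assume "\<pi> \<in> {\<pi>. \<pi> permutes {..<l}}"
    then have \<pi>: "\<pi> permutes {..<l}" by simp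
    have "0 \<in> \<pi> ` {..<l}" using permutes_image[OF \<pi>] v(4) by simp
    then obtain i where "i < l" "\<pi> i = 0" by auto
    then have "\<xi> i (v (\<pi> i)) = 0" using V(4) v(1) by simp
    then have "(\<Prod>i<l. \<xi> i (v (\<pi> i))) = 0" using \<open>i < l\<close> by (intro prod_zero) auto
    then show "of_int (sign \<pi>) * (\<Prod>i<l. \<xi> i (v (\<pi> i))) = 0" by simp
  qed
  finally show "(\<Sum>I\<in>UNIV. c $ I * wedge l w $ I) = 0" using c by simp
qed

lemma plucker_vanish_first:
  assumes c: "wedge_form c l \<xi>"
    and "\<And>x. x \<in> V \<Longrightarrow> \<xi> 0 x = 0" "1 \<le> l"
  shows "plucker l V \<subseteq> hyperplane c"
  unfolding plucker_subset_hyperplane c[rule_format] leibniz_def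
proof (intro allI impI sum.neutral ballI)
  fix v \<pi> assume "\<forall>i<l. v i \<in> V" "\<pi> \<in> {\<pi>. \<pi> permutes {..<l}}"
  moreover from this have "\<pi> 0 < l" using permutes_in_image[of \<pi> "{..<l}" 0] assms(3) by simp
  ultimately have "\<xi> 0 (v (\<pi> 0)) = 0" using assms(2) by blast
  then have "(\<Prod>i<l. \<xi> i (v (\<pi> i))) = 0" using assms(3) by (intro prod_zero) auto
  then show "of_int (sign \<pi>) * (\<Prod>i<l. \<xi> i (v (\<pi> i))) = 0" by simp
qed

lemma plucker_not_subset:
  assumes c: "wedge_form c l \<xi>"
    and "\<And>i. i < l \<Longrightarrow> v i \<in> V"
    and "\<And>a i. a < l \<Longrightarrow> 1 \<le> i \<Longrightarrow> i < l \<Longrightarrow> a \<noteq> i \<Longrightarrow> \<xi> i (v a) = 0"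
    and "\<And>i. i < l \<Longrightarrow> \<xi> i (v i) = 1"
  shows "\<not> plucker l V \<subseteq> hyperplane c"
proof -
  have "leibniz l (\<lambda>a i. \<xi> i (v a)) = 1" using assms(3,4) by (rule leibniz_unitriangular)
  then show ?thesis unfolding plucker_subset_hyperplane c[rule_format] not_all
    using assms(2) by (intro exI[of _ v]) simp
qed

text \<open>The form \<eta> \<and> \<xi> 1 \<and> ... \<and> \<xi> (l - 1) works, where \<eta>
  vanishes on B but not at a chosen x in V, and the \<xi> i are dual to a basis of V starting with
  x.\<close>

lemma hyperplane_separating:
  fixes V B :: "'n::{finite,linorder} cvec set"
  assumes "V \<in> Gr l" "vec.subspace B" "\<not> V \<subseteq> B"
  obtains c where "\<not> plucker l V \<subseteq> hyperplane c" "\<And>V'. V' \<subseteq> B \<Longrightarrow> plucker l V' \<subseteq> hyperplane c"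
proof -
  obtain x where x: "x \<in> V" "x \<notin> B" using assms(3) by blast
  then have "x \<noteq> 0" using assms(2) vec.subspace_0 by blast
  then obtain v where v: "v 0 = x" "\<And>i. i < l \<Longrightarrow> v i \<in> V" "inj_on v {..<l}"
    "vec.independent (v ` {..<l})" "1 \<le> l" using Gr_basis[OF assms(1) x(1)] by metis
  have "vec.independent (v ` {..<l} \<union> {})" using v by simp
  from dual_functionals[OF _ this] v obtain \<xi> where \<xi>: "\<forall>i. linear_functional (\<xi> i)"
    "\<forall>i<l. \<forall>a<l. \<xi> i (v a) = (if a = i then 1 else 0)" by blast
  obtain S where S: "S \<subseteq> B" "vec.independent S" "B \<subseteq> vec.span S" using vec.basis_exists by metis
  then have span: "vec.span S = B" using assms(2) by (simp add: vec.span_subspace)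
  then have "vec.independent (insert x S)" using S x by (simp add: vec.independent_insert)
  then obtain \<eta> where \<eta>: "linear_functional \<eta>" "\<forall>y\<in>insert x S. \<eta> y = (if y = x then 1 else 0)"
    using linear_functional_extend[of "insert x S" "\<lambda>y. if y = x then 1 else 0"] by blast
  have \<eta>B: "\<eta> y = 0" if "y \<in> B" for y
  proof (rule linear_functional_vanish_span[OF \<eta>(1), of S])
    show "\<eta> z = 0" if "z \<in> S" for z using \<eta>(2) that x S(1) by auto
  qed (use that span in simp)
  define \<zeta> where "\<zeta> = \<xi>(0 := \<eta>)"
  have \<zeta>: "linear_functional (\<zeta> i)" for i using \<xi>(1) \<eta>(1) by (simp add: \<zeta>_def)
  obtain c where c: "wedge_form c l \<zeta>"
    using wedge_functional[of \<zeta> l] \<zeta> by blast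
  show ?thesis
  proof (rule that[of c])
    show "\<not> plucker l V \<subseteq> hyperplane c"
      by (rule plucker_not_subset[OF c, of v]) (use v \<xi>(2) \<eta>(2) in \<open>auto simp: \<zeta>_def\<close>)
    show "plucker l V' \<subseteq> hyperplane c" if "V' \<subseteq> B" for V'
      using that \<eta>B v(5) by (intro plucker_vanish_first[OF c]) (auto simp: \<zeta>_def)
  qed
qed

text \<open>The \<xi> i are dual to a basis of V and vanish on A, so every subspace meeting A
  contains a common zero of them. For A of complementary dimension this hyperplane cuts out a
  Schubert divisor.\<close>

lemma hyperplane_through_complement:
  fixes V A :: "'n::{finite,linorder} cvec set"
  assumes "V \<in> Gr l" "1 \<le> l" "vec.subspace A" "A \<inter> V \<subseteq> {0}"
  obtains c where "\<not> plucker l V \<subseteq> hyperplane c"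
    "\<And>V' x. V' \<in> Gr l \<Longrightarrow> x \<in> V' \<inter> A \<Longrightarrow> x \<noteq> 0 \<Longrightarrow> plucker l V' \<subseteq> hyperplane c"
proof -
  have V: "vec.subspace V" "vec.dim V = l" using assms(1) by (auto simp: Gr_def)
  then have "vec.dim V \<noteq> 0" using assms(2) by simp
  then obtain x where "x \<in> V" "x \<noteq> 0" by (auto simp: vec.dim_eq_0)
  then obtain v where v: "\<And>i. i < l \<Longrightarrow> v i \<in> V" "inj_on v {..<l}" "vec.independent (v ` {..<l})"
    "vec.span (v ` {..<l}) = V" using Gr_basis[OF assms(1)] by metis
  obtain S where S: "S \<subseteq> A" "vec.independent S" "A \<subseteq> vec.span S" "card S = vec.dim A"
    using vec.basis_exists by metis
  have span: "vec.span S = A" using S assms(3) by (simp add: vec.span_subspace)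
  have fin: "finite S" using S(2) vec.finiteI_independent by blast
  have "0 \<notin> S" using S(2) vec.dependent_zero by blast
  then have disj: "v ` {..<l} \<inter> S = {}" using v(1) S(1) assms(4) by auto
  have ind: "vec.independent (v ` {..<l} \<union> S)"
  proof (rule vec.card_le_dim_spanning[of _ "{y + z | y z. y \<in> V \<and> z \<in> A}"])
    have "{y + z | y z. y \<in> V \<and> z \<in> A} = vec.span (v ` {..<l} \<union> S)"
      unfolding vec.span_Un v(4) span by auto
    then show "v ` {..<l} \<union> S \<subseteq> {y + z | y z. y \<in> V \<and> z \<in> A}"
      "{y + z | y z. y \<in> V \<and> z \<in> A} \<subseteq> vec.span (v ` {..<l} \<union> S)"
      using vec.span_superset[of "v ` {..<l} \<union> S"] by simp_all
    have "V \<inter> A \<subseteq> {0}" using assms(4) by auto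
    then have "vec.dim (V \<inter> A) = 0" by (simp add: vec.dim_eq_0)
    then have "vec.dim {y + z | y z. y \<in> V \<and> z \<in> A} = l + vec.dim A"
      using vec.dim_sums_Int[OF V(1) assms(3)] V(2) by linarith
    then show "card (v ` {..<l} \<union> S) \<le> vec.dim {y + z | y z. y \<in> V \<and> z \<in> A}"
      using card_Un_le[of "v ` {..<l}" S] v(2) S(4) by (simp add: card_image)
  qed (use fin in auto)
  obtain \<xi> where \<xi>: "\<forall>i. linear_functional (\<xi> i)"
    "\<forall>i<l. \<forall>a<l. \<xi> i (v a) = (if a = i then 1 else 0)"
    "\<forall>i<l. \<forall>x\<in>S. \<xi> i x = 0"
    using dual_functionals[OF v(2) ind disj] by blast
  obtain c where c: "wedge_form c l \<xi>"
    using wedge_functional[of \<xi> l] \<xi>(1) by blast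
  show ?thesis
  proof (rule that[of c])
    show "\<not> plucker l V \<subseteq> hyperplane c"
      by (rule plucker_not_subset[OF c, of v]) (use v \<xi>(2) in auto)
    fix V' x assume V': "V' \<in> Gr l" "x \<in> V' \<inter> A" "x \<noteq> 0"
    have "\<xi> i x = 0" if "i < l" for i
      using linear_functional_vanish_span[OF \<xi>(1)[rule_format], of S] \<xi>(3) that V'(2) span by auto
    then show "plucker l V' \<subseteq> hyperplane c"
      using V' by (intro plucker_vanish[OF \<xi>(1)[rule_format] c, of V' x]) auto
  qed
qed

section \<open>Spans of rational curves\<close>

definition affine_pt :: "complex \<Rightarrow> (complex ^ 2) set" where
  "affine_pt t = vec.span {vector [t, 1]}"

lemma dim_span_singleton: "w \<noteq> 0 \<Longrightarrow> vec.dim (vec.span {w :: 'n::finite cvec}) = 1"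
  by (simp add: vec.dim_insert)

lemma affine_pt_P1: "affine_pt t \<in> P1"
proof -
  have "vector [t, 1] \<noteq> (0 :: complex ^ 2)" by (simp add: vec_eq_iff forall_2 vector_2)
  then show ?thesis unfolding affine_pt_def Gr_def using dim_span_singleton by auto
qed

lemma vector_in_affine_pt: "vector [t, 1] \<in> affine_pt t - {0}"
  by (auto simp: affine_pt_def vec.span_base vec_eq_iff forall_2 vector_2)

lemma inj_affine_pt: "inj affine_pt"
proof (rule injI)
  fix s t assume "affine_pt s = affine_pt t"
  then have "vector [s, 1] \<in> vec.span {vector [t, 1] :: complex ^ 2}"
    using vector_in_affine_pt[of s] by (simp add: affine_pt_def)
  then obtain c where "vector [s, 1] - c *s vector [t, 1 :: complex] = (0 :: complex ^ 2)"
    by (auto simp: vec.span_breakdown_eq)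
  then show "s = t" by (simp add: vec_eq_iff forall_2 vector_2)
qed

lemma span_scaled_singleton:
  assumes "c \<noteq> 0"
  shows "vec.span {c *s w} = vec.span {w :: 'n::finite cvec}"
proof (rule antisym)
  have "w = (1 / c) *s (c *s w)" using assms by simp
  then have "w \<in> vec.span {c *s w}" by (metis vec.span_base vec.span_scale singletonI)
  then show "vec.span {w} \<subseteq> vec.span {c *s w}" by (intro vec.span_minimal) auto
  have "c *s w \<in> vec.span {w}" by (simp add: vec.span_base vec.span_scale)
  then show "vec.span {c *s w} \<subseteq> vec.span {w}" by (intro vec.span_minimal) auto
qed

lemma P1_generator:
  assumes "x \<in> P1"
  obtains u where "u \<in> x - {0}" "x = vec.span {u}"
proof -
  have x: "vec.subspace x" "vec.dim x = 1" using assms by (auto simp: Gr_def)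
  then have "vec.dim x \<noteq> 0" by simp
  then obtain u where u: "u \<in> x" "u \<noteq> 0" by (auto simp: vec.dim_eq_0)
  then have "vec.span {u} = x" using x dim_span_singleton[of u]
    by (intro vec.subspace_dim_equal vec.span_minimal) auto
  with u show ?thesis using that by blast
qed

lemma P1_cases:
  assumes "x \<in> P1"
  shows "x = vec.span {vector [1, 0]} \<or> (\<exists>t. x = affine_pt t)"
proof -
  obtain u where u: "u \<noteq> 0" "x = vec.span {u}" using P1_generator[OF assms] by auto
  show ?thesis
  proof (cases "u $ 2 = 0")
    case True
    have "u $ 1 \<noteq> 0"
    proof
      assume "u $ 1 = 0"
      then have "u = 0" using True by (simp add: vec_eq_iff forall_2)
      then show False using u by simp
    qed
    moreover have "u = (u $ 1) *s vector [1, 0]" using True by (simp add: vec_eq_iff forall_2 vector_2)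
    ultimately show ?thesis using u span_scaled_singleton by metis
  next
    case False
    then have "u = (u $ 2) *s vector [u $ 1 / u $ 2, 1]" by (simp add: vec_eq_iff forall_2 vector_2)
    then have "x = affine_pt (u $ 1 / u $ 2)"
      using u False span_scaled_singleton by (metis affine_pt_def)
    then show ?thesis by blast
  qed
qed

lemma P1_nonempty: "P1 \<noteq> {}"
  using affine_pt_P1 by blast

lemma finite_P1_subset: "A \<subseteq> P1 \<Longrightarrow> finite {t. affine_pt t \<in> A} \<Longrightarrow> finite A"
proof -
  assume A: "A \<subseteq> P1" "finite {t. affine_pt t \<in> A}"
  have "A \<subseteq> insert (vec.span {vector [1, 0]}) (affine_pt ` {t. affine_pt t \<in> A})"
    using P1_cases A(1) by fast
  then show "finite A" using A(2) finite_subset by blast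
qed

lemma finite_affine_pts: "finite A \<Longrightarrow> finite {t. affine_pt t \<in> A}"
  using finite_vimageI[OF _ inj_affine_pt, of A] by (simp add: vimage_def)

section \<open>Hyperplane sections as roots of polynomials\<close>

definition pairing :: "complex ^ 'i \<Rightarrow> complex ^ 'i \<Rightarrow> complex" where
  "pairing c z = (\<Sum>i\<in>UNIV. c $ i * z $ i)"

text \<open>The dehomogenised equation of the hyperplane section: its roots are the points of the
  affine chart where the forms pair to 0 with c.\<close>

definition section_poly :: "nat \<Rightarrow> (nat \<Rightarrow> complex ^ 'i) \<Rightarrow> complex ^ 'i \<Rightarrow> complex poly" where
  "section_poly m a c = (\<Sum>i\<le>m. monom (pairing c (a i)) i)"

lemma pairing_binary_form:
  "pairing c (binary_form m a u) = (\<Sum>i\<le>m. u $ 1 ^ i * u $ 2 ^ (m - i) * pairing c (a i))"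
  unfolding pairing_def binary_form_def sum_component vector_smult_component sum_distrib_left
  by (subst sum.swap) (simp add: mult_ac)

lemma poly_section_poly: "poly (section_poly m a c) t = pairing c (binary_form m a (vector [t, 1]))"
  by (simp add: section_poly_def poly_sum poly_monom pairing_binary_form vector_2 mult.commute)

lemma pairing_add: "pairing (c + s *s e) z = pairing c z + s * pairing e z"
  by (simp add: pairing_def algebra_simps sum.distrib sum_distrib_left)

lemma section_poly_add: "section_poly m a (c + s *s e) = section_poly m a c + smult s (section_poly m a e)"
  by (rule poly_eqI) (simp add: section_poly_def coeff_sum pairing_add)

lemma span_subset_hyperplane: "vec.span {z} \<subseteq> hyperplane c \<longleftrightarrow> pairing c z = 0"
proof
  assume "vec.span {z} \<subseteq> hyperplane c"
  then show "pairing c z = 0" using vec.span_base[of z "{z}"] by (auto simp: hyperplane_def pairing_def)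
next
  assume "pairing c z = 0"
  then show "vec.span {z} \<subseteq> hyperplane c"
    by (intro vec.span_minimal subspace_hyperplane) (simp add: hyperplane_def pairing_def)
qed

text \<open>If the section polynomial were 0, all coefficient vectors would pair to 0 with c and the
  value at x would lie in the hyperplane. So there are finitely many points within U, and finitely
  many lie outside U.\<close>

lemma finite_hyperplane_section:
  assumes "regular_map \<phi>" "x \<in> P1" "\<not> \<phi> x \<subseteq> hyperplane c"
  shows "finite {y \<in> P1. \<phi> y \<subseteq> hyperplane c}"
proof -
  obtain U m a where U: "x \<in> U" "U \<subseteq> P1" "finite (P1 - U)"
    "\<forall>y\<in>U. \<forall>u\<in>y - {0}. \<phi> y = vec.span {binary_form m a u}"
    using assms(1,2) unfolding regular_map_def by meson
  have "section_poly m a c \<noteq> 0"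
  proof
    assume 0: "section_poly m a c = 0"
    have "pairing c (a i) = 0" if "i \<le> m" for i
    proof -
      have "coeff (section_poly m a c) i = pairing c (a i)"
        using that by (simp add: section_poly_def coeff_sum)
      then show ?thesis using 0 by simp
    qed
    then have "pairing c (binary_form m a u) = 0" for u by (simp add: pairing_binary_form)
    moreover obtain u where "u \<in> x - {0}" using P1_generator[OF assms(2)] by blast
    ultimately show False using U(1,4) assms(3) span_subset_hyperplane by metis
  qed
  then have "finite {t. poly (section_poly m a c) t = 0}" by (rule poly_roots_finite)
  moreover have "{t. affine_pt t \<in> {y \<in> U. \<phi> y \<subseteq> hyperplane c}} \<subseteq> {t. poly (section_poly m a c) t = 0}"
  proof safe
    fix t assume t: "affine_pt t \<in> U" "\<phi> (affine_pt t) \<subseteq> hyperplane c"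
    then have "\<phi> (affine_pt t) = vec.span {binary_form m a (vector [t, 1])}"
      using U(4) vector_in_affine_pt by blast
    then show "poly (section_poly m a c) t = 0"
      using t span_subset_hyperplane by (metis poly_section_poly)
  qed
  ultimately have "finite {t. affine_pt t \<in> {y \<in> U. \<phi> y \<subseteq> hyperplane c}}"
    using finite_subset by blast
  then have "finite {y \<in> U. \<phi> y \<subseteq> hyperplane c}" using U(2) by (intro finite_P1_subset) auto
  then have "finite ({y \<in> U. \<phi> y \<subseteq> hyperplane c} \<union> (P1 - U))" using U(3) by simp
  then show ?thesis by (rule rev_finite_subset) auto
qed

text \<open>Where Q does not vanish, roots of P + s Q are the points at which -P / Q takes the value
  s. This quotient is nonconstant near t, so by the open mapping theorem it takes all small values
  there. If Q vanishes at t, the root stays put.\<close>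

lemma perturbed_root:
  fixes P Q :: "complex poly"
  assumes "P \<noteq> 0" "poly P t = 0" "0 < r"
  shows "\<forall>\<^sub>F s in at 0. \<exists>t'. dist t t' < r \<and> poly (P + smult s Q) t' = 0"
proof (cases "poly Q t = 0")
  case True
  then show ?thesis using assms by (intro always_eventually allI exI[of _ t]) simp
next
  case False
  have "open {z. poly Q z \<noteq> 0}"
    by (intro open_Collect_neq continuous_intros)
  then have "open (ball t r \<inter> {z. poly Q z \<noteq> 0})" by (intro open_Int) auto
  moreover have "t \<in> ball t r \<inter> {z. poly Q z \<noteq> 0}" using False assms by simp
  ultimately obtain \<epsilon> where \<epsilon>: "0 < \<epsilon>" "ball t \<epsilon> \<subseteq> ball t r \<inter> {z. poly Q z \<noteq> 0}"
    using open_contains_ball by metis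
  define g where "g z = - poly P z / poly Q z" for z
  have g0: "g t = 0" using assms(2) by (simp add: g_def)
  have "\<not> g constant_on ball t \<epsilon>"
  proof
    assume "g constant_on ball t \<epsilon>"
    then have "g z = 0" if "z \<in> ball t \<epsilon>" for z
      using g0 \<epsilon>(1) that by (metis constant_on_def centre_in_ball)
    then have "ball t \<epsilon> \<subseteq> {z. poly P z = 0}" using \<epsilon>(2) by (force simp: g_def)
    then have "finite (ball t \<epsilon>)" using poly_roots_finite[OF assms(1)] finite_subset by blast
    then show False using uncountable_ball[OF \<epsilon>(1), of t] countable_finite by blast
  qed
  moreover have "g holomorphic_on ball t \<epsilon>"
    unfolding g_def using \<epsilon>(2) by (auto intro!: holomorphic_intros)
  ultimately have "open (g ` ball t \<epsilon>)"
    by (intro open_mapping_thm[of g "ball t \<epsilon>"]) auto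
  moreover have "0 \<in> g ` ball t \<epsilon>" using g0 \<epsilon>(1) by (metis centre_in_ball imageI)
  ultimately have "\<forall>\<^sub>F s in at 0. s \<in> g ` ball t \<epsilon>" by (rule eventually_at_in_open')
  then show ?thesis
  proof eventually_elim
    case (elim s)
    then obtain z where "z \<in> ball t \<epsilon>" "s = g z" by blast
    then show ?case using \<epsilon>(2) by (intro exI[of _ z]) (auto simp: g_def)
  qed
qed

text \<open>A small perturbation of c is general, hence has exactly d intersections, and still has
  one near every t in T. Distinct t give distinct intersections because the neighbourhoods are
  disjoint.\<close>

lemma card_hyperplane_section_le_degree:
  fixes \<phi> :: "(complex ^ 2) set \<Rightarrow> (complex ^ 'i) set"
  assumes \<phi>: "regular_map \<phi>" "has_degree \<phi> d"
    and U: "U \<subseteq> P1" "finite (P1 - U)" "\<forall>y\<in>U. \<forall>u\<in>y - {0}. \<phi> y = vec.span {binary_form m a u}"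
    and T: "finite T" "\<And>t. t \<in> T \<Longrightarrow> affine_pt t \<in> U \<and> \<phi> (affine_pt t) \<subseteq> hyperplane c"
    and x: "x \<in> P1" "\<not> \<phi> x \<subseteq> hyperplane c"
  shows "card T \<le> d"
proof -
  define B where "B = {t. affine_pt t \<notin> U}"
  have finB: "finite B"
    using finite_affine_pts[OF U(2)] affine_pt_P1 by (simp add: B_def)
  have inU: "\<phi> (affine_pt t) \<subseteq> hyperplane c \<longleftrightarrow> poly (section_poly m a c) t = 0" if "t \<notin> B" for t c
  proof -
    have "\<phi> (affine_pt t) = vec.span {binary_form m a (vector [t, 1])}"
      using U(3) vector_in_affine_pt that by (simp add: B_def)
    then show ?thesis by (simp add: span_subset_hyperplane poly_section_poly)
  qed
  have "section_poly m a c \<noteq> 0"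
  proof
    assume "section_poly m a c = 0"
    then have "\<phi> (affine_pt t) \<subseteq> hyperplane c" if "t \<notin> B" for t
      using inU[OF that, of c] by simp
    then have "- B \<subseteq> {t. affine_pt t \<in> {y \<in> P1. \<phi> y \<subseteq> hyperplane c}}"
      using affine_pt_P1 by blast
    then have "finite (- B)"
      using finite_affine_pts[OF finite_hyperplane_section[OF \<phi>(1) x]] finite_subset by blast
    then show False using finB infinite_UNIV_char_0[where 'a=complex] by (metis Compl_partition finite_UnI)
  qed
  \<comment> \<open>The balls of radius r around T must be disjoint and must also avoid B, where a
    root of the section polynomial need not be a point of the intersection.\<close>
  have "\<exists>r>0. \<forall>t\<in>T. \<forall>t'\<in>T \<union> B. t \<noteq> t' \<longrightarrow> 2 * r \<le> dist t t'"
  proof -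
    have "\<forall>t\<in>T. \<exists>r>0. \<forall>t'\<in>T \<union> B. t' \<noteq> t \<longrightarrow> r \<le> dist t t'"
      using finite_set_avoid[of "T \<union> B"] finB T(1) by blast
    then obtain r where r: "\<And>t. t \<in> T \<Longrightarrow> 0 < r t" "\<And>t t'. t \<in> T \<Longrightarrow> t' \<in> T \<union> B \<Longrightarrow> t' \<noteq> t \<Longrightarrow> r t \<le> dist t t'"
      by metis
    define \<rho> where "\<rho> = Min (insert 1 (r ` T)) / 2"
    have "0 < \<rho>" using r(1) T(1) by (simp add: \<rho>_def)
    moreover have "2 * \<rho> \<le> dist t t'" if "t \<in> T" "t' \<in> T \<union> B" "t \<noteq> t'" for t t'
    proof -
      have "2 * \<rho> \<le> r t" using T(1) that by (simp add: \<rho>_def)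
      then show ?thesis using r(2)[of t t'] that by force
    qed
    ultimately show ?thesis by blast
  qed
  then obtain r where r: "0 < r" "\<And>t t'. t \<in> T \<Longrightarrow> t' \<in> T \<union> B \<Longrightarrow> t \<noteq> t' \<Longrightarrow> 2 * r \<le> dist t t'"
    by blast
  let ?S = "\<lambda>s e. {x \<in> P1. \<phi> x \<subseteq> hyperplane (c + s *s e)}"
  obtain e where e: "\<forall>\<^sub>F s in at (0::complex). finite (?S s e) \<and>
      card (?S s e) = d"
    using for_general_vec_near[OF \<phi>(2)[unfolded has_degree_def], of c] by blast
  have "\<forall>\<^sub>F s in at 0. \<forall>t\<in>T. \<exists>t'. dist t t' < r \<and>
      poly (section_poly m a c + smult s (section_poly m a e)) t' = 0"
  proof (rule eventually_ball_finite[OF T(1)], rule ballI)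
    fix t assume "t \<in> T"
    then have "poly (section_poly m a c) t = 0" using T(2)[of t] inU[of t c] by (simp add: B_def)
    then show "\<forall>\<^sub>F s in at 0. \<exists>t'. dist t t' < r \<and>
      poly (section_poly m a c + smult s (section_poly m a e)) t' = 0"
      using \<open>section_poly m a c \<noteq> 0\<close> r(1) by (intro perturbed_root)
  qed
  from eventually_happens[OF eventually_conj[OF e this]] obtain s where
    s: "finite (?S s e)"
      "card (?S s e) = d"
      "\<forall>t\<in>T. \<exists>t'. dist t t' < r \<and> poly (section_poly m a (c + s *s e)) t' = 0"
    by (auto simp: section_poly_add)
  then obtain h where h: "\<And>t. t \<in> T \<Longrightarrow> dist t (h t) < r"
    "\<And>t. t \<in> T \<Longrightarrow> poly (section_poly m a (c + s *s e)) (h t) = 0" by metis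
  have "inj_on h T"
  proof (rule inj_onI, rule ccontr)
    fix t t' assume t: "t \<in> T" "t' \<in> T" "h t = h t'" "t \<noteq> t'"
    have "dist t t' \<le> dist t (h t) + dist t' (h t')" using dist_triangle2[of t t' "h t"] t(3) by simp
    then show False using h(1)[OF t(1)] h(1)[OF t(2)] r(2)[of t t'] t by simp
  qed
  then have "card T = card ((\<lambda>t. affine_pt (h t)) ` T)"
    using inj_affine_pt by (subst card_image) (auto simp: inj_on_def inj_def)
  also have "\<dots> \<le> card (?S s e)"
  proof (rule card_mono[OF s(1)], safe)
    fix t assume t: "t \<in> T"
    show "affine_pt (h t) \<in> P1" by (rule affine_pt_P1)
    have "h t \<notin> B"
    proof
      assume "h t \<in> B"
      moreover have "t \<noteq> h t" using calculation T(2)[OF t] by (auto simp: B_def)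
      ultimately show False using r(2)[of t "h t"] t h(1)[OF t] r(1) by auto
    qed
    then have "\<phi> (affine_pt (h t)) \<subseteq> hyperplane (c + s *s e)" using inU h(2)[OF t] by simp
    then show "\<And>y. y \<in> \<phi> (affine_pt (h t)) \<Longrightarrow> y \<in> hyperplane (c + s *s e)" by blast
  qed
  finally show ?thesis using s(2) by simp
qed

text \<open>
  Let \<open>N\<close> be the dimension of the span. There are \<open>N - l\<close> points of the curve and vectors in them
  which span a complement \<open>A\<close> of a point \<open>f x0\<close>. The hyperplane of all \<open>V\<close> that meet \<open>A\<close> contains
  these \<open>N - l\<close> points but not \<open>f x0\<close>, so the degree is at least \<open>N - l\<close>.
\<close>

lemma curve_span_bound:
  fixes f :: "'n::{finite,linorder} curve"
  assumes f: "f \<in> rational_curves l d" and l: "1 \<le> l"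
  shows "vec.dim (vec.span (\<Union>(f ` P1))) \<le> l + d"
proof -
  let ?\<phi> = "plucker l \<circ> f" and ?S = "vec.span (\<Union>(f ` P1))"
  have fGr: "f x \<in> Gr l" if "x \<in> P1" for x using f that by (auto simp: rational_curves_def)
  have reg: "regular_map ?\<phi>" and deg: "has_degree ?\<phi> d" using f by (auto simp: rational_curves_def)
  obtain x0 where x0: "x0 \<in> P1" using P1_nonempty by blast
  have V0: "vec.subspace (f x0)" "vec.dim (f x0) = l" using fGr[OF x0] by (auto simp: Gr_def)
  obtain U m a where U: "U \<subseteq> P1" "finite (P1 - U)"
    "\<forall>y\<in>U. \<forall>u\<in>y - {0}. ?\<phi> y = vec.span {binary_form m a u}"
    using reg x0 unfolding regular_map_def by meson
  define bad where "bad = {t. affine_pt t \<notin> U}"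
  have fin_bad: "finite bad"
    using finite_affine_pts[OF U(2)] affine_pt_P1 by (simp add: bad_def)
  \<comment> \<open>Choosing the new vector outside f x0 + A keeps A transverse to f x0. Avoiding
    \<open>bad\<close> keeps all points in one set U on which the same forms represent the
    curve.\<close>
  have chain: "\<exists>T A. finite T \<and> card T = j \<and> T \<inter> bad = {} \<and> vec.subspace A \<and> vec.dim A = j \<and>
      A \<inter> f x0 \<subseteq> {0} \<and> (\<forall>t\<in>T. \<exists>v\<in>A \<inter> f (affine_pt t). v \<noteq> 0)" if "l + j \<le> vec.dim ?S" for j
    using that
  proof (induction j)
    case 0
    show ?case by (intro exI[of _ "{}"] exI[of _ "{0}"]) auto
  next
    case (Suc j)
    then obtain T A where TA: "finite T" "card T = j" "T \<inter> bad = {}" "vec.subspace A" "vec.dim A = j"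
      "A \<inter> f x0 \<subseteq> {0}" "\<forall>t\<in>T. \<exists>v\<in>A \<inter> f (affine_pt t). v \<noteq> 0" by auto
    define B where "B = {y + z | y z. y \<in> f x0 \<and> z \<in> A}"
    have B: "vec.subspace B" unfolding B_def using vec.subspace_sums[OF V0(1) TA(4)] .
    have "f x0 \<inter> A \<subseteq> {0}" using TA(6) by auto
    then have "vec.dim (f x0 \<inter> A) = 0" by (simp add: vec.dim_eq_0)
    then have dimB: "vec.dim B = l + j"
      using vec.dim_sums_Int[OF V0(1) TA(4)] V0(2) TA(5) unfolding B_def by linarith
    have "\<exists>x\<in>P1. \<not> f x \<subseteq> B"
    proof (rule ccontr)
      assume "\<not> ?thesis"
      then have "?S \<subseteq> B" using B by (intro vec.span_minimal) auto
      then have "vec.dim ?S \<le> l + j" using vec.dim_subset dimB by metis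
      then show False using Suc.prems by simp
    qed
    then obtain x where x: "x \<in> P1" "\<not> f x \<subseteq> B" by blast
    \<comment> \<open>This hyperplane meets the curve in finitely many points and contains every
      point of it lying inside B, so almost every parameter t has f t outside B.\<close>
    obtain c where c: "\<not> plucker l (f x) \<subseteq> hyperplane c"
      "\<And>V'. V' \<subseteq> B \<Longrightarrow> plucker l V' \<subseteq> hyperplane c"
      using hyperplane_separating[OF fGr[OF x(1)] B x(2)] by blast
    have "finite {y \<in> P1. ?\<phi> y \<subseteq> hyperplane c}"
      using finite_hyperplane_section[OF reg x(1)] c(1) by simp
    from finite_affine_pts[OF this]
    have "finite {t. f (affine_pt t) \<subseteq> B}"
      by (rule rev_finite_subset) (use c(2) affine_pt_P1 in auto)
    then have fin: "finite (bad \<union> T \<union> {t. f (affine_pt t) \<subseteq> B})" using fin_bad TA(1) by simp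
    obtain t where t: "t \<notin> bad \<union> T \<union> {t. f (affine_pt t) \<subseteq> B}"
      using ex_new_if_finite[OF infinite_UNIV_char_0 fin] by blast
    then obtain v where v: "v \<in> f (affine_pt t)" "v \<notin> B" by auto
    have AB: "z \<in> B" if "z \<in> A" for z
      using that vec.subspace_0[OF V0(1)] unfolding B_def by (intro CollectI exI[of _ 0] exI[of _ z]) auto
    have spanA: "vec.span A = A" using TA(4) by (simp add: vec.span_eq_iff)
    have "v \<notin> vec.span A" unfolding spanA using v(2) AB by blast
    then have dimA': "vec.dim (vec.span (insert v A)) = Suc j"
      using TA(5) by (simp add: vec.dim_insert)
    have disj: "vec.span (insert v A) \<inter> f x0 \<subseteq> {0}"
    proof safe
      fix y assume y: "y \<in> vec.span (insert v A)" "y \<in> f x0"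
      then obtain k where k: "y - k *s v \<in> A" using spanA by (auto simp: vec.span_breakdown_eq)
      show "y = 0"
      proof (cases "k = 0")
        case True
        then show ?thesis using k y TA(6) by auto
      next
        case False
        have "k *s v = y + (- (y - k *s v))" by simp
        moreover have "- (y - k *s v) \<in> A" using k TA(4) by (rule vec.subspace_neg[rotated])
        ultimately have "k *s v \<in> B" using y(2) unfolding B_def by blast
        then have "(1 / k) *s (k *s v) \<in> B" using B vec.subspace_scale by blast
        then have "v \<in> B" using False by simp
        then show ?thesis using v(2) by blast
      qed
    qed
    have "v \<noteq> 0" using \<open>v \<notin> vec.span A\<close> vec.span_zero by blast
    then have new: "\<exists>v'\<in>vec.span (insert v A) \<inter> f (affine_pt t). v' \<noteq> 0"
      using v(1) vec.span_base[of v "insert v A"] by blast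
    have old: "\<exists>v'\<in>vec.span (insert v A) \<inter> f (affine_pt t'). v' \<noteq> 0" if "t' \<in> T" for t'
      using TA(7) that vec.span_superset[of "insert v A"] by blast
    show ?case
      using TA t dimA' disj new old
      by (intro exI[of _ "insert t T"] exI[of _ "vec.span (insert v A)"]) auto
  qed
  have "f x0 \<subseteq> ?S" using x0 vec.span_superset by blast
  then have "l \<le> vec.dim ?S" using vec.dim_subset V0(2) by metis
  then obtain T A where TA: "finite T" "card T = vec.dim ?S - l" "T \<inter> bad = {}" "vec.subspace A"
    "A \<inter> f x0 \<subseteq> {0}" "\<forall>t\<in>T. \<exists>v\<in>A \<inter> f (affine_pt t). v \<noteq> 0"
    using chain[of "vec.dim ?S - l"] by auto
  obtain c where c: "\<not> plucker l (f x0) \<subseteq> hyperplane c"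
    "\<And>V' x. V' \<in> Gr l \<Longrightarrow> x \<in> V' \<inter> A \<Longrightarrow> x \<noteq> 0 \<Longrightarrow> plucker l V' \<subseteq> hyperplane c"
    using hyperplane_through_complement[OF fGr[OF x0] l TA(4,5)] by blast
  have "card T \<le> d"
  proof (rule card_hyperplane_section_le_degree[OF reg deg U TA(1) _ x0])
    fix t assume t: "t \<in> T"
    then obtain v where "v \<in> f (affine_pt t) \<inter> A" "v \<noteq> 0" using TA(6) by auto
    then have "plucker l (f (affine_pt t)) \<subseteq> hyperplane c"
      using c(2)[OF fGr[OF affine_pt_P1]] by blast
    then show "affine_pt t \<in> U \<and> ?\<phi> (affine_pt t) \<subseteq> hyperplane c"
      using t TA(3) by (auto simp: bad_def)
  qed (use c(1) in simp)
  then show ?thesis using TA(2) by simp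
qed

text \<open>The span of all points has dimension at most l, so it coincides with each of
  them.\<close>

lemma rational_curves_0_constant:
  fixes f :: "'n::{finite,linorder} curve"
  assumes "f \<in> rational_curves l 0" "1 \<le> l"
  obtains V where "V \<in> Gr l" "f = (\<lambda>x\<in>P1. V)"
proof -
  define S where "S = vec.span (\<Union>(f ` P1))"
  have fGr: "f x \<in> Gr l" if "x \<in> P1" for x using assms(1) that by (auto simp: rational_curves_def)
  have "f x = S" if x: "x \<in> P1" for x
  proof (rule vec.subspace_dim_equal)
    show "f x \<subseteq> S" unfolding S_def using x vec.span_superset by blast
    show "vec.dim S \<le> vec.dim (f x)" using curve_span_bound[OF assms] fGr[OF x] by (simp add: Gr_def S_def)
  qed (use fGr[OF x] in \<open>auto simp: Gr_def S_def\<close>)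
  moreover from this have "S \<in> Gr l" using fGr P1_nonempty by (metis ex_in_conv)
  moreover have "f \<in> extensional P1" using assms(1) by (auto simp: rational_curves_def PiE_def)
  ultimately show ?thesis using that[of S] by (auto simp: extensional_def fun_eq_iff)
qed

lemma constant_rational_curve:
  fixes V :: "'n::{finite,linorder} cvec set"
  assumes "V \<in> Gr l" "1 \<le> l"
  shows "(\<lambda>x\<in>P1. V) \<in> rational_curves l 0"
proof -
  let ?\<phi> = "plucker l \<circ> (\<lambda>x\<in>P1. V)"
  obtain w where w: "w \<noteq> 0" "plucker l V = vec.span {w}" using plucker_span[OF assms] .
  have "regular_map ?\<phi>"
    unfolding regular_map_def
  proof (intro conjI ballI)
    show "?\<phi> x \<in> Proj" if "x \<in> P1" for x
      using plucker_Proj[OF assms] that by simp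
    show "\<exists>U m a. x \<in> U \<and> U \<subseteq> P1 \<and> finite (P1 - U) \<and>
        (\<forall>y\<in>U. \<forall>u\<in>y - {0}. ?\<phi> y = vec.span {binary_form m a u})"
      if "x \<in> P1" for x
      using that w(2) by (intro exI[of _ P1] exI[of _ 0] exI[of _ "\<lambda>_. w"]) (auto simp: binary_form_def)
  qed
  moreover have "has_degree ?\<phi> 0"
    unfolding has_degree_def
  proof (rule for_general_mono)
    obtain I where I: "w $ I \<noteq> 0" using w(1) by (auto simp: vec_eq_iff)
    show "for_general (range (\<lambda>i c. c $ i)) (\<lambda>c. pairing c w \<noteq> 0)"
    proof (rule for_general_nonzero)
      show "(\<lambda>c. pairing c w) \<in> polynomial_maps (range (\<lambda>i c. c $ i))"
        unfolding pairing_def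
        by (intro polynomial_maps_sum polynomial_maps.mult polynomial_maps.const polynomial_maps.coord rangeI)
      show "pairing (axis I 1) w \<noteq> 0"
        using I by (simp add: pairing_def axis_def if_distrib[of "\<lambda>t. t * _"] cong: if_cong)
    qed
    fix c assume "pairing c w \<noteq> 0"
    then have eq: "{x \<in> P1. ?\<phi> x \<subseteq> hyperplane c} = {}"
      using w(2) span_subset_hyperplane by auto
    show "finite {x \<in> P1. ?\<phi> x \<subseteq> hyperplane c} \<and>
        card {x \<in> P1. ?\<phi> x \<subseteq> hyperplane c} = 0" unfolding eq by simp
  qed
  ultimately show ?thesis using assms(1) by (simp add: rational_curves_def)
qed

lemma meeting_curves_0:
  assumes "1 \<le> l" "X \<subseteq> Gr l"
  shows "meeting_curves l 0 X Y Z = (\<lambda>V. \<lambda>x\<in>P1. V) ` (X \<inter> Y \<inter> Z)"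
proof (intro equalityI subsetI)
  fix f assume f: "f \<in> meeting_curves l 0 X Y Z"
  then obtain V where V: "f = (\<lambda>x\<in>P1. V)"
    using rational_curves_0_constant[OF _ assms(1)] by (auto simp: meeting_curves_def)
  have "f ` P1 \<subseteq> {V}" using V by auto
  then have "V \<in> X \<inter> Y \<inter> Z" using f by (auto simp: meeting_curves_def)
  then show "f \<in> (\<lambda>V. \<lambda>x\<in>P1. V) ` (X \<inter> Y \<inter> Z)" using V by blast
next
  fix f assume "f \<in> (\<lambda>V. \<lambda>x\<in>P1. V) ` (X \<inter> Y \<inter> Z)"
  then obtain V where V: "f = (\<lambda>x\<in>P1. V)" "V \<in> X \<inter> Y \<inter> Z" by blast
  moreover have "f ` P1 = {V}" using V(1) P1_nonempty by auto
  moreover have "f \<in> rational_curves l 0"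
    unfolding V(1) using V(2) assms by (intro constant_rational_curve) auto
  ultimately show "f \<in> meeting_curves l 0 X Y Z" by (simp add: meeting_curves_def)
qed

section \<open>Gromov-Witten invariants with a special class\<close>

lemma curve_classes_singleton: "finite (curve_classes {f}) \<and> card (curve_classes {f}) = 1"
  by (simp add: curve_classes_def quotient_def)

text \<open>Two general counts hold simultaneously for some actual triple of flags, so they
  agree.\<close>

lemma the_general_count:
  assumes "for_general_flags (\<lambda>(F :: 'n::{finite,linorder} flag) G H. P F G H \<and> c F G H = N)"
  shows "(THE N. for_general_flags (\<lambda>F G H. P F G H \<and> c F G H = N)) = N"
proof (rule the_equality[where P = "\<lambda>N. for_general_flags (\<lambda>F G H. P F G H \<and> c F G H = N)"])
  fix N'
  assume "for_general_flags (\<lambda>F G H. P F G H \<and> c F G H = N')"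
  from for_general_flags_ex[OF for_general_flags_conj[OF assms this]] show "N' = N" by auto
qed (rule assms)

lemma gromov_witten_special:
  assumes n: "CARD('n::{finite,linorder}) = l + k" and l: "1 \<le> l" and p: "p \<le> k"
    and mu: "mu \<in> partitions_in l k" and nu: "nu \<in> partitions_in l k" and mu0: "mu ! (l - 1) = 0"
  shows "gromov_witten (T :: 'n itself) l k (p # replicate (l - 1) 0) mu (dual_partition k nu) d =
    (if d = 0 \<and> p + sum_list mu = sum_list nu \<and> horizontal_strip mu nu then 1 else 0)"
proof (cases "p + sum_list mu = sum_list nu + d * (l + k)")
  case False
  then have "p + sum_list mu + sum_list (dual_partition k nu) \<noteq> l * k + d * CARD('n)"
    using sum_list_dual_partition[OF nu] n by simp
  then show ?thesis using False by (auto simp: gromov_witten_def sum_list_replicate)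
next
  case True
  then have dim: "sum_list (p # replicate (l - 1) 0) + sum_list mu + sum_list (dual_partition k nu) =
      l * k + d * CARD('n)"
    using sum_list_dual_partition[OF nu] n by (simp add: sum_list_replicate)
  let ?N = "if d = 0 \<and> p + sum_list mu = sum_list nu \<and> horizontal_strip mu nu then 1 else 0 :: nat"
  let ?c = "\<lambda>(F :: 'n flag) G H. curve_classes (meeting_curves l d (schubert l k (p # replicate (l - 1) 0) F)
      (schubert l k mu G) (schubert l k (dual_partition k nu) H))"
  have "for_general_flags (\<lambda>F G H. finite (?c F G H) \<and> card (?c F G H) = ?N)"
  proof (rule for_general_flags_mono[OF for_general_flags_general])
    fix F G H :: "'n flag"
    assume "\<exists>\<phi>. general_flags F G H \<phi>"
    then obtain \<phi> where "general_flags F G H \<phi>" by blast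
    then interpret general_flags F G H \<phi> .
    let ?X = "schubert l k (p # replicate (l - 1) 0) F" and ?Y = "schubert l k mu G"
      and ?Z = "schubert l k (dual_partition k nu) H"
    show "finite (?c F G H) \<and> card (?c F G H) = ?N"
    proof (cases "d = 0")
      case d: True
      have curves: "meeting_curves l d ?X ?Y ?Z = (\<lambda>V. \<lambda>x\<in>P1. V) ` (?X \<inter> ?Y \<inter> ?Z)"
        unfolding d by (rule meeting_curves_0[OF l]) (auto simp: schubert_def)
      have sum: "p + sum_list mu = sum_list nu" using True d by simp
      show ?thesis
      proof (cases "horizontal_strip mu nu")
        case hs: True
        then obtain V where "?X \<inter> ?Y \<inter> ?Z = {V}"
          using pieri_intersection[OF n l p mu nu sum] by auto
        then have "meeting_curves l d ?X ?Y ?Z = {\<lambda>x\<in>P1. V}" using curves by simp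
        then show ?thesis using curve_classes_singleton d sum hs by simp
      next
        case hs: False
        then have "?X \<inter> ?Y \<inter> ?Z = {}"
          using pieri_intersection[OF n l p mu nu sum] by simp
        then have "meeting_curves l d ?X ?Y ?Z = {}" using curves by simp
        then show ?thesis using hs by (simp add: curve_classes_def quotient_def)
      qed
    next
      case d: False
      have "f \<notin> meeting_curves l d ?X ?Y ?Z" for f
      proof
        assume "f \<in> meeting_curves l d ?X ?Y ?Z"
        then have f: "f \<in> rational_curves l d" "f ` P1 \<inter> ?X \<noteq> {}" "f ` P1 \<inter> ?Y \<noteq> {}" "f ` P1 \<inter> ?Z \<noteq> {}"
          by (auto simp: meeting_curves_def)
        then obtain V1 V2 V3 where V: "V1 \<in> f ` P1" "V1 \<in> ?X" "V2 \<in> f ` P1" "V2 \<in> ?Y"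
          "V3 \<in> f ` P1" "V3 \<in> ?Z" by (metis disjoint_iff)
        have sub: "V \<subseteq> vec.span (\<Union>(f ` P1))" if "V \<in> f ` P1" for V
          using that vec.span_superset by blast
        show False
          using d V by (intro no_common_subspace[OF n l p mu nu mu0 True _ vec.subspace_span
              curve_span_bound[OF f(1) l] sub[OF V(1)] sub[OF V(3)] sub[OF V(5)]]) auto
      qed
      then have "meeting_curves l d ?X ?Y ?Z = {}" by blast
      then show ?thesis using d by (simp add: curve_classes_def quotient_def)
    qed
  qed
  from the_general_count[OF this] show ?thesis
    unfolding gromov_witten_def Let_def using dim by simp
qed

lemma quantum_coeff_special:
  assumes "CARD('n::{finite,linorder}) = l + k" "1 \<le> l" "p \<le> k"
    "mu \<in> partitions_in l k" "nu \<in> partitions_in l k" "mu ! (l - 1) = 0"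
  shows "quantum_coeff (T :: 'n itself) l k (p # replicate (l - 1) 0) mu nu =
    (if p + sum_list mu = sum_list nu \<and> horizontal_strip mu nu then 1 else 0)"
proof -
  note gw = gromov_witten_special[OF assms]
  show ?thesis
  proof (cases "p + sum_list mu = sum_list nu \<and> horizontal_strip mu nu")
    case True
    then have "{d. gromov_witten T l k (p # replicate (l - 1) 0) mu (dual_partition k nu) d \<noteq> 0} = {0}"
      unfolding gw by auto
    then show ?thesis unfolding quantum_coeff_def using True by (simp only: gw) simp
  next
    case False
    then have "{d. gromov_witten T l k (p # replicate (l - 1) 0) mu (dual_partition k nu) d \<noteq> 0} = {}"
      unfolding gw by auto
    then show ?thesis unfolding quantum_coeff_def using False by (simp only: sum.empty if_False)
  qed
qed

section \<open>Laplace expansion in the quantum ring\<close>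

text \<open>The cycle carrying i to N and shifting i + 1, ..., N down by one; its sign is the sign
  (-1)^(N - i) of the Laplace expansion.\<close>

definition move_to_end :: "nat \<Rightarrow> nat \<Rightarrow> nat \<Rightarrow> nat" where
  "move_to_end N i j = (if j < i then j else if j = i then N else if j \<le> N then j - 1 else j)"

lemma move_to_end_permutes_sign:
  assumes "1 \<le> i" "i \<le> N"
  shows "move_to_end N i permutes {1..N} \<and> sign (move_to_end N i) = (- 1) ^ (N - i)"
  using assms(2,1)
proof (induction i rule: inc_induct)
  case base
  have "move_to_end N N = id" by (auto simp: move_to_end_def fun_eq_iff)
  show ?case unfolding \<open>move_to_end N N = id\<close> by (intro conjI permutes_id) simp
next
  case (step i)
  have eq: "move_to_end N i = move_to_end N (Suc i) \<circ> Transposition.transpose i (Suc i)"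
    using step by (auto simp: move_to_end_def fun_eq_iff Transposition.transpose_def)
  have IH: "move_to_end N (Suc i) permutes {1..N}" "sign (move_to_end N (Suc i)) = (- 1) ^ (N - Suc i)"
    using step by auto
  have t: "Transposition.transpose i (Suc i) permutes {1..N}"
    using step by (intro permutes_swap_id) auto
  have "N - i = Suc (N - Suc i)" using step by simp
  then have "sign (move_to_end N i) = (- 1) ^ (N - i)"
    unfolding eq using IH t permutation_permutes[of "move_to_end N (Suc i)"]
    by (subst sign_compose) (auto simp: sign_swap_id permutation_swap_id)
  moreover have "move_to_end N i permutes {1..N}" unfolding eq using permutes_compose[OF t IH(1)] .
  ultimately show ?case by blast
qed

definition skip :: "nat \<Rightarrow> nat \<Rightarrow> nat" where
  "skip i j = (if j < i then j else Suc j)"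

lemma skip_image: "1 \<le> i \<Longrightarrow> i \<le> Suc m \<Longrightarrow> skip i ` {1..m} = {1..Suc m} - {i}"
proof (intro equalityI subsetI)
  fix j assume "1 \<le> i" "i \<le> Suc m" "j \<in> {1..Suc m} - {i}"
  then show "j \<in> skip i ` {1..m}"
    by (intro image_eqI[of _ _ "if j < i then j else j - 1"]) (auto simp: skip_def)
qed (auto simp: skip_def)

lemma inj_skip: "inj_on (skip i) A"
  by (auto simp: inj_on_def skip_def split: if_splits)

text \<open>A permutation of 1, ..., m + 1 factors uniquely as the cycle moving i to the end, where
  i is the preimage of m + 1, followed by a permutation fixing m + 1.\<close>

lemma sum_permutations_last:
  fixes g :: "(nat \<Rightarrow> nat) \<Rightarrow> 'a::comm_monoid_add"
  shows "(\<Sum>\<pi> | \<pi> permutes {1..Suc m}. g \<pi>) =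
    (\<Sum>i\<in>{1..Suc m}. \<Sum>\<pi> | \<pi> permutes {1..m}. g (\<pi> \<circ> move_to_end (Suc m) i))"
proof -
  let ?c = "move_to_end (Suc m)"
  let ?P = "\<lambda>m. {\<pi>. \<pi> permutes {1..m}}" and ?j = "\<lambda>(i, \<pi>). \<pi> \<circ> ?c i"
  have c: "?c i permutes {1..Suc m}" "?c i i = Suc m" if "i \<in> {1..Suc m}" for i
    using move_to_end_permutes_sign[of i "Suc m"] that by (auto simp: move_to_end_def)
  have "(\<Sum>i\<in>{1..Suc m}. \<Sum>\<pi>\<in>?P m. g (\<pi> \<circ> ?c i)) =
     (\<Sum>(i, \<pi>)\<in>{1..Suc m} \<times> ?P m. g (\<pi> \<circ> ?c i))"
    by (simp add: sum.cartesian_product)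
  also have "\<dots> = (\<Sum>\<pi>\<in>?P (Suc m). g \<pi>)"
  proof (rule sum.reindex_bij_witness[where i = "\<lambda>\<pi>. (inv_into UNIV \<pi> (Suc m), \<pi> \<circ> inv_into UNIV (?c (inv_into UNIV \<pi> (Suc m))))"
        and j = ?j])
    fix x assume "x \<in> {1..Suc m} \<times> ?P m"
    then obtain i \<pi> where x: "x = (i, \<pi>)" "i \<in> {1..Suc m}" "\<pi> permutes {1..m}" by auto
    have \<pi>': "\<pi> permutes {1..Suc m}" using x(3) by (rule permutes_subset) auto
    have fix': "\<pi> (Suc m) = Suc m" using x(3) by (simp add: permutes_def)
    have comp: "\<pi> \<circ> ?c i permutes {1..Suc m}" using permutes_compose[OF c(1)[OF x(2)] \<pi>'] .
    have "(\<pi> \<circ> ?c i) i = Suc m" using c(2)[OF x(2)] fix' by simp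
    then have "inv_into UNIV (\<pi> \<circ> ?c i) (Suc m) = i" using permutes_inv_eq[OF comp] by simp
    moreover have "\<pi> \<circ> ?c i \<circ> inv_into UNIV (?c i) = \<pi>"
      using permutes_inv_o(1)[OF c(1)[OF x(2)]] by (simp add: comp_assoc)
    ultimately show "(inv_into UNIV (?j x) (Suc m),
        (?j x) \<circ> inv_into UNIV (?c (inv_into UNIV (?j x) (Suc m)))) = x"
      using x(1) by simp
    show "(?j x) \<in> ?P (Suc m)" using comp x(1) by simp
    show "g (?j x) = (case x of (i, \<pi>) \<Rightarrow> g (\<pi> \<circ> ?c i))" using x(1) by simp
  next
    fix \<pi> assume "\<pi> \<in> ?P (Suc m)"
    then have \<pi>: "\<pi> permutes {1..Suc m}" by simp
    let ?i = "inv_into UNIV \<pi> (Suc m)"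
    have i: "?i \<in> {1..Suc m}" using permutes_in_image[OF permutes_inv[OF \<pi>], of "Suc m"] by simp
    note ci = c(1)[OF i]
    show "(case (?i, \<pi> \<circ> inv_into UNIV (?c ?i)) of (i, \<pi>) \<Rightarrow> \<pi> \<circ> ?c i) = \<pi>"
      using permutes_inv_o(2)[OF ci] by (simp add: comp_assoc)
    have perm: "\<pi> \<circ> inv_into UNIV (?c ?i) permutes {1..Suc m}"
      using permutes_compose[OF permutes_inv[OF ci] \<pi>] .
    have last: "(\<pi> \<circ> inv_into UNIV (?c ?i)) (Suc m) = Suc m"
    proof -
      have "inv_into UNIV (?c ?i) (Suc m) = ?i" using c(2)[OF i] permutes_inv_eq[OF ci] by simp
      then show ?thesis using permutes_inverses(1)[OF \<pi>] by simp
    qed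
    have "\<pi> \<circ> inv_into UNIV (?c ?i) permutes {1..m}"
      by (rule permutes_superset[OF perm]) (use last in \<open>auto simp: atLeastAtMostSuc_conv\<close>)
    then show "(?i, \<pi> \<circ> inv_into UNIV (?c ?i)) \<in> {1..Suc m} \<times> ?P m" using i by simp
  qed
  finally show ?thesis by simp
qed

lemma finite_partitions_in: "finite (partitions_in l k)"
proof (rule finite_subset)
  show "partitions_in l k \<subseteq> {xs. set xs \<subseteq> {..k} \<and> length xs = l}" by (auto simp: partitions_in_def)
  show "finite {xs. set xs \<subseteq> {..k} \<and> length xs = l}" by (rule finite_lists_length_eq) simp
qed

text \<open>Associativity of the quantum product enters through \<open>cring_QH\<close>, as the fact
  taken for granted. Elements are functions on partitions, so identities of the ring are checked
  value by value in \<open>int poly\<close>.\<close>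

locale quantum_cohomology =
  fixes T :: "'n::{finite,linorder} itself" and l k :: nat
  assumes cring_QH: "cring (QH T l k)"
    and l_pos: "1 \<le> l" and card_n: "CARD('n) = l + k"
begin

abbreviation "R \<equiv> QH T l k"

sublocale cring R by (rule cring_QH)

section \<open>Ring operations and determinants evaluated at a partition\<close>

lemma carrier_iff: "x \<in> carrier R \<longleftrightarrow> (\<forall>nu. nu \<notin> partitions_in l k \<longrightarrow> x nu = 0)"
  by (simp add: QH_def)

lemma add_eval: "(x \<oplus>\<^bsub>R\<^esub> y) nu = x nu + y nu"
  by (simp add: QH_def)

lemma zero_eval: "\<zero>\<^bsub>R\<^esub> nu = 0"
  by (simp add: QH_def)

lemma mult_eval:
  "(x \<otimes>\<^bsub>R\<^esub> y) nu = (if nu \<in> partitions_in l k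
     then \<Sum>lam\<in>partitions_in l k. \<Sum>mu\<in>partitions_in l k. x lam * y mu * quantum_coeff T l k lam mu nu
     else 0)"
  by (simp add: QH_def)

lemma one_eq: "\<one>\<^bsub>R\<^esub> = schubert_class (replicate l 0)"
  by (simp add: QH_def)

lemma finsum_eval:
  assumes "finite A" "f \<in> A \<rightarrow> carrier R"
  shows "finsum R f A nu = (\<Sum>a\<in>A. f a nu)"
  using assms by (induction A) (auto simp: zero_eval add_eval finsum_insert Pi_iff)

lemma sign_mult_eval:
  assumes "x \<in> carrier R"
  shows "([sign \<pi>] \<cdot>\<^bsub>R\<^esub> x) nu = of_int (sign \<pi>) * x nu"
proof (cases \<pi> rule: sign_cases)
  case even
  then show ?thesis using assms by (simp add: add.int_pow_1)
next
  case odd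
  have "(x \<oplus>\<^bsub>R\<^esub> \<ominus>\<^bsub>R\<^esub> x) nu = 0" using assms by (simp add: r_neg zero_eval)
  then have "(\<ominus>\<^bsub>R\<^esub> x) nu = - x nu" by (simp add: add_eval add_eq_0_iff)
  moreover have "[(- 1 :: int)] \<cdot>\<^bsub>R\<^esub> x = \<ominus>\<^bsub>R\<^esub> x"
    using assms add.int_pow_neg[of x 1] add.int_pow_1[of x] by simp
  ultimately show ?thesis using odd by simp
qed

lemma ring_det_eval:
  assumes "\<And>i j. i \<in> {1..m} \<Longrightarrow> j \<in> {1..m} \<Longrightarrow> A i j \<in> carrier R"
  shows "ring_det R m A nu =
    (\<Sum>\<pi> | \<pi> permutes {1..m}. of_int (sign \<pi>) * finprod R (\<lambda>i. A i (\<pi> i)) {1..m} nu)"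
proof -
  have c: "finprod R (\<lambda>i. A i (\<pi> i)) {1..m} \<in> carrier R" if "\<pi> permutes {1..m}" for \<pi>
    using assms that permutes_in_image[OF that] by (intro finprod_closed) auto
  then have "ring_det R m A nu = (\<Sum>\<pi> | \<pi> permutes {1..m}. ([sign \<pi>] \<cdot>\<^bsub>R\<^esub> finprod R (\<lambda>i. A i (\<pi> i)) {1..m}) nu)"
    unfolding ring_det_def
    by (intro finsum_eval) (auto simp: finite_permutations intro!: add.int_pow_closed)
  also have "\<dots> = (\<Sum>\<pi> | \<pi> permutes {1..m}. of_int (sign \<pi>) * finprod R (\<lambda>i. A i (\<pi> i)) {1..m} nu)"
    using c by (intro sum.cong) (auto simp: sign_mult_eval)
  finally show ?thesis .
qed

lemma ring_det_cong:
  assumes "\<And>i j. i \<in> {1..m} \<Longrightarrow> j \<in> {1..m} \<Longrightarrow> A i j \<in> carrier R"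
    and "\<And>i j. i \<in> {1..m} \<Longrightarrow> j \<in> {1..m} \<Longrightarrow> A i j = B i j"
  shows "ring_det R m A = ring_det R m B"
proof
  fix nu
  have "finprod R (\<lambda>i. A i (\<pi> i)) {1..m} = finprod R (\<lambda>i. B i (\<pi> i)) {1..m}" if "\<pi> permutes {1..m}" for \<pi>
  proof (rule finprod_cong'[OF refl])
    fix i assume i: "i \<in> {1..m}"
    then have "\<pi> i \<in> {1..m}" using permutes_in_image[OF that] by blast
    then show "A i (\<pi> i) = B i (\<pi> i)" using assms(2) i by blast
  qed (use assms permutes_in_image[OF that] in auto)
  moreover have "B i j \<in> carrier R" if "i \<in> {1..m}" "j \<in> {1..m}" for i j
    using assms(1,2)[OF that] by simp
  ultimately show "ring_det R m A nu = ring_det R m B nu"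
    using assms(1) by (subst (1 2) ring_det_eval) auto
qed

lemma ring_det_carrier:
  assumes "\<And>i j. i \<in> {1..m} \<Longrightarrow> j \<in> {1..m} \<Longrightarrow> A i j \<in> carrier R"
  shows "ring_det R m A \<in> carrier R"
proof -
  have "finprod R (\<lambda>i. A i (\<pi> i)) {1..m} nu = 0" if "\<pi> permutes {1..m}" "nu \<notin> partitions_in l k" for \<pi> nu
  proof -
    have "finprod R (\<lambda>i. A i (\<pi> i)) {1..m} \<in> carrier R"
      using assms permutes_in_image[OF that(1)] by (intro finprod_closed) auto
    then show ?thesis using that(2) by (simp add: carrier_iff)
  qed
  then show ?thesis unfolding carrier_iff
    by (intro allI impI, subst ring_det_eval[OF assms]) (auto intro!: sum.neutral)
qed

lemma ring_det_zero_row: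
  assumes "\<And>i j. i \<in> {1..m} \<Longrightarrow> j \<in> {1..m} \<Longrightarrow> A i j \<in> carrier R"
    and "r \<in> {1..m}" "\<And>j. j \<in> {1..m} \<Longrightarrow> A r j = \<zero>\<^bsub>R\<^esub>"
  shows "ring_det R m A = \<zero>\<^bsub>R\<^esub>"
proof
  fix nu
  have "finprod R (\<lambda>i. A i (\<pi> i)) {1..m} = \<zero>\<^bsub>R\<^esub>" if "\<pi> permutes {1..m}" for \<pi>
  proof -
    have c: "A i (\<pi> i) \<in> carrier R" if "i \<in> {1..m}" for i
      using assms(1) that permutes_in_image[OF \<open>\<pi> permutes {1..m}\<close>, of i] by blast
    have "{1..m} = insert r ({1..m} - {r})" using assms(2) by blast
    then have "finprod R (\<lambda>i. A i (\<pi> i)) {1..m} =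
        A r (\<pi> r) \<otimes>\<^bsub>R\<^esub> finprod R (\<lambda>i. A i (\<pi> i)) ({1..m} - {r})"
      using c assms(2) finprod_insert[of "{1..m} - {r}" r "\<lambda>i. A i (\<pi> i)"] by auto
    also have "A r (\<pi> r) = \<zero>\<^bsub>R\<^esub>"
      using assms(2,3) permutes_in_image[OF that, of r] by blast
    finally show ?thesis using c by (simp add: Pi_iff)
  qed
  then show "ring_det R m A nu = \<zero>\<^bsub>R\<^esub> nu"
    using assms(1) by (subst ring_det_eval) (auto simp: zero_eval)
qed

text \<open>Linearity in the second factor for an element known through its values; the
  coefficients, such as the signs in a determinant, act on values.\<close>

lemma mult_eval_sum:
  assumes "finite P" "\<And>mu. y mu = (\<Sum>p\<in>P. c p * z p mu)"
  shows "(x \<otimes>\<^bsub>R\<^esub> y) nu = (\<Sum>p\<in>P. c p * (x \<otimes>\<^bsub>R\<^esub> z p) nu)"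
proof (cases "nu \<in> partitions_in l k")
  case True
  let ?q = "\<lambda>lam mu. quantum_coeff T l k lam mu nu"
  have "(x \<otimes>\<^bsub>R\<^esub> y) nu = (\<Sum>lam\<in>partitions_in l k. \<Sum>mu\<in>partitions_in l k. \<Sum>p\<in>P. c p * (x lam * z p mu * ?q lam mu))"
    using True by (simp add: mult_eval assms(2) sum_distrib_left sum_distrib_right mult_ac)
  also have "\<dots> = (\<Sum>lam\<in>partitions_in l k. \<Sum>p\<in>P. \<Sum>mu\<in>partitions_in l k. c p * (x lam * z p mu * ?q lam mu))"
    by (intro sum.cong refl sum.swap)
  also have "\<dots> = (\<Sum>p\<in>P. \<Sum>lam\<in>partitions_in l k. \<Sum>mu\<in>partitions_in l k. c p * (x lam * z p mu * ?q lam mu))"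
    by (rule sum.swap)
  also have "\<dots> = (\<Sum>p\<in>P. c p * (x \<otimes>\<^bsub>R\<^esub> z p) nu)"
    using True by (simp add: mult_eval sum_distrib_left)
  finally show ?thesis .
qed (simp add: mult_eval)

text \<open>Permutations are grouped by the row i that meets the last column. The remaining rows are
  renumbered by \<open>skip i\<close>, and the cycle contributes the sign.\<close>

lemma ring_det_last_column:
  assumes A: "\<And>i j. i \<in> {1..Suc m} \<Longrightarrow> j \<in> {1..Suc m} \<Longrightarrow> A i j \<in> carrier R"
  shows "ring_det R (Suc m) A nu = (\<Sum>i\<in>{1..Suc m}. (- 1) ^ (Suc m - i) *
    (A i (Suc m) \<otimes>\<^bsub>R\<^esub> ring_det R m (\<lambda>i' j. A (skip i i') j)) nu)"
proof -
  let ?c = "move_to_end (Suc m)"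
  let ?F = "\<lambda>i \<pi>. finprod R (\<lambda>i'. A (skip i i') (\<pi> i')) {1..m}"
  have minor: "A (skip i i') j \<in> carrier R" if "i \<in> {1..Suc m}" "i' \<in> {1..m}" "j \<in> {1..m}" for i i' j
    using that by (intro A) (auto simp: skip_def)
  have "ring_det R (Suc m) A nu = (\<Sum>i\<in>{1..Suc m}. \<Sum>\<pi> | \<pi> permutes {1..m}.
      of_int (sign (\<pi> \<circ> ?c i)) * finprod R (\<lambda>i'. A i' ((\<pi> \<circ> ?c i) i')) {1..Suc m} nu)"
    using A by (subst ring_det_eval) (auto simp only: sum_permutations_last)
  also have "\<dots> = (\<Sum>i\<in>{1..Suc m}. \<Sum>\<pi> | \<pi> permutes {1..m}.
      (- 1) ^ (Suc m - i) * (of_int (sign \<pi>) * (A i (Suc m) \<otimes>\<^bsub>R\<^esub> ?F i \<pi>) nu))"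
  proof (intro sum.cong refl)
    fix i \<pi> assume i: "i \<in> {1..Suc m}" and "\<pi> \<in> {\<pi>. \<pi> permutes {1..m}}"
    then have \<pi>: "\<pi> permutes {1..m}" by simp
    have c: "?c i permutes {1..Suc m}" "sign (?c i) = (- 1) ^ (Suc m - i)"
      using move_to_end_permutes_sign[of i "Suc m"] i by auto
    have "permutation \<pi>" "permutation (?c i)"
      using \<pi> c(1) permutation_permutes by (metis finite_atLeastAtMost)+
    then have sgn: "sign (\<pi> \<circ> ?c i) = (- 1) ^ (Suc m - i) * sign \<pi>"
      by (simp add: sign_compose c(2))
    have fixlast: "\<pi> (Suc m) = Suc m" using \<pi> by (simp add: permutes_def)
    have at_i: "(\<pi> \<circ> ?c i) i = Suc m" using fixlast by (simp add: move_to_end_def)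
    have at_skip: "(\<pi> \<circ> ?c i) (skip i i') = \<pi> i'" if "i' \<in> {1..m}" for i'
      using that by (auto simp: move_to_end_def skip_def)
    have eq: "{1..Suc m} = insert i (skip i ` {1..m})" using skip_image[of i m] i by auto
    have notin: "i \<notin> skip i ` {1..m}" using skip_image[of i m] i by auto
    have im: "\<pi> i' \<in> {1..m}" if "i' \<in> {1..m}" for i' using permutes_in_image[OF \<pi>] that by blast
    have closed: "(\<lambda>i'. A i' ((\<pi> \<circ> ?c i) i')) \<in> skip i ` {1..m} \<rightarrow> carrier R"
      using minor i im at_skip by auto
    have "finprod R (\<lambda>i'. A i' ((\<pi> \<circ> ?c i) i')) {1..Suc m} =
        A i (Suc m) \<otimes>\<^bsub>R\<^esub> finprod R (\<lambda>i'. A i' ((\<pi> \<circ> ?c i) i')) (skip i ` {1..m})"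
      unfolding eq using notin closed at_i A[OF i, of "Suc m"]
      by (subst finprod_insert) auto
    also have "finprod R (\<lambda>i'. A i' ((\<pi> \<circ> ?c i) i')) (skip i ` {1..m}) =
        finprod R (\<lambda>i'. A (skip i i') ((\<pi> \<circ> ?c i) (skip i i'))) {1..m}"
      by (rule finprod_reindex[OF closed inj_skip])
    also have "\<dots> = ?F i \<pi>"
      using minor i im at_skip by (intro finprod_cong') auto
    finally show "of_int (sign (\<pi> \<circ> ?c i)) * finprod R (\<lambda>i'. A i' ((\<pi> \<circ> ?c i) i')) {1..Suc m} nu =
        (- 1) ^ (Suc m - i) * (of_int (sign \<pi>) * (A i (Suc m) \<otimes>\<^bsub>R\<^esub> ?F i \<pi>) nu)"
      using sgn by simp
  qed
  also have "\<dots> = (\<Sum>i\<in>{1..Suc m}. (- 1) ^ (Suc m - i) *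
      (A i (Suc m) \<otimes>\<^bsub>R\<^esub> ring_det R m (\<lambda>i' j. A (skip i i') j)) nu)"
  proof (intro sum.cong refl)
    fix i assume i: "i \<in> {1..Suc m}"
    have "(A i (Suc m) \<otimes>\<^bsub>R\<^esub> ring_det R m (\<lambda>i' j. A (skip i i') j)) nu =
       (\<Sum>\<pi> | \<pi> permutes {1..m}. of_int (sign \<pi>) * (A i (Suc m) \<otimes>\<^bsub>R\<^esub> ?F i \<pi>) nu)"
      using minor[OF i] by (intro mult_eval_sum ring_det_eval) (auto simp: finite_permutations)
    then show "(\<Sum>\<pi> | \<pi> permutes {1..m}.
      (- 1) ^ (Suc m - i) * (of_int (sign \<pi>) * (A i (Suc m) \<otimes>\<^bsub>R\<^esub> ?F i \<pi>) nu)) =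
      (- 1) ^ (Suc m - i) * (A i (Suc m) \<otimes>\<^bsub>R\<^esub> ring_det R m (\<lambda>i' j. A (skip i i') j)) nu"
      by (simp add: sum_distrib_left)
  qed
  finally show ?thesis .
qed

end

section \<open>Giambelli determinants\<close>

text \<open>
  The partition left after deleting row \<open>i\<close> of the Giambelli matrix with \<open>Suc m\<close> rows and its last
  column: the rows below row \<open>i\<close> move up by one, which lowers their parts by one.
\<close>

definition delete_row :: "nat list \<Rightarrow> nat \<Rightarrow> nat \<Rightarrow> nat list" where
  "delete_row lam m i = map (\<lambda>j. if Suc j < i then lam ! j else if j < m then lam ! Suc j - 1 else 0) [0..<length lam]"

lemma sum_list_nth: "length xs = l \<Longrightarrow> sum_list xs = (\<Sum>j<l. xs ! j)"
  by (simp add: sum_list_sum_nth atLeast0LessThan)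

text \<open>A horizontal strip has at most one box in each of the \<open>nu ! 0\<close> columns of
  nu.\<close>

lemma horizontal_strip_sum_le:
  assumes "horizontal_strip mu nu" "length mu = l" "length nu = l" "1 \<le> l"
  shows "sum_list nu \<le> nu ! 0 + sum_list mu"
proof -
  obtain l' where l: "l = Suc l'" using assms(4) by (cases l) auto
  have "sum_list nu = (\<Sum>j<Suc l'. nu ! j)" using sum_list_nth[OF assms(3)] l by simp
  also have "\<dots> = nu ! 0 + (\<Sum>j<l'. nu ! Suc j)" by (rule sum.lessThan_Suc_shift)
  also have "(\<Sum>j<l'. nu ! Suc j) \<le> (\<Sum>j<l'. mu ! j)"
    using assms(1,3) l by (intro sum_mono) (auto simp: horizontal_strip_def)
  also have "\<dots> \<le> sum_list mu" using sum_list_nth[OF assms(2)] by (simp add: l)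
  finally show ?thesis by simp
qed

section \<open>Strips on the partitions left by deleting a row\<close>

locale deletable_rows =
  fixes lam :: "nat list" and l k m :: nat
  assumes lam: "lam \<in> partitions_in l k" and m: "Suc m \<le> l"
    and pos: "lam ! m \<noteq> 0" and tail: "j < l \<Longrightarrow> Suc m \<le> j \<Longrightarrow> lam ! j = 0"
begin

abbreviation "mu \<equiv> delete_row lam m"

lemma length_lam: "length lam = l"
  using lam by (rule partitions_in_length)

lemma lam_mono: "i \<le> j \<Longrightarrow> j < l \<Longrightarrow> lam ! j \<le> lam ! i"
  using partitions_in_antimono[OF lam] .

lemma lam_pos: "j \<le> m \<Longrightarrow> 1 \<le> lam ! j"
  using lam_mono[of j m] pos m by simp

lemma mu_nth: "j < l \<Longrightarrow> mu i ! j = (if Suc j < i then lam ! j else if j < m then lam ! Suc j - 1 else 0)"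
  by (simp add: delete_row_def length_lam)

lemma mu_partition:
  assumes "i \<le> Suc m"
  shows "mu i \<in> partitions_in l k" "mu i ! (l - 1) = 0"
proof -
  have "mu i ! j' \<le> mu i ! j" if "j < j'" "j' < l" for j j'
    using that lam_mono[of j j'] lam_mono[of j "Suc j'"] lam_mono[of "Suc j" "Suc j'"] assms m
    by (auto simp: mu_nth)
  moreover have "mu i ! j \<le> k" if "j < l" for j
    using that partitions_in_nth_le[OF lam, of j] partitions_in_nth_le[OF lam, of "Suc j"] m
    by (auto simp: mu_nth)
  ultimately show "mu i \<in> partitions_in l k"
    by (simp add: partitions_in_iff) (simp add: delete_row_def length_lam)
  show "mu i ! (l - 1) = 0" using m assms by (simp add: mu_nth)
qed

text \<open>Deleting row i loses its part and one box in each of the Suc m - i rows below. The loss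
  is the index of the special class in row i of the last column, so every term of the expansion has
  the same degree.\<close>

lemma mu_sum:
  assumes "1 \<le> i" "i \<le> Suc m"
  shows "lam ! (i - 1) + (Suc m - i) + sum_list (mu i) = sum_list lam"
proof -
  have "sum_list (mu i) = (\<Sum>j<l. mu i ! j)"
    by (rule sum_list_nth) (simp add: delete_row_def length_lam)
  also have "\<dots> = (\<Sum>j<m. mu i ! j)"
    using m assms by (intro sum.mono_neutral_right) (auto simp: mu_nth)
  finally have sum_mu: "sum_list (mu i) = (\<Sum>j<m. mu i ! j)" .
  have "sum_list (mu i) + (Suc m - i) = (\<Sum>j<m. mu i ! j) + (\<Sum>j<m. if i - 1 \<le> j then 1 else 0)"
  proof -
    have "{j \<in> {..<m}. i - 1 \<le> j} = {i - 1..<m}" by auto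
    then have "(\<Sum>j<m. if i - 1 \<le> j then 1 else 0) = Suc m - i"
      using assms by (simp flip: sum.inter_filter)
    then show ?thesis using sum_mu by simp
  qed
  also have "\<dots> = (\<Sum>j<m. lam ! skip (i - 1) j)"
    unfolding sum.distrib[symmetric]
  proof (intro sum.cong refl)
    fix j assume "j \<in> {..<m}"
    then have "j < l" "1 \<le> lam ! Suc j" "j < m" using m lam_pos[of "Suc j"] by auto
    then show "mu i ! j + (if i - 1 \<le> j then 1 else 0) = lam ! skip (i - 1) j"
      using assms(1) by (auto simp: mu_nth skip_def)
  qed
  also have "\<dots> = (\<Sum>j\<in>{..m} - {i - 1}. lam ! j)"
  proof -
    have "skip (i - 1) ` {..<m} = {..m} - {i - 1}"
    proof (intro equalityI subsetI)
      fix j assume "j \<in> {..m} - {i - 1}"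
      then show "j \<in> skip (i - 1) ` {..<m}" using assms
        by (intro image_eqI[of _ _ "if j < i - 1 then j else j - 1"]) (auto simp: skip_def)
    qed (auto simp: skip_def)
    then have "(\<Sum>j\<in>{..m} - {i - 1}. lam ! j) = (\<Sum>j\<in>skip (i - 1) ` {..<m}. lam ! j)" by simp
    also have "\<dots> = (\<Sum>j<m. lam ! skip (i - 1) j)" by (simp add: sum.reindex[OF inj_skip])
    finally show ?thesis by simp
  qed
  finally have "lam ! (i - 1) + (Suc m - i) + sum_list (mu i) = lam ! (i - 1) + (\<Sum>j\<in>{..m} - {i - 1}. lam ! j)"
    by simp
  also have "\<dots> = (\<Sum>j\<le>m. lam ! j)"
    using assms by (intro sum.remove[symmetric]) auto
  also have "\<dots> = (\<Sum>j<l. lam ! j)"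
    using m tail by (intro sum.mono_neutral_left) auto
  also have "\<dots> = sum_list lam" using sum_list_nth[OF length_lam] by simp
  finally show ?thesis .
qed

text \<open>
  A horizontal strip on \<open>mu i\<close> either reaches part \<open>lam ! (i - 1)\<close> in row \<open>i\<close> or does not; the two cases
  are \<open>above nu i\<close> and \<open>above nu (i - 1)\<close>, so the alternating sum over \<open>i\<close> telescopes.
\<close>

definition above :: "nat list \<Rightarrow> nat \<Rightarrow> bool" where
  "above nu i \<longleftrightarrow> (\<forall>j<i. lam ! j \<le> nu ! j) \<and> (\<forall>j. i \<le> j \<and> j \<le> m \<longrightarrow> nu ! j < lam ! j) \<and>
     (\<forall>j. Suc j < i \<longrightarrow> nu ! Suc j \<le> lam ! j) \<and>
     (\<forall>j. i \<le> Suc j \<and> j < m \<longrightarrow> lam ! Suc j \<le> Suc (nu ! j)) \<and> (\<forall>j. m < j \<and> j < l \<longrightarrow> nu ! j = 0)"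

lemma strip_mu_iff:
  assumes "1 \<le> i" "i \<le> Suc m" "length nu = l"
  shows "horizontal_strip (mu i) nu \<longleftrightarrow>
    (\<forall>j. Suc j < i \<longrightarrow> lam ! j \<le> nu ! j \<and> nu ! Suc j \<le> lam ! j) \<and>
    (\<forall>j. i \<le> Suc j \<and> j < m \<longrightarrow> lam ! Suc j \<le> Suc (nu ! j) \<and> nu ! Suc j < lam ! Suc j) \<and>
    (\<forall>j. m < j \<and> j < l \<longrightarrow> nu ! j = 0)" (is "?L \<longleftrightarrow> ?A \<and> ?B \<and> ?C")
proof (intro iffI conjI allI impI)
  assume L: ?L
  have up: "mu i ! j \<le> nu ! j" if "j < l" for j
    using L that assms(3) by (simp add: horizontal_strip_def)
  have down: "nu ! Suc j \<le> mu i ! j" if "Suc j < l" for j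
    using L that assms(3) by (simp add: horizontal_strip_def)
  {
    fix j assume j: "Suc j < i"
    show "lam ! j \<le> nu ! j" "nu ! Suc j \<le> lam ! j"
      using up[of j] down[of j] mu_nth[of j i] j assms(2) m by auto
  next
    fix j assume j: "i \<le> Suc j \<and> j < m"
    show "lam ! Suc j \<le> Suc (nu ! j)" "nu ! Suc j < lam ! Suc j"
      using up[of j] down[of j] mu_nth[of j i] j m lam_pos[of "Suc j"] by auto
  next
    fix j assume j: "m < j \<and> j < l"
    then obtain j' where "j = Suc j'" by (cases j) auto
    then show "nu ! j = 0" using down[of j'] mu_nth[of j' i] j assms(2) by auto
  }
next
  assume R: "?A \<and> ?B \<and> ?C"
  have "mu i ! j \<le> nu ! j" "Suc j < l \<longrightarrow> nu ! Suc j \<le> mu i ! j" if "j < l" for j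
  proof -
    consider "Suc j < i" | "i \<le> Suc j" "j < m" | "i \<le> Suc j" "m \<le> j" by linarith
    then have "mu i ! j \<le> nu ! j \<and> (Suc j < l \<longrightarrow> nu ! Suc j \<le> mu i ! j)"
    proof cases
      case 1
      then show ?thesis using R that by (simp add: mu_nth)
    next
      case 2
      then have "lam ! Suc j \<le> Suc (nu ! j)" "nu ! Suc j < lam ! Suc j" using R by blast+
      then show ?thesis using 2 that by (simp add: mu_nth) linarith
    next
      case 3
      then show ?thesis using R that by (simp add: mu_nth)
    qed
    then show "mu i ! j \<le> nu ! j" "Suc j < l \<longrightarrow> nu ! Suc j \<le> mu i ! j" by auto
  qed
  then show ?L using assms(3) by (simp add: horizontal_strip_def)
qed

lemma all_from_Suc: "(\<forall>j. Suc h \<le> j \<and> j \<le> m \<longrightarrow> P j) \<longleftrightarrow> (\<forall>j. h \<le> j \<and> j < m \<longrightarrow> P (Suc j))"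
  by (metis Suc_le_D Suc_le_eq Suc_le_mono)

lemma strip_mu_reaching:
  assumes "h \<le> m" "length nu = l"
  shows "horizontal_strip (mu (Suc h)) nu \<and> lam ! h \<le> nu ! h \<longleftrightarrow> above nu (Suc h)"
  using assms unfolding above_def all_from_Suc
  by (subst strip_mu_iff) (auto simp: All_less_Suc)

text \<open>The two sides differ only in how row i is compared with the row before it; there
  monotonicity of lam supplies the missing inequality in either direction.\<close>

lemma strip_mu_not_reaching:
  assumes "1 \<le> i" "i \<le> Suc m" "length nu = l"
  shows "horizontal_strip (mu i) nu \<and> nu ! (i - 1) < lam ! (i - 1) \<longleftrightarrow> above nu (i - 1)"
  unfolding strip_mu_iff[OF assms] above_def
proof (intro iffI conjI allI impI; (elim conjE)?)
  fix j
  assume A: "\<forall>j. Suc j < i \<longrightarrow> lam ! j \<le> nu ! j \<and> nu ! Suc j \<le> lam ! j"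
    and B: "\<forall>j. i \<le> Suc j \<and> j < m \<longrightarrow> lam ! Suc j \<le> Suc (nu ! j) \<and> nu ! Suc j < lam ! Suc j"
    and C: "\<forall>j. m < j \<and> j < l \<longrightarrow> nu ! j = 0" and D: "nu ! (i - 1) < lam ! (i - 1)"
  show "lam ! j \<le> nu ! j" if "j < i - 1" using A that by simp
  show "nu ! j < lam ! j" if "i - 1 \<le> j" "j \<le> m"
  proof (cases "j = i - 1")
    case False
    then have "i \<le> Suc (j - 1) \<and> j - 1 < m" "Suc (j - 1) = j" using that assms(1) by auto
    then show ?thesis using B[rule_format, of "j - 1"] by simp
  qed (use D in simp)
  show "nu ! Suc j \<le> lam ! j" if "Suc j < i - 1" using A that by simp
  show "lam ! Suc j \<le> Suc (nu ! j)" if "i - 1 \<le> Suc j" "j < m"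
  proof (cases "i \<le> Suc j")
    case False
    then have "lam ! j \<le> nu ! j" using A that by simp
    moreover have "lam ! Suc j \<le> lam ! j" using lam_mono that m by simp
    ultimately show ?thesis by simp
  qed (use B that in blast)
  show "nu ! j = 0" if "m < j" "j < l" using C that by blast
next
  fix j
  assume A: "\<forall>j<i - 1. lam ! j \<le> nu ! j" and B: "\<forall>j. i - 1 \<le> j \<and> j \<le> m \<longrightarrow> nu ! j < lam ! j"
    and C: "\<forall>j. Suc j < i - 1 \<longrightarrow> nu ! Suc j \<le> lam ! j"
    and D: "\<forall>j. i - 1 \<le> Suc j \<and> j < m \<longrightarrow> lam ! Suc j \<le> Suc (nu ! j)"
    and E: "\<forall>j. m < j \<and> j < l \<longrightarrow> nu ! j = 0"
  show "lam ! j \<le> nu ! j" if "Suc j < i" using A that by simp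
  show "nu ! Suc j \<le> lam ! j" if "Suc j < i"
  proof (cases "Suc j < i - 1")
    case False
    then have "nu ! Suc j < lam ! Suc j" using B that assms(2) by simp
    moreover have "lam ! Suc j \<le> lam ! j" using lam_mono that assms(2) m by simp
    ultimately show ?thesis by simp
  qed (use C in blast)
  show "lam ! Suc j \<le> Suc (nu ! j)" if "i \<le> Suc j" "j < m" using D that by simp
  show "nu ! Suc j < lam ! Suc j" if "i \<le> Suc j" "j < m" using B that by simp
  show "nu ! j = 0" if "m < j" "j < l" using E that by blast
  show "nu ! (i - 1) < lam ! (i - 1)" using B assms(1,2) by simp
qed

text \<open>Here nu would be strictly below lam in positions 0 to m and 0 afterwards, and would have
  too few boxes.\<close>

lemma above_0:
  assumes "length nu = l" "sum_list nu = sum_list lam"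
  shows "\<not> above nu 0"
proof
  assume A: "above nu 0"
  have "(\<Sum>j<l. nu ! j) < (\<Sum>j<l. lam ! j)"
  proof (rule sum_strict_mono_ex1)
    show "\<forall>j\<in>{..<l}. nu ! j \<le> lam ! j"
    proof
      fix j assume "j \<in> {..<l}"
      then show "nu ! j \<le> lam ! j" using A by (cases "j \<le> m") (auto simp: above_def intro: less_imp_le)
    qed
    show "\<exists>j\<in>{..<l}. nu ! j < lam ! j" using A m by (intro bexI[of _ 0]) (auto simp: above_def)
  qed simp
  then show False using assms by (simp add: sum_list_nth[OF assms(1)] sum_list_nth[OF length_lam])
qed

text \<open>Here nu contains lam, and equal size leaves no room for a further box.\<close>

lemma above_last:
  assumes "length nu = l" "sum_list nu = sum_list lam"
  shows "above nu (Suc m) \<longleftrightarrow> nu = lam"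
proof
  assume A: "above nu (Suc m)"
  have le: "lam ! j \<le> nu ! j" if "j < l" for j
    using A that tail[of j] by (cases "j < Suc m") (auto simp: above_def)
  have "lam ! j = nu ! j" if "j < l" for j
  proof (rule ccontr)
    assume "lam ! j \<noteq> nu ! j"
    then have "(\<Sum>j<l. lam ! j) < (\<Sum>j<l. nu ! j)"
      using le that by (intro sum_strict_mono_ex1) (auto intro!: bexI[of _ j] simp: less_le)
    then show False using assms by (simp add: sum_list_nth[OF assms(1)] sum_list_nth[OF length_lam])
  qed
  then show "nu = lam" using assms(1) length_lam by (simp add: list_eq_iff_nth_eq)
next
  assume "nu = lam"
  then show "above nu (Suc m)" using lam_mono tail m by (auto simp: above_def)
qed

lemma alternating_strips:
  assumes "length nu = l" "sum_list nu = sum_list lam"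
  shows "(\<Sum>i\<in>{1..Suc m}. (- 1) ^ (Suc m - i) * (if horizontal_strip (mu i) nu then 1 else 0)) =
    (if nu = lam then 1 else 0 :: int poly)"
proof -
  define \<alpha> :: "nat \<Rightarrow> int poly" where "\<alpha> i = (if above nu i then 1 else 0)" for i
  have split: "(if horizontal_strip (mu i) nu then 1 else 0) = \<alpha> i + \<alpha> (i - 1)" if "i \<in> {1..Suc m}" for i
  proof -
    obtain h where "i = Suc h" "h \<le> m" using \<open>i \<in> {1..Suc m}\<close> by (cases i) auto
    then show ?thesis
      using strip_mu_reaching[of h nu] strip_mu_not_reaching[of "Suc h" nu] assms(1) by (auto simp: \<alpha>_def not_le)
  qed
  have "(\<Sum>i\<in>{1..M}. (- 1) ^ (M - i) * (\<alpha> i + \<alpha> (i - 1))) = \<alpha> M + (- 1) ^ (M + 1) * \<alpha> 0" if "1 \<le> M" for M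
    using that
  proof (induction M rule: dec_induct)
    case (step M)
    have "(\<Sum>i\<in>{1..Suc M}. (- 1) ^ (Suc M - i) * (\<alpha> i + \<alpha> (i - 1))) =
        \<alpha> (Suc M) + \<alpha> M + (\<Sum>i\<in>{1..M}. (- 1) ^ (Suc M - i) * (\<alpha> i + \<alpha> (i - 1)))"
      by simp
    also have "(\<Sum>i\<in>{1..M}. (- 1) ^ (Suc M - i) * (\<alpha> i + \<alpha> (i - 1))) =
        - (\<Sum>i\<in>{1..M}. (- 1) ^ (M - i) * (\<alpha> i + \<alpha> (i - 1)))"
      by (auto simp: sum_negf[symmetric] Suc_diff_le intro!: sum.cong)
    finally show ?case using step by simp
  qed simp
  from this[of "Suc m"] have "(\<Sum>i\<in>{1..Suc m}. (- 1) ^ (Suc m - i) * (\<alpha> i + \<alpha> (i - 1))) =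
      \<alpha> (Suc m) + (- 1) ^ (Suc m + 1) * \<alpha> 0" by simp
  also have "\<dots> = (if nu = lam then 1 else 0)"
    using above_0[OF assms] above_last[OF assms] by (simp add: \<alpha>_def)
  finally have "(\<Sum>i\<in>{1..Suc m}. (- 1) ^ (Suc m - i) * (\<alpha> i + \<alpha> (i - 1))) = (if nu = lam then 1 else 0)" .
  moreover have "(\<Sum>i\<in>{1..Suc m}. (- 1) ^ (Suc m - i) * (if horizontal_strip (mu i) nu then 1 else 0)) =
      (\<Sum>i\<in>{1..Suc m}. (- 1) ^ (Suc m - i) * (\<alpha> i + \<alpha> (i - 1)))"
    by (intro sum.cong refl arg_cong2[where f = "(*)"] split)
  ultimately show ?thesis by (simp only:)
qed

end

context quantum_cohomology
begin

section \<open>The Giambelli formula by induction on the number of rows\<close>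

lemma schubert_class_carrier: "lam \<in> partitions_in l k \<Longrightarrow> schubert_class lam \<in> carrier R"
  by (auto simp: carrier_iff schubert_class_def)

lemma special_partition: "p \<le> k \<Longrightarrow> p # replicate (l - 1) 0 \<in> partitions_in l k"
  using l_pos by (auto simp: partitions_in_iff nth_Cons split: nat.split)

lemma special_class_carrier: "special_class l k p \<in> carrier R"
proof (cases "0 \<le> p \<and> p \<le> int k")
  case True
  then have "schubert_class (nat p # replicate (l - 1) 0) \<in> carrier R"
    by (intro schubert_class_carrier special_partition) auto
  then show ?thesis using True by (simp add: special_class_def)
qed (auto simp: special_class_def carrier_iff)

lemma special_class_0: "special_class l k 0 = \<one>\<^bsub>R\<^esub>"
proof -
  have "replicate l 0 = (0 :: nat) # replicate (l - 1) 0" using l_pos by (cases l) auto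
  then show ?thesis by (simp add: special_class_def one_eq)
qed

lemma special_class_neg: "p < 0 \<Longrightarrow> special_class l k p = \<zero>\<^bsub>R\<^esub>"
  by (auto simp: special_class_def fun_eq_iff zero_eval)

lemma schubert_class_mult_eval:
  assumes "lam \<in> partitions_in l k" "mu \<in> partitions_in l k" "nu \<in> partitions_in l k"
  shows "(schubert_class lam \<otimes>\<^bsub>R\<^esub> schubert_class mu) nu = quantum_coeff T l k lam mu nu"
proof -
  have "(\<Sum>b\<in>partitions_in l k. schubert_class lam a * schubert_class mu b * quantum_coeff T l k a b nu) =
      (if a = lam then quantum_coeff T l k lam mu nu else 0)" for a
    using assms(2) finite_partitions_in[of l k]
    by (simp add: schubert_class_def if_distrib[of "\<lambda>t. t * _"] if_distrib[of "\<lambda>t. _ * t"] cong: if_cong)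
  then show ?thesis using assms finite_partitions_in[of l k] by (simp add: mult_eval)
qed

text \<open>Entries of the determinant can have index p > k. Then both sides vanish: the class is 0
  by convention, and a strip on mu inside the rectangle has at most \<open>nu ! 0\<close>, hence at
  most k, boxes.\<close>

lemma special_mult_eval:
  assumes "mu \<in> partitions_in l k" "mu ! (l - 1) = 0" "nu \<in> partitions_in l k"
  shows "(special_class l k (int p) \<otimes>\<^bsub>R\<^esub> schubert_class mu) nu =
    (if p + sum_list mu = sum_list nu \<and> horizontal_strip mu nu then 1 else 0)"
proof (cases "p \<le> k")
  case True
  then have "special_class l k (int p) = schubert_class (p # replicate (l - 1) 0)"
    by (simp add: special_class_def)
  then show ?thesis
    using schubert_class_mult_eval[OF special_partition[OF True] assms(1,3)]
      quantum_coeff_special[OF card_n l_pos True assms(1,3,2), of T] by simp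
next
  case False
  then have "special_class l k (int p) = \<zero>\<^bsub>R\<^esub>"
    by (auto simp: special_class_def fun_eq_iff zero_eval)
  then have "(special_class l k (int p) \<otimes>\<^bsub>R\<^esub> schubert_class mu) nu = 0"
    using schubert_class_carrier[OF assms(1)] by (simp add: zero_eval)
  moreover have "\<not> (p + sum_list mu = sum_list nu \<and> horizontal_strip mu nu)"
  proof
    assume "p + sum_list mu = sum_list nu \<and> horizontal_strip mu nu"
    then have "p \<le> nu ! 0"
      using horizontal_strip_sum_le[of mu nu l] partitions_in_length assms l_pos by auto
    then show False using partitions_in_nth_le[OF assms(3), of 0] l_pos False by simp
  qed
  ultimately show ?thesis by simp
qed

text \<open>The size m is kept separate from l so that the minors fall under the induction
  hypothesis. If row m + 1 of lam is empty, the last row of the matrix is 0, ..., 0, 1; otherwise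
  the minors belong to the partitions \<open>mu i\<close> and the Pieri rule applies.\<close>

lemma giambelli_rows:
  assumes "m \<le> l" "lam \<in> partitions_in l k" "\<And>j. j < l \<Longrightarrow> m \<le> j \<Longrightarrow> lam ! j = 0"
  shows "ring_det R m (\<lambda>i j. special_class l k (int (lam ! (i - 1)) + int j - int i)) = schubert_class lam"
  using assms
proof (induction m arbitrary: lam)
  case 0
  then have "lam = replicate l 0" by (auto simp: list_eq_iff_nth_eq partitions_in_length)
  moreover have "ring_det R 0 (\<lambda>i j. special_class l k (int (lam ! (i - 1)) + int j - int i)) nu = \<one>\<^bsub>R\<^esub> nu" for nu
    by (subst ring_det_eval) (auto simp: sign_id)
  ultimately show ?case by (auto simp: one_eq fun_eq_iff)
next
  case (Suc m)
  let ?A = "\<lambda>i j. special_class l k (int (lam ! (i - 1)) + int j - int i)"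
  have carr: "?A i j \<in> carrier R" for i j by (rule special_class_carrier)
  show ?case
  proof (cases "lam ! m = 0")
    case True
    show ?thesis
    proof
      fix nu
      have tail: "lam ! j = 0" if "j < l" "m \<le> j" for j
        using Suc.prems(3)[of j] True that by (cases "j = m") auto
      \<comment> \<open>For i <= m the last row of the minor is row m + 1 of the matrix, whose
        indices j - (m + 1) are negative for j <= m.\<close>
      have zero: "ring_det R m (\<lambda>i' j. ?A (skip i i') j) = \<zero>\<^bsub>R\<^esub>" if "i \<in> {1..m}" for i
      proof (rule ring_det_zero_row[where r = m])
        show "?A (skip i m) j = \<zero>\<^bsub>R\<^esub>" if "j \<in> {1..m}" for j
          using that \<open>i \<in> {1..m}\<close> True by (intro special_class_neg) (auto simp: skip_def)
      qed (use carr that in auto)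
      have "ring_det R (Suc m) ?A nu = (\<Sum>i\<in>{1..Suc m}. (- 1) ^ (Suc m - i) *
          (?A i (Suc m) \<otimes>\<^bsub>R\<^esub> ring_det R m (\<lambda>i' j. ?A (skip i i') j)) nu)"
        using carr by (rule ring_det_last_column)
      also have "\<dots> = (?A (Suc m) (Suc m) \<otimes>\<^bsub>R\<^esub> ring_det R m (\<lambda>i' j. ?A (skip (Suc m) i') j)) nu"
      proof -
        have "(- 1) ^ (Suc m - i) * (?A i (Suc m) \<otimes>\<^bsub>R\<^esub> ring_det R m (\<lambda>i' j. ?A (skip i i') j)) nu = 0"
          if "i \<in> {1..m}" for i
          using zero[OF that] carr[of i "Suc m"] by (simp add: zero_eval)
        then show ?thesis by (simp add: atLeastAtMostSuc_conv)
      qed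
      also have "?A (Suc m) (Suc m) = \<one>\<^bsub>R\<^esub>" using True special_class_0 by simp
      also have "ring_det R m (\<lambda>i' j. ?A (skip (Suc m) i') j) = ring_det R m ?A"
        using carr by (intro ring_det_cong) (auto simp: skip_def)
      also have "ring_det R m ?A = schubert_class lam"
        using Suc.IH[of lam] Suc.prems tail by auto
      also have "\<one>\<^bsub>R\<^esub> \<otimes>\<^bsub>R\<^esub> schubert_class lam = schubert_class lam"
        using schubert_class_carrier[OF Suc.prems(2)] by simp
      finally show "ring_det R (Suc m) ?A nu = schubert_class lam nu" .
    qed
  next
    case False
    interpret deletable_rows lam l k m
      by unfold_locales (use Suc.prems False in auto)
    show ?thesis
    proof
      fix nu
      show "ring_det R (Suc m) ?A nu = schubert_class lam nu"
      proof (cases "nu \<in> partitions_in l k")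
        case nu: False
        have "ring_det R (Suc m) ?A \<in> carrier R" using carr by (rule ring_det_carrier)
        then show ?thesis using nu schubert_class_carrier[OF Suc.prems(2)] by (simp add: carrier_iff)
      next
        case nu: True
        have minor: "ring_det R m (\<lambda>i' j. ?A (skip i i') j) = schubert_class (mu i)" if i: "i \<in> {1..Suc m}" for i
        proof -
          have "ring_det R m (\<lambda>i' j. ?A (skip i i') j) =
              ring_det R m (\<lambda>i' j. special_class l k (int (mu i ! (i' - 1)) + int j - int i'))"
          proof (rule ring_det_cong)
            fix i' j assume i': "i' \<in> {1..m}" "j \<in> {1..m}"
            \<comment> \<open>Below the deleted row both the row number and the part drop by one, so
              the index of the special class is unchanged. The parts there are positive, which makes
              the subtraction in \<open>delete_row\<close> genuine.\<close>
            have "int (lam ! (skip i i' - 1)) - int (skip i i') = int (mu i ! (i' - 1)) - int i'"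
            proof (cases "i' < i")
              case True
              then have "skip i i' = i'" "Suc (i' - 1) < i" "i' - 1 < l" using i' m by (auto simp: skip_def)
              then show ?thesis using mu_nth[of "i' - 1" i] by simp
            next
              case False
              then have "skip i i' = Suc i'" "\<not> Suc (i' - 1) < i" "Suc (i' - 1) = i'" "i' - 1 < m" "i' - 1 < l"
                using i' m by (auto simp: skip_def)
              moreover have "1 \<le> lam ! i'" using lam_pos[of i'] i' by simp
              ultimately show ?thesis using mu_nth[of "i' - 1" i] by (simp add: of_nat_diff)
            qed
            then show "?A (skip i i') j = special_class l k (int (mu i ! (i' - 1)) + int j - int i')"
              by (intro arg_cong[where f = "special_class l k"]) linarith
          qed (rule carr)
          also have "\<dots> = schubert_class (mu i)"
            using i m mu_partition(1)[of i] by (intro Suc.IH) (auto simp: mu_nth)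
          finally show ?thesis .
        qed
        have "ring_det R (Suc m) ?A nu = (\<Sum>i\<in>{1..Suc m}. (- 1) ^ (Suc m - i) *
            (?A i (Suc m) \<otimes>\<^bsub>R\<^esub> ring_det R m (\<lambda>i' j. ?A (skip i i') j)) nu)"
          using carr by (rule ring_det_last_column)
        also have "\<dots> = (\<Sum>i\<in>{1..Suc m}. (- 1) ^ (Suc m - i) *
            (if sum_list nu = sum_list lam \<and> horizontal_strip (mu i) nu then 1 else 0))"
        proof (intro sum.cong refl arg_cong2[where f = "(*)"])
          fix i assume i: "i \<in> {1..Suc m}"
          have "int (lam ! (i - 1)) + int (Suc m) - int i = int (lam ! (i - 1) + (Suc m - i))"
            using i by auto
          moreover have "lam ! (i - 1) + (Suc m - i) + sum_list (mu i) = sum_list lam"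
            using mu_sum[of i] i by simp
          ultimately show "(?A i (Suc m) \<otimes>\<^bsub>R\<^esub> ring_det R m (\<lambda>i' j. ?A (skip i i') j)) nu =
              (if sum_list nu = sum_list lam \<and> horizontal_strip (mu i) nu then 1 else 0)"
            using special_mult_eval[OF mu_partition nu, of i "lam ! (i - 1) + (Suc m - i)"] minor[OF i] i
            by (auto simp del: of_nat_add)
        qed
        also have "\<dots> = schubert_class lam nu"
        proof (cases "sum_list nu = sum_list lam")
          case True
          then show ?thesis
            using alternating_strips[OF partitions_in_length[OF nu] True] by (simp add: schubert_class_def)
        next
          case False
          then show ?thesis by (auto simp: schubert_class_def)
        qed
        finally show ?thesis .
      qed
    qed
  qed
qed

end

theorem theorem2:
  fixes l k :: nat and lam :: "nat list"
  assumes "l \<ge> 1" and "k \<ge> 1"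
    and "CARD('n::{finite,linorder}) = l + k"
    and "cring (QH TYPE('n) l k)"
    and "lam \<in> partitions_in l k"
  shows "schubert_class lam =
    ring_det (QH TYPE('n) l k) l (\<lambda>i j. special_class l k (int (lam ! (i - 1)) + int j - int i))"
proof -
  interpret quantum_cohomology "TYPE('n)" l k
    by (rule quantum_cohomology.intro) (use assms in simp_all)
  show ?thesis using giambelli_rows[OF order_refl assms(5)] by simp
qed

end
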